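(* Let $\{\pi,\mathcal H_\pi\}$ be an irreducible unitary representation of a locally compact group $G$. The following are equivalent: (i) $\{\pi,\mathcal H_\pi\}$ has an admissible vector. (ii) $\{\pi,\mathcal H_\pi\}$ is (unitarily) equivalent to an irreducible subrepresentation $\{\lambda_{|\mathcal H_0},\mathcal H_0\}$ of the left regular representation $\lambda$ of $G$ such that $\mathcal H_0\cap\mathcal D^\flat\neq\{0\}$. In such case, with $\mathcal H_0$ as in (ii), $\mathcal H_0\cap\mathcal E'$ consists of a single element $e$, and $e$ is an admissible vector for $\{\lambda_{|\mathcal H_0},\mathcal H_0\}$.
   Context: $G$ is a locally compact group with fixed left Haar measure $ds$ and modular function $\delta_G$ (so $d(st)=\delta_G(t)\,ds$, $d(s^{-1})=\delta_G(s^{-1})\,ds$). $C_c(G)$ is the space of complex continuous compactly supported functions; $L^2(G)$ is taken with respect to $ds$. A unitary representation $\{\pi,\mathcal H_\pi\}$ is a strongly continuous homomorphism from $G$ into the unitary operators of a nonzero Hilbert space $\mathcal H_\pi$, with inner product $(\cdot|\cdot)$ linear in the first variable. For $\eta,\psi\in\mathcal H_\pi$, $[L_\eta\psi](s):=(\psi|\pi(s)\eta)$. The vector $\eta$ is admissible for $\{\pi,\mathcal H_\pi\}$ if $L_\eta$ is a bounded map $\mathcal H_\pi\to L^2(G)$ with $L_\eta^*L_\eta=I_{\mathcal H_\pi}$. The left regular representation is $[\lambda(s)f](t):=f(s^{-1}t)$ on $L^2(G)$; a subrepresentation is the restriction $\lambda_{|\mathcal H_0}$ to a nonzero closed $\lambda$-invariant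 subspace $\mathcal H_0$. Convolution: $[f\ast g](s):=\int_G f(t)g(t^{-1}s)\,dt$. Involution: $f^\flat(s):=\overline{f(s^{-1})}$, with domain $\mathcal D^\flat:=\{f\in L^2(G):\int_G\delta_G^{-1}(s)|f(s)|^2\,ds<\infty\}$. A vector $g\in L^2(G)$ is right bounded if $\sup\{\|f\ast g\|_{L^2}:f\in C_c(G),\|f\|_{L^2}\le 1\}<\infty$; $\mathcal B'$ is the set of right bounded vectors and $\mathcal U':=\mathcal B'\cap\mathcal D^\flat$. $\mathcal E'$ is the set of nonzero $e\in\mathcal U'$ with $e=e^\flat=e\ast e$. *)

theory Defs
  imports "HOL-Analysis.Analysis"
begin

section \<open>Complex Hilbert spaces\<close>

text \<open>The inner product is linear in the \<^emph>\<open>first\<close> variable. The underlying real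
  Hilbert space carries \<open>Re (cinner x y)\<close>, so norm and topology are those of the library.\<close>

class complex_inner = real_inner +
  fixes scaleC :: "complex \<Rightarrow> 'a \<Rightarrow> 'a"  (infixr \<open>*\<^sub>C\<close> 75)
    and cinner :: "'a \<Rightarrow> 'a \<Rightarrow> complex"
  assumes scaleC_add_right: "a *\<^sub>C (x + y) = a *\<^sub>C x + a *\<^sub>C y"
    and scaleC_add_left: "(a + b) *\<^sub>C x = a *\<^sub>C x + b *\<^sub>C x"
    and scaleC_scaleC: "a *\<^sub>C b *\<^sub>C x = (a * b) *\<^sub>C x"
    and scaleR_scaleC: "r *\<^sub>R x = complex_of_real r *\<^sub>C x"
    and cinner_commute: "cinner x y = cnj (cinner y x)"
    and cinner_add_left: "cinner (x + y) z = cinner x z + cinner y z"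
    and cinner_scaleC_left: "cinner (a *\<^sub>C x) y = a * cinner x y"
    and inner_eq_Re_cinner: "inner x y = Re (cinner x y)"

class complex_hilbert = complex_inner + complete_space

definition closed_csubspace :: "'h::complex_hilbert set \<Rightarrow> bool" where
  "closed_csubspace H \<longleftrightarrow> closed H \<and> 0 \<in> H \<and>
     (\<forall>x\<in>H. \<forall>y\<in>H. x + y \<in> H) \<and> (\<forall>a. \<forall>x\<in>H. a *\<^sub>C x \<in> H)"

definition clinear_on :: "'h::complex_hilbert set \<Rightarrow> ('h \<Rightarrow> 'k::complex_hilbert) \<Rightarrow> bool" where
  "clinear_on H T \<longleftrightarrow> (\<forall>x\<in>H. \<forall>y\<in>H. T (x + y) = T x + T y) \<and>
     (\<forall>a. \<forall>x\<in>H. T (a *\<^sub>C x) = a *\<^sub>C T x)"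

definition unitary_between ::
  "'h::complex_hilbert set \<Rightarrow> 'k::complex_hilbert set \<Rightarrow> ('h \<Rightarrow> 'k) \<Rightarrow> bool" where
  "unitary_between H K U \<longleftrightarrow> clinear_on H U \<and> bij_betw U H K \<and>
     (\<forall>x\<in>H. \<forall>y\<in>H. cinner (U x) (U y) = cinner x y)"

definition bounded_op_on :: "'h::complex_hilbert set \<Rightarrow> ('h \<Rightarrow> 'k::complex_hilbert) \<Rightarrow> bool" where
  "bounded_op_on H T \<longleftrightarrow> clinear_on H T \<and> (\<exists>C. \<forall>x\<in>H. norm (T x) \<le> C * norm x)"

definition is_adjoint_on ::
  "'h::complex_hilbert set \<Rightarrow> ('h \<Rightarrow> 'k::complex_hilbert) \<Rightarrow> ('k \<Rightarrow> 'h) \<Rightarrow> bool" where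
  "is_adjoint_on H T A \<longleftrightarrow> (\<forall>y. A y \<in> H) \<and> (\<forall>x\<in>H. \<forall>y. cinner (T x) y = cinner x (A y))"


section \<open>Locally compact groups with a left Haar measure\<close>

text \<open>The class \<^class>\<open>topological_group_add\<close> does not assume commutativity; the group
  \<open>G\<close> is written additively only because this is the notation of the library. So
  \<open>s + t\<close>, \<open>- s\<close>, \<open>0\<close> stand for $st$, $s^{-1}$, and the identity.

  The measure \<open>haar\<close> is a nonzero left-invariant Radon measure on the Borel sets. No
  countability is assumed of \<open>G\<close>, so the regularity conditions have to be part of the
  definition.\<close>

class locally_compact_group = topological_group_add + t2_space +
  fixes haar :: "'a measure"
  assumes locally_compact: "locally_compact_space (topology open)"
    and sets_haar_raw: "sets haar = sigma_sets UNIV {U. open U}"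
    and haar_left_invariant: "A \<in> sets haar \<Longrightarrow> emeasure haar ((+) s ` A) = emeasure haar A"
    and haar_nonzero: "emeasure haar UNIV \<noteq> 0"
    and haar_finite_compact: "compact K \<Longrightarrow> emeasure haar K < \<infinity>"
    and haar_outer_regular: "A \<in> sets haar \<Longrightarrow>
          emeasure haar A = (INF U\<in>{U. open U \<and> A \<subseteq> U}. emeasure haar U)"
    and haar_inner_regular: "open U \<Longrightarrow>
          emeasure haar U = (SUP K\<in>{K. compact K \<and> K \<subseteq> U}. emeasure haar K)"

lemma sets_haar [simp, measurable_cong]:
  "sets (haar :: 'g::locally_compact_group measure) = sets borel"
  by (simp add: sets_haar_raw borel_def)

lemma space_haar [simp]: "space (haar :: 'g::locally_compact_group measure) = UNIV"
  using sets_eq_imp_space_eq[OF sets_haar] by simp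

lemma measurable_haar_eq [simp]:
  "borel_measurable (haar :: 'g::locally_compact_group measure) = borel_measurable borel"
  by (rule measurable_cong_sets) simp_all

lemma translate_measurable [measurable]:
  "(\<lambda>t::'g::locally_compact_group. s + t) \<in> borel_measurable borel"
  by (intro borel_measurable_continuous_onI continuous_intros)

lemma distr_haar_translate:
  "distr haar haar ((+) s) = (haar :: 'g::locally_compact_group measure)"
proof (rule measure_eqI)
  fix A assume "A \<in> sets (distr haar haar ((+) s))"
  then have A: "A \<in> sets borel" by simp
  have vim: "(+) s -` A = (+) (- s) ` A"
    by (auto simp: image_iff) (metis minus_add_cancel)
  have "emeasure (distr haar haar ((+) s)) A = emeasure haar ((+) s -` A \<inter> space haar)"
    by (rule emeasure_distr) (use A in \<open>simp_all add: measurable_cong_sets[OF sets_haar sets_haar]\<close>)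
  also have "\<dots> = emeasure haar A"
    using haar_left_invariant[of A "- s"] A by (simp add: vim)
  finally show "emeasure (distr haar haar ((+) s)) A = emeasure haar A" .
qed simp

text \<open>$d(st) = \delta_G(t)\,ds$, that is $\mu(At) = \delta_G(t)\,\mu(A)$.\<close>

definition modular :: "'g::locally_compact_group \<Rightarrow> real" where
  "modular t = (THE c. 0 < c \<and> (\<forall>A\<in>sets (borel :: 'g measure).
     emeasure haar ((\<lambda>s. s + t) ` A) = ennreal c * emeasure haar A))"


section \<open>The Hilbert space of square-integrable functions\<close>

definition square_integrable :: "('g::locally_compact_group \<Rightarrow> complex) \<Rightarrow> bool" where
  "square_integrable f \<longleftrightarrow> f \<in> borel_measurable borel \<and> integrable haar (\<lambda>s. (cmod (f s))\<^sup>2)"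

definition l2_rel :: "('g::locally_compact_group \<Rightarrow> complex) \<Rightarrow> ('g \<Rightarrow> complex) \<Rightarrow> bool" where
  "l2_rel f g \<longleftrightarrow> square_integrable f \<and> square_integrable g \<and> (AE s in haar. f s = g s)"

lemma square_integrable_zero: "square_integrable (\<lambda>_. 0)"
  by (simp add: square_integrable_def)

lemma l2_rel_refl: "l2_rel f f \<longleftrightarrow> square_integrable f"
  by (simp add: l2_rel_def)

quotient_type (overloaded) 'g l2 = "'g::locally_compact_group \<Rightarrow> complex" / partial: l2_rel
proof (rule part_equivpI)
  show "\<exists>f. l2_rel f f"
    using square_integrable_zero l2_rel_refl by blast
  show "symp l2_rel"
    by (rule sympI) (auto simp: l2_rel_def eq_commute)
  show "transp l2_rel"
    by (rule transpI) (auto simp: l2_rel_def elim: AE_mp)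
qed

lemma square_integrable_add:
  assumes "square_integrable f" "square_integrable g"
  shows "square_integrable (\<lambda>s. f s + g s)"
proof -
  have m [measurable]: "f \<in> borel_measurable borel" "g \<in> borel_measurable borel"
    using assms by (auto simp: square_integrable_def)
  have "integrable haar (\<lambda>s. (cmod (f s + g s))\<^sup>2)"
  proof (rule Bochner_Integration.integrable_bound)
    show "integrable haar (\<lambda>s. 2 * (cmod (f s))\<^sup>2 + 2 * (cmod (g s))\<^sup>2)"
      using assms by (auto simp: square_integrable_def)
    show "AE s in haar. norm ((cmod (f s + g s))\<^sup>2)
            \<le> norm (2 * (cmod (f s))\<^sup>2 + 2 * (cmod (g s))\<^sup>2)"
    proof (rule AE_I2)
      fix s
      have "(cmod (f s + g s))\<^sup>2 \<le> (cmod (f s) + cmod (g s))\<^sup>2"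
        by (intro power_mono norm_triangle_ineq) auto
      also have "\<dots> \<le> 2 * (cmod (f s))\<^sup>2 + 2 * (cmod (g s))\<^sup>2"
        using zero_le_power2[of "cmod (f s) - cmod (g s)"]
        by (simp add: power2_eq_square algebra_simps)
      finally show "norm ((cmod (f s + g s))\<^sup>2)
          \<le> norm (2 * (cmod (f s))\<^sup>2 + 2 * (cmod (g s))\<^sup>2)" by simp
    qed
  qed simp
  then show ?thesis by (simp add: square_integrable_def)
qed

lemma square_integrable_scale:
  assumes "square_integrable f"
  shows "square_integrable (\<lambda>s. c * f s)"
  using assms by (auto simp: square_integrable_def norm_mult power_mult_distrib)

lemma square_integrable_product:
  assumes "square_integrable f" "square_integrable g"
  shows "integrable haar (\<lambda>s. f s * cnj (g s))"
proof (rule Bochner_Integration.integrable_bound)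
  have m [measurable]: "f \<in> borel_measurable borel" "g \<in> borel_measurable borel"
    using assms by (auto simp: square_integrable_def)
  show "integrable haar (\<lambda>s. (cmod (f s))\<^sup>2 + (cmod (g s))\<^sup>2)"
    using assms by (auto simp: square_integrable_def)
  show "AE s in haar. norm (f s * cnj (g s)) \<le> norm ((cmod (f s))\<^sup>2 + (cmod (g s))\<^sup>2)"
  proof (rule AE_I2)
    fix s
    have "2 * (cmod (f s) * cmod (g s)) \<le> (cmod (f s))\<^sup>2 + (cmod (g s))\<^sup>2"
      using sum_squares_bound[of "cmod (f s)" "cmod (g s)"] by (simp add: mult.assoc)
    moreover have "0 \<le> cmod (f s) * cmod (g s)" by simp
    ultimately have "cmod (f s) * cmod (g s) \<le> (cmod (f s))\<^sup>2 + (cmod (g s))\<^sup>2" by linarith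
    then show "norm (f s * cnj (g s)) \<le> norm ((cmod (f s))\<^sup>2 + (cmod (g s))\<^sup>2)"
      by (simp add: norm_mult)
  qed
  have "(\<lambda>s. cnj (g s)) \<in> borel_measurable borel"
    by (rule borel_measurable_continuous_on[OF _ m(2)]) (intro continuous_intros)
  then show "(\<lambda>s. f s * cnj (g s)) \<in> borel_measurable haar" by simp
qed

instantiation l2 :: (locally_compact_group) complex_inner
begin

lift_definition zero_l2 :: "'a l2" is "\<lambda>_. 0"
  by (simp add: l2_rel_refl square_integrable_zero)

lift_definition plus_l2 :: "'a l2 \<Rightarrow> 'a l2 \<Rightarrow> 'a l2" is "\<lambda>f g s. f s + g s"
  by (auto simp: l2_rel_def square_integrable_add)

lift_definition scaleC_l2 :: "complex \<Rightarrow> 'a l2 \<Rightarrow> 'a l2" is "\<lambda>a f s. a * f s"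
  by (auto simp: l2_rel_def square_integrable_scale)

lift_definition cinner_l2 :: "'a l2 \<Rightarrow> 'a l2 \<Rightarrow> complex"
  is "\<lambda>f g. \<integral>s. f s * cnj (g s) \<partial>haar"
  by (rule integral_cong_AE)
     (auto simp: l2_rel_def dest: square_integrable_product intro: borel_measurable_integrable)

definition "scaleR_l2 r (f :: 'a l2) = complex_of_real r *\<^sub>C f"
definition "uminus_l2 (f :: 'a l2) = (- 1) *\<^sub>C f"
definition "minus_l2 (f :: 'a l2) g = f + - g"
definition "inner_l2 (f :: 'a l2) g = Re (cinner f g)"
definition "norm_l2 (f :: 'a l2) = sqrt (inner f f)"
definition "dist_l2 (f :: 'a l2) g = norm (f - g)"
definition "sgn_l2 (f :: 'a l2) = inverse (norm f) *\<^sub>R f"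
definition "uniformity_l2 = (INF e\<in>{0 <..}. principal {(f :: 'a l2, g). dist f g < e})"
definition "open_l2 (U :: 'a l2 set) \<longleftrightarrow>
  (\<forall>x\<in>U. eventually (\<lambda>(x', y). x' = x \<longrightarrow> y \<in> U) uniformity)"

instance
proof
  fix f g h :: "'a l2" and a b :: complex and r r' :: real
  show add_assoc: "f + g + h = f + (g + h)"
    by transfer (simp add: l2_rel_def square_integrable_add add.assoc)
  show "f + g = g + f"
    by transfer (simp add: l2_rel_def square_integrable_add add.commute)
  show "0 + f = f"
    by transfer (simp add: l2_rel_def)
  show "- f + f = 0" unfolding uminus_l2_def
    by transfer (simp add: l2_rel_def square_integrable_zero)
  show "f - g = f + - g" by (simp add: minus_l2_def)
  show C1: "a *\<^sub>C (f + g) = a *\<^sub>C f + a *\<^sub>C g" for a :: complex and f g :: "'a l2"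
    by transfer (simp add: l2_rel_def square_integrable_add square_integrable_scale distrib_left)
  show C2: "(a + b) *\<^sub>C f = a *\<^sub>C f + b *\<^sub>C f" for a b :: complex and f :: "'a l2"
    by transfer (simp add: l2_rel_def square_integrable_add square_integrable_scale distrib_right)
  show C3: "a *\<^sub>C b *\<^sub>C f = (a * b) *\<^sub>C f" for a b :: complex and f :: "'a l2"
    by transfer (simp add: l2_rel_def square_integrable_scale mult.assoc)
  have C4: "1 *\<^sub>C f = f"
    by transfer (simp add: l2_rel_def)
  show "r *\<^sub>R f = complex_of_real r *\<^sub>C f" by (simp add: scaleR_l2_def)
  show "r *\<^sub>R (f + g) = r *\<^sub>R f + r *\<^sub>R g" by (simp add: scaleR_l2_def C1)
  show "(r + r') *\<^sub>R f = r *\<^sub>R f + r' *\<^sub>R f" by (simp add: scaleR_l2_def C2)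
  show "r *\<^sub>R r' *\<^sub>R f = (r * r') *\<^sub>R f" by (simp add: scaleR_l2_def C3)
  show "1 *\<^sub>R f = f" by (simp add: scaleR_l2_def C4)
  show I1: "cinner f g = cnj (cinner g f)" for f g :: "'a l2"
    by transfer (simp flip: Bochner_Integration.integral_cnj add: mult.commute)
  show I2: "cinner (f + g) h = cinner f h + cinner g h" for f g h :: "'a l2"
    by transfer (simp add: distrib_right l2_rel_refl square_integrable_product)
  show I3: "cinner (a *\<^sub>C f) g = a * cinner f g" for a :: complex and f g :: "'a l2"
    by transfer (simp add: mult.assoc l2_rel_refl square_integrable_product)
  show "inner f g = Re (cinner f g)" by (simp add: inner_l2_def)
  show "inner f g = inner g f" unfolding inner_l2_def by (subst I1) simp
  show "inner (f + g) h = inner f h + inner g h" by (simp add: inner_l2_def I2)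
  show "inner (r *\<^sub>R f) g = r * inner f g" by (simp add: inner_l2_def scaleR_l2_def I3)
  show "norm f = sqrt (inner f f)" by (simp add: norm_l2_def)
  show "dist f g = norm (f - g)" by (simp add: dist_l2_def)
  show "sgn f = inverse (norm f) *\<^sub>R f" by (simp add: sgn_l2_def)
  show "uniformity = (INF e\<in>{0 <..}. principal {(f :: 'a l2, g). dist f g < e})"
    by (simp add: uniformity_l2_def)
  show "open U \<longleftrightarrow> (\<forall>x\<in>U. eventually (\<lambda>(x', y). x' = x \<longrightarrow> y \<in> U) uniformity)" for U :: "'a l2 set"
    by (simp add: open_l2_def)
  have sq: "cinner f f = complex_of_real (\<integral>s. (cmod (rep_l2 f s))\<^sup>2 \<partial>haar)"
    unfolding cinner_l2_def
    by (simp add: complex_norm_square[symmetric] del: of_real_power)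
  show "0 \<le> inner f f" unfolding inner_l2_def sq by simp
  show "inner f f = 0 \<longleftrightarrow> f = 0"
  proof
    assume "f = 0"
    moreover have "(0 :: 'a l2) + 0 = 0"
      by transfer (simp add: l2_rel_refl square_integrable_zero)
    ultimately show "inner f f = 0"
      using I2[of 0 0 f] by (simp add: inner_l2_def)
  next
    assume "inner f f = 0"
    then have 0: "(\<integral>s. (cmod (rep_l2 f s))\<^sup>2 \<partial>haar) = 0"
      unfolding inner_l2_def sq by simp
    have si: "square_integrable (rep_l2 f)"
      using Quotient3_rep_reflp[OF Quotient3_l2] by (simp add: l2_rel_refl)
    then have "AE s in haar. (cmod (rep_l2 f s))\<^sup>2 = 0"
      using integral_nonneg_eq_0_iff_AE[of haar "\<lambda>s. (cmod (rep_l2 f s))\<^sup>2"] 0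
      by (auto simp: square_integrable_def)
    then have "l2_rel (rep_l2 f) (\<lambda>_. 0)"
      using si by (simp add: l2_rel_def square_integrable_zero)
    then have "abs_l2 (rep_l2 f) = abs_l2 (\<lambda>_. 0)"
      using Quotient3_rel_abs[OF Quotient3_l2] by blast
    then show "f = 0"
      using Quotient3_abs_rep[OF Quotient3_l2, of f] by (simp add: zero_l2_def)
  qed
qed

end

lemma square_integrable_rep: "square_integrable (rep_l2 f)"
  using Quotient3_rep_reflp[OF Quotient3_l2] by (simp add: l2_rel_refl)

lemma abs_rep_l2 [simp]: "abs_l2 (rep_l2 f) = f"
  using Quotient3_abs_rep[OF Quotient3_l2] .

lemma AE_rep_abs_l2:
  assumes "square_integrable f"
  shows "AE s in haar. rep_l2 (abs_l2 f) s = f s"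
proof -
  have "l2_rel (rep_l2 (abs_l2 f)) f"
    using assms by (metis rep_abs_rsp_left[OF Quotient3_l2] l2_rel_refl)
  then show ?thesis by (simp add: l2_rel_def)
qed

lemma norm_abs_l2:
  assumes "square_integrable f"
  shows "norm (abs_l2 f) = sqrt (\<integral>s. (cmod (f s))\<^sup>2 \<partial>haar)"
  using assms
  by (simp add: norm_l2_def inner_l2_def cinner_l2.abs_eq l2_rel_refl
      complex_norm_square[symmetric] del: of_real_power)

lemma diff_abs_l2:
  assumes "square_integrable f" "square_integrable g"
  shows "abs_l2 f - abs_l2 g = abs_l2 (\<lambda>s. f s - g s)"
  using assms square_integrable_scale[of g "- 1"]
  by (simp add: minus_l2_def uminus_l2_def scaleC_l2.abs_eq plus_l2.abs_eq l2_rel_refl)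

lemma square_integrable_diff:
  assumes "square_integrable f" "square_integrable g"
  shows "square_integrable (\<lambda>s. f s - g s)"
  using square_integrable_add[OF assms(1) square_integrable_scale[OF assms(2), of "- 1"]] by simp

lemma nn_integral_square:
  assumes "square_integrable f"
  shows "(\<integral>\<^sup>+s. ennreal ((cmod (f s))\<^sup>2) \<partial>haar) = ennreal ((norm (abs_l2 f))\<^sup>2)"
  using assms by (simp add: norm_abs_l2 square_integrable_def nn_integral_eq_integral)

instance l2 :: (locally_compact_group) complex_hilbert
proof
  fix X :: "nat \<Rightarrow> 'a l2" assume X: "Cauchy X"
  have "\<exists>N. \<forall>m\<ge>N. \<forall>n\<ge>N. norm (X m - X n) < (1/4)^k" for k :: nat
    using CauchyD[OF X, of "(1/4)^k"] by simp
  then obtain N where N: "\<And>k m n. m \<ge> N k \<Longrightarrow> n \<ge> N k \<Longrightarrow> norm (X m - X n) < (1/4)^k"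
    by metis
  define r where "r k = k + (\<Sum>i\<le>k. N i)" for k
  have r_ge: "N k \<le> r n" if "k \<le> n" for k n
  proof -
    have "N k \<le> (\<Sum>i\<le>n. N i)"
      by (rule member_le_sum) (use that in auto)
    then show ?thesis by (simp add: r_def)
  qed
  have r_mono: "strict_mono r"
    by (rule strict_monoI_Suc) (simp add: r_def)
  define u where "u k = rep_l2 (X (r k))" for k
  have u_si: "square_integrable (u k)" for k by (simp add: u_def square_integrable_rep)
  then have um [measurable]: "u k \<in> borel_measurable borel" for k
    by (simp add: square_integrable_def)
  have dist_u: "(\<integral>\<^sup>+s. ennreal ((cmod (u m s - u n s))\<^sup>2) \<partial>haar) \<le> ennreal (((1/4)^k)\<^sup>2)"
    if "k \<le> m" "k \<le> n" for k m n
  proof -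
    have "norm (abs_l2 (\<lambda>s. u m s - u n s)) = norm (X (r m) - X (r n))"
      using diff_abs_l2[OF u_si u_si, of m n] by (simp add: u_def)
    also have "\<dots> \<le> (1/4)^k" using N[OF r_ge r_ge] that by (meson less_imp_le)
    finally show ?thesis
      by (subst nn_integral_square) (auto intro!: ennreal_leI power_mono square_integrable_diff u_si)
  qed
  have AE_conv: "AE s in haar. convergent (\<lambda>k. u k s)"
  proof -
    have "(\<integral>\<^sup>+s. (\<Sum>k. ennreal (4^k * (cmod (u (Suc k) s - u k s))\<^sup>2)) \<partial>haar)
        = (\<Sum>k. \<integral>\<^sup>+s. ennreal (4^k * (cmod (u (Suc k) s - u k s))\<^sup>2) \<partial>haar)"
      by (rule nn_integral_suminf) simp
    also have "\<dots> \<le> (\<Sum>k. ennreal ((1/4)^k))"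
    proof (rule suminf_le)
      fix k
      have "(\<integral>\<^sup>+s. ennreal (4^k * (cmod (u (Suc k) s - u k s))\<^sup>2) \<partial>haar)
         = ennreal (4^k) * (\<integral>\<^sup>+s. ennreal ((cmod (u (Suc k) s - u k s))\<^sup>2) \<partial>haar)"
        by (subst nn_integral_cmult[symmetric]) (auto simp: ennreal_mult)
      also have "\<dots> \<le> ennreal (4^k) * ennreal (((1/4)^k)\<^sup>2)"
        by (intro mult_left_mono dist_u) auto
      also have "\<dots> = ennreal (4^k * ((1/4)^k)\<^sup>2)"
        by (rule ennreal_mult[symmetric]) auto
      also have "(4::real)^k * ((1/4)^k)\<^sup>2 = (1/4)^k"
        by (simp add: power2_eq_square power_one_over)
      finally show "(\<integral>\<^sup>+s. ennreal (4^k * (cmod (u (Suc k) s - u k s))\<^sup>2) \<partial>haar)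
         \<le> ennreal ((1/4)^k)" .
    qed auto
    also have "\<dots> = ennreal (\<Sum>k. (1/4)^k)"
      by (rule suminf_ennreal2) (auto intro: summable_geometric)
    also have "\<dots> < \<infinity>" by simp
    finally have "(\<integral>\<^sup>+s. (\<Sum>k. ennreal (4^k * (cmod (u (Suc k) s - u k s))\<^sup>2)) \<partial>haar) \<noteq> \<infinity>"
      by simp
    then have "AE s in haar. (\<Sum>k. ennreal (4^k * (cmod (u (Suc k) s - u k s))\<^sup>2)) \<noteq> \<infinity>"
      by (intro nn_integral_PInf_AE) simp_all
    then show ?thesis
    proof (rule AE_mp, intro AE_I2 impI)
      fix s
      assume fin: "(\<Sum>k. ennreal (4^k * (cmod (u (Suc k) s - u k s))\<^sup>2)) \<noteq> \<infinity>"
      define S where "S = enn2real (\<Sum>k. ennreal (4^k * (cmod (u (Suc k) s - u k s))\<^sup>2))"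
      have S: "ennreal S = (\<Sum>k. ennreal (4^k * (cmod (u (Suc k) s - u k s))\<^sup>2))"
        using fin by (simp add: S_def less_top)
      have S0: "0 \<le> S" by (simp add: S_def)
      have four: "(2 ^ k)\<^sup>2 = (4::real) ^ k" for k :: nat
        by (simp add: power2_eq_square flip: power_mult_distrib)
      have bound: "cmod (u (Suc k) s - u k s) \<le> sqrt S * (1/2)^k" for k
      proof -
        let ?g = "\<lambda>k. ennreal (4^k * (cmod (u (Suc k) s - u k s))\<^sup>2)"
        have "sum ?g {k} \<le> suminf ?g"
          by (rule sum_le_suminf) simp_all
        then have "?g k \<le> ennreal S"
          unfolding S by (simp only: sum.insert sum.empty finite.emptyI empty_iff add_0_right simp_thms)
        then have "4^k * (cmod (u (Suc k) s - u k s))\<^sup>2 \<le> S"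
          by (simp only: ennreal_le_iff[OF S0])
        then have "(2^k * cmod (u (Suc k) s - u k s))\<^sup>2 \<le> S"
          by (simp add: power_mult_distrib four)
        then have "2^k * cmod (u (Suc k) s - u k s) \<le> sqrt S"
          by (rule real_le_rsqrt)
        then show ?thesis by (simp add: power_one_over divide_simps mult.commute)
      qed
      have "summable (\<lambda>k. u (Suc k) s - u k s)"
        by (rule summable_comparison_test'[where g = "\<lambda>k. sqrt S * (1/2)^k" and N = 0])
           (auto intro!: summable_mult summable_geometric bound)
      then have "convergent (\<lambda>n. \<Sum>k<n. u (Suc k) s - u k s)"
        by (simp add: summable_iff_convergent)
      then have "convergent (\<lambda>n. (u n s - u 0 s) + u 0 s)"
        unfolding sum_lessThan_telescope[of "\<lambda>k. u k s"] by (intro convergent_add convergent_const)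
      then show "convergent (\<lambda>k. u k s)" by simp
    qed
  qed
  define f where "f s = lim (\<lambda>k. u k s)" for s
  have fm [measurable]: "f \<in> borel_measurable borel"
    unfolding f_def using borel_measurable_lim_metric[of u haar] um by simp
  have f_dist: "(\<integral>\<^sup>+s. ennreal ((cmod (f s - u n s))\<^sup>2) \<partial>haar) \<le> ennreal (((1/4)^n)\<^sup>2)" for n
  proof -
    have "(\<integral>\<^sup>+s. ennreal ((cmod (f s - u n s))\<^sup>2) \<partial>haar)
        = (\<integral>\<^sup>+s. liminf (\<lambda>m. ennreal ((cmod (u m s - u n s))\<^sup>2)) \<partial>haar)"
    proof (rule nn_integral_cong_AE, rule AE_mp[OF AE_conv], intro AE_I2 impI)
      fix s assume "convergent (\<lambda>k. u k s)"
      then have "(\<lambda>k. u k s) \<longlonglongrightarrow> f s" by (simp add: f_def convergent_LIMSEQ_iff)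
      then have "(\<lambda>m. ennreal ((cmod (u m s - u n s))\<^sup>2)) \<longlonglongrightarrow> ennreal ((cmod (f s - u n s))\<^sup>2)"
        by (intro tendsto_intros)
      then show "ennreal ((cmod (f s - u n s))\<^sup>2)
          = liminf (\<lambda>m. ennreal ((cmod (u m s - u n s))\<^sup>2))"
        by (intro lim_imp_Liminf[symmetric] sequentially_bot)
    qed
    also have "\<dots> \<le> liminf (\<lambda>m. \<integral>\<^sup>+s. ennreal ((cmod (u m s - u n s))\<^sup>2) \<partial>haar)"
      by (rule nn_integral_liminf) simp
    also have "\<dots> \<le> liminf (\<lambda>m::nat. ennreal (((1/4)^n)\<^sup>2))"
      by (rule Liminf_mono) (auto simp: eventually_sequentially intro!: exI[of _ n] dist_u)
    also have "\<dots> = ennreal (((1/4)^n)\<^sup>2)" by (simp add: Liminf_const)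
    finally show ?thesis .
  qed
  have fu: "square_integrable (\<lambda>s. f s - u n s)" for n
  proof -
    have "integrable haar (\<lambda>s. (cmod (f s - u n s))\<^sup>2)"
    proof (rule integrableI_bounded)
      have "(\<integral>\<^sup>+s. ennreal (norm ((cmod (f s - u n s))\<^sup>2)) \<partial>haar) \<le> ennreal (((1/4)^n)\<^sup>2)"
        using f_dist[of n] by simp
      also have "\<dots> < \<infinity>" by simp
      finally show "(\<integral>\<^sup>+s. ennreal (norm ((cmod (f s - u n s))\<^sup>2)) \<partial>haar) < \<infinity>" .
    qed simp
    then show ?thesis by (simp add: square_integrable_def)
  qed
  have f: "square_integrable f"
    using square_integrable_add[OF fu[of 0] u_si[of 0]] by simp
  have le: "norm (X (r n) - abs_l2 f) \<le> (1/4)^n" for n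
  proof -
    have "norm (X (r n) - abs_l2 f) = norm (abs_l2 f - abs_l2 (u n))"
      by (simp add: u_def norm_minus_commute)
    also have "\<dots> = norm (abs_l2 (\<lambda>s. f s - u n s))" by (simp add: diff_abs_l2 f u_si)
    finally have eq: "norm (X (r n) - abs_l2 f) = norm (abs_l2 (\<lambda>s. f s - u n s))" .
    have "ennreal ((norm (abs_l2 (\<lambda>s. f s - u n s)))\<^sup>2) \<le> ennreal (((1/4)^n)\<^sup>2)"
      using f_dist[of n] by (simp add: nn_integral_square[OF fu])
    then have "(norm (abs_l2 (\<lambda>s. f s - u n s)))\<^sup>2 \<le> ((1/4)^n)\<^sup>2"
      by (subst (asm) ennreal_le_iff) auto
    then show ?thesis unfolding eq by (rule power2_le_imp_le) simp
  qed
  have "(\<lambda>n. X (r n) - abs_l2 f) \<longlonglongrightarrow> 0"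
    by (rule Lim_null_comparison[where g = "\<lambda>n. (1/4)^n"])
       (auto simp: le intro!: LIMSEQ_realpow_zero)
  then have "(X \<circ> r) \<longlonglongrightarrow> abs_l2 f"
    by (simp add: LIM_zero_iff o_def)
  then show "convergent X"
    using Cauchy_converges_subseq[OF X r_mono] unfolding convergent_def by blast
qed

section \<open>Unitary representations\<close>

text \<open>A representation is given by a map \<open>\<pi>\<close> and a closed subspace \<open>H\<close> of a Hilbert space
  type; only the restriction of the operators \<open>\<pi> s\<close> to \<open>H\<close> matters. In this way
  \<open>{\<pi>, H\<^sub>\<pi>}\<close> and the restriction of the left regular representation to a subspace are
  treated alike.\<close>

definition unitary_representation ::
  "('g::locally_compact_group \<Rightarrow> 'h::complex_hilbert \<Rightarrow> 'h) \<Rightarrow> 'h set \<Rightarrow> bool" where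
  "unitary_representation \<pi> H \<longleftrightarrow> closed_csubspace H \<and> H \<noteq> {0} \<and>
     (\<forall>s. unitary_between H H (\<pi> s)) \<and>
     (\<forall>s t. \<forall>x\<in>H. \<pi> (s + t) x = \<pi> s (\<pi> t x)) \<and>
     (\<forall>x\<in>H. continuous_on UNIV (\<lambda>s. \<pi> s x))"

definition invariant_subspace ::
  "('g \<Rightarrow> 'h::complex_hilbert \<Rightarrow> 'h) \<Rightarrow> 'h set \<Rightarrow> bool" where
  "invariant_subspace \<pi> K \<longleftrightarrow> closed_csubspace K \<and> (\<forall>s. \<forall>x\<in>K. \<pi> s x \<in> K)"

definition irreducible_on ::
  "('g \<Rightarrow> 'h::complex_hilbert \<Rightarrow> 'h) \<Rightarrow> 'h set \<Rightarrow> bool" where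
  "irreducible_on \<pi> H \<longleftrightarrow>
     (\<forall>K. K \<subseteq> H \<longrightarrow> invariant_subspace \<pi> K \<longrightarrow> K = {0} \<or> K = H)"

definition subrepresentation ::
  "('g \<Rightarrow> 'h::complex_hilbert \<Rightarrow> 'h) \<Rightarrow> 'h set \<Rightarrow> bool" where
  "subrepresentation \<pi> K \<longleftrightarrow> invariant_subspace \<pi> K \<and> K \<noteq> {0}"

definition unitarily_equivalent ::
  "('g \<Rightarrow> 'h::complex_hilbert \<Rightarrow> 'h) \<Rightarrow> 'h set \<Rightarrow>
   ('g \<Rightarrow> 'k::complex_hilbert \<Rightarrow> 'k) \<Rightarrow> 'k set \<Rightarrow> bool" where
  "unitarily_equivalent \<pi> H \<rho> K \<longleftrightarrow>
     (\<exists>U. unitary_between H K U \<and> (\<forall>s. \<forall>x\<in>H. U (\<pi> s x) = \<rho> s (U x)))"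

definition voice_transform ::
  "('g \<Rightarrow> 'h::complex_hilbert \<Rightarrow> 'h) \<Rightarrow> 'h \<Rightarrow> 'h \<Rightarrow> 'g \<Rightarrow> complex" where
  "voice_transform \<pi> \<eta> \<psi> = (\<lambda>s. cinner \<psi> (\<pi> s \<eta>))"

definition voice_operator ::
  "('g::locally_compact_group \<Rightarrow> 'h::complex_hilbert \<Rightarrow> 'h) \<Rightarrow> 'h \<Rightarrow> 'h \<Rightarrow> 'g l2" where
  "voice_operator \<pi> \<eta> \<psi> = abs_l2 (voice_transform \<pi> \<eta> \<psi>)"

text \<open>\<open>abs_l2\<close> is meaningful on square-integrable functions only, hence the second conjunct.
  The adjoint of a bounded operator between Hilbert spaces exists and is unique.\<close>

definition admissible ::
  "('g::locally_compact_group \<Rightarrow> 'h::complex_hilbert \<Rightarrow> 'h) \<Rightarrow> 'h set \<Rightarrow> 'h \<Rightarrow> bool" where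
  "admissible \<pi> H \<eta> \<longleftrightarrow> \<eta> \<in> H \<and>
     (\<forall>\<psi>\<in>H. square_integrable (voice_transform \<pi> \<eta> \<psi>)) \<and>
     bounded_op_on H (voice_operator \<pi> \<eta>) \<and>
     (\<exists>A. is_adjoint_on H (voice_operator \<pi> \<eta>) A \<and>
          (\<forall>\<psi>\<in>H. A (voice_operator \<pi> \<eta> \<psi>) = \<psi>))"


section \<open>The left regular representation and right bounded vectors\<close>

lemma AE_translate:
  assumes "AE t in (haar :: 'g::locally_compact_group measure). P t"
  shows "AE t in haar. P (s + t)"
proof -
  have m: "(+) s \<in> measurable haar (haar :: 'g measure)"
    by (simp add: measurable_cong_sets[OF sets_haar sets_haar])
  have "AE t in distr haar haar ((+) s). P t"
    using assms by (simp only: distr_haar_translate)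
  then show ?thesis by (rule AE_distrD[OF m])
qed

lemma square_integrable_translate:
  assumes "square_integrable f"
  shows "square_integrable (\<lambda>t. f (s + t))"
proof -
  have [measurable]: "f \<in> borel_measurable borel"
    using assms by (simp add: square_integrable_def)
  have m: "(+) s \<in> measurable haar (haar :: 'a measure)"
    by (simp add: measurable_cong_sets[OF sets_haar sets_haar])
  have "integrable (distr haar haar ((+) s)) (\<lambda>t. (cmod (f t))\<^sup>2)"
    using assms by (simp only: distr_haar_translate) (simp add: square_integrable_def)
  then have "integrable haar (\<lambda>t. (cmod (f (s + t)))\<^sup>2)"
    by (subst (asm) integrable_distr_eq[OF m]) simp_all
  then show ?thesis by (simp add: square_integrable_def)
qed

lift_definition left_regular :: "'g::locally_compact_group \<Rightarrow> 'g l2 \<Rightarrow> 'g l2"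
  is "\<lambda>s f t. f (- s + t)"
  unfolding l2_rel_def by (intro conjI square_integrable_translate AE_translate) simp_all

definition Cc :: "('g::locally_compact_group \<Rightarrow> complex) set" where
  "Cc = {f. continuous_on UNIV f \<and> compact (closure {s. f s \<noteq> 0})}"

definition convolution ::
  "('g::locally_compact_group \<Rightarrow> complex) \<Rightarrow> ('g \<Rightarrow> complex) \<Rightarrow> 'g \<Rightarrow> complex" where
  "convolution f g s = (\<integral>t. f t * g (- t + s) \<partial>haar)"

definition flat :: "('g::locally_compact_group \<Rightarrow> complex) \<Rightarrow> 'g \<Rightarrow> complex" where
  "flat f s = cnj (f (- s))"

definition flat_domain :: "'g::locally_compact_group l2 set" where
  "flat_domain = {f. (\<integral>\<^sup>+s. ennreal (inverse (modular s) * (cmod (rep_l2 f s))\<^sup>2) \<partial>haar) < \<infinity>}"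

definition right_bounded :: "'g::locally_compact_group l2 set" where
  "right_bounded = {g. \<exists>C. \<forall>f\<in>Cc. norm (abs_l2 f) \<le> 1 \<longrightarrow>
     square_integrable (convolution f (rep_l2 g)) \<and>
     norm (abs_l2 (convolution f (rep_l2 g))) \<le> C}"

definition U_prime :: "'g::locally_compact_group l2 set" where
  "U_prime = right_bounded \<inter> flat_domain"

text \<open>Equalities in \<open>L\<^sup>2(G)\<close> are equalities almost everywhere of representatives.\<close>

definition E_prime :: "'g::locally_compact_group l2 set" where
  "E_prime = {e \<in> U_prime. e \<noteq> 0 \<and>
     (AE s in haar. rep_l2 e s = flat (rep_l2 e) s) \<and>
     (AE s in haar. rep_l2 e s = convolution (rep_l2 e) (rep_l2 e) s)}"

end

theory Submission
  imports Defs
begin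

text \<open>An admissible vector \<open>\<eta>\<close> makes \<open>L\<^sub>\<eta>\<close> an isometric intertwiner into \<open>L\<^sup>2(G)\<close>, and the function
  \<open>L\<^sub>\<eta> \<eta> = (\<eta> | \<pi>(\<cdot>) \<eta>)\<close> is invariant under the involution, hence lies in its domain.

  Conversely let \<open>f \<noteq> 0\<close> lie in the irreducible subspace \<open>H\<^sub>0\<close> and in the domain of the involution, and
  let \<open>h\<close> be its image under the involution. The operator \<open>T x = (x | \<lambda>(\<cdot>) f) = x * h\<close> is closed and
  densely defined on \<open>H\<^sub>0\<close> and commutes with \<open>\<lambda>\<close>, so by Schur's lemma, applied to the projection onto
  its graph, it is everywhere defined and \<open>T\<^sup>* T = k > 0\<close>. By Fubini \<open>T\<^sup>* y = y * f = (y | \<lambda>(\<cdot>) h)\<close>, and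
  therefore \<open>k \<psi> = T\<^sup>* T \<psi> = (T \<psi> | \<lambda>(\<cdot>) h) = (\<psi> | \<lambda>(\<cdot>) T\<^sup>* h)\<close> for \<open>\<psi> \<in> H\<^sub>0\<close>: the vector
  \<open>e = k\<^sup>-\<^sup>1 T\<^sup>* h\<close> reproduces \<open>H\<^sub>0\<close>, i.e. \<open>\<psi> = (\<psi> | \<lambda>(\<cdot>) e)\<close> almost everywhere. Reproducing vectors are
  unique, admissible and lie in \<open>E_prime\<close>. An element \<open>e'\<close> of \<open>H\<^sub>0 \<inter> E_prime\<close> can serve as both \<open>f\<close> and
  \<open>h\<close>; then \<open>k e = e' * e' = e'\<close> and idempotence forces \<open>k = 1\<close>, so that \<open>e'\<close> itself reproduces.

  Since \<open>modular\<close> is defined by a description, the uniqueness of Haar measure enters as well. It follows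
  from the Fubini identity \<open>\<integral> f ds \<cdot> \<integral> g(t\<^sup>-\<^sup>1) dt = \<integral> g(s) (\<integral> f(t s) dt) ds\<close> for compactly supported
  continuous functions.\<close>

section \<open>Hilbert space preliminaries\<close>

text \<open>\<open>G\<close> need be neither second countable nor \<sigma>-compact, so Haar measure
  may fail to be \<sigma>-finite and the usual Fubini theorem does not cover general
  square-integrable functions. Integrals are therefore interchanged only between compactly supported
  continuous functions and the result is carried to \<open>L\<^sup>2\<close> by density;
  square-integrability of a coefficient is read off from its pairings with test functions or from
  pointwise limits.

  The domain of the involution enters because \<phi> * h, for compactly supported \<phi>, has norm
  at most the \<open>L\<^sup>1\<close> norm of \<phi> times the norm of h; so T is densely defined.
  Nothing bounds T beforehand, and Schur's lemma cannot be applied to \<open>T\<^sup>* T\<close>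
  itself. The projection onto the graph, compressed to \<open>H\<^sub>0\<close>, is the bounded
  substitute \<open>(1 + T\<^sup>* T)\<^sup>-\<^sup>1\<close>.

  Schur's lemma rests on one square root: if a self-adjoint B commutes with the representation, the
  kernel of |B| - B is invariant, which makes B semidefinite on the irreducible space; applied to
  all shifts A - a this leaves only scalars.\<close>

instance complex_hilbert \<subseteq> banach ..

lemma cinner_add_right:
  "cinner (x::'a::complex_inner) (y + z) = cinner x y + cinner x z"
  by (metis cinner_add_left cinner_commute complex_cnj_add)

lemma cinner_scaleC_right: "cinner (x::'a::complex_inner) (a *\<^sub>C y) = cnj a * cinner x y"
  by (metis cinner_scaleC_left cinner_commute complex_cnj_mult)

lemma scaleC_one [simp]: "1 *\<^sub>C (x::'a::complex_inner) = x"
  using scaleR_scaleC[of 1 x] by simp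

lemma scaleC_minus1: "(- 1) *\<^sub>C (x::'a::complex_inner) = - x"
  using scaleR_scaleC[of "- 1" x] by simp

lemma scaleC_zero_right [simp]: "a *\<^sub>C (0::'a::complex_inner) = 0"
  using scaleC_add_right[of a 0 0] by simp

lemma scaleC_zero_left [simp]: "0 *\<^sub>C (x::'a::complex_inner) = 0"
  using scaleC_add_left[of 0 0 x] by simp

lemma cinner_zero_left [simp]: "cinner (0::'a::complex_inner) x = 0"
  using cinner_scaleC_left[of 0 0 x] by simp

lemma cinner_zero_right [simp]: "cinner (x::'a::complex_inner) 0 = 0"
  using cinner_scaleC_right[of x 0 0] by simp

lemma cinner_minus_left: "cinner (- x::'a::complex_inner) y = - cinner x y"
  using cinner_scaleC_left[of "-1" x y] by (simp add: scaleC_minus1)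

lemma cinner_minus_right: "cinner (x::'a::complex_inner) (- y) = - cinner x y"
  using cinner_scaleC_right[of x "-1" y] by (simp add: scaleC_minus1)

lemma scaleC_diff_right: "a *\<^sub>C (x - y::'a::complex_inner) = a *\<^sub>C x - a *\<^sub>C y"
  using scaleC_add_right[of a "x - y" y] by (simp add: algebra_simps)

lemma cinner_diff_left: "cinner (x - y::'a::complex_inner) z = cinner x z - cinner y z"
  using cinner_add_left[of x "- y" z] by (simp add: cinner_minus_left)

lemma cinner_diff_right: "cinner (x::'a::complex_inner) (y - z) = cinner x y - cinner x z"
  using cinner_add_right[of x y "- z"] by (simp add: cinner_minus_right)

lemma cinner_scaleR_left: "cinner (r *\<^sub>R x::'a::complex_inner) y = of_real r * cinner x y"
  by (simp add: scaleR_scaleC cinner_scaleC_left)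

lemma cinner_scaleR_right: "cinner (x::'a::complex_inner) (r *\<^sub>R y) = of_real r * cinner x y"
  by (simp add: scaleR_scaleC cinner_scaleC_right)

lemma cinner_self: "cinner (x::'a::complex_inner) x = of_real ((norm x)\<^sup>2)"
proof -
  have "Im (cinner x x) = 0"
    using cinner_commute[of x x] by (simp add: complex_eq_iff)
  moreover have "Re (cinner x x) = (norm x)\<^sup>2"
    by (simp add: inner_eq_Re_cinner[symmetric] power2_norm_eq_inner)
  ultimately show ?thesis by (simp add: complex_eq_iff)
qed

lemma cinner_conv_inner:
  "cinner (x::'a::complex_inner) y = Complex (inner x y) (inner x (\<i> *\<^sub>C y))"
  by (simp add: complex_eq_iff inner_eq_Re_cinner cinner_scaleC_right)

lemma cinner_eq_zero_iff [simp]: "cinner (x::'a::complex_inner) x = 0 \<longleftrightarrow> x = 0"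
  by (simp add: cinner_self)

lemma norm_scaleC: "norm (a *\<^sub>C x::'a::complex_inner) = cmod a * norm x"
proof -
  have "complex_of_real ((norm (a *\<^sub>C x))\<^sup>2) = a * cnj a * of_real ((norm x)\<^sup>2)"
    by (simp only: cinner_self[symmetric] cinner_scaleC_left cinner_scaleC_right mult_ac)
  also have "\<dots> = complex_of_real ((cmod a * norm x)\<^sup>2)"
    by (simp add: complex_norm_square[symmetric] power_mult_distrib)
  finally have "(norm (a *\<^sub>C x))\<^sup>2 = (cmod a * norm x)\<^sup>2"
    using of_real_eq_iff by blast
  then show ?thesis by (simp add: power2_eq_iff_nonneg)
qed

lemma cinner_Cauchy_Schwarz: "cmod (cinner x y) \<le> norm (x::'a::complex_inner) * norm y"
proof (cases "cinner x y = 0")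
  case False
  \<comment> \<open>Rotating \<open>x\<close> by this phase makes the inner product real and
    nonnegative, so the real Cauchy-Schwarz inequality applies.\<close>
  define a where "a = cnj (sgn (cinner x y))"
  have a: "cmod a = 1" using False by (simp add: a_def norm_sgn)
  have "cinner (a *\<^sub>C x) y = of_real (cmod (cinner x y))"
    unfolding cinner_scaleC_left a_def sgn_eq
    by (simp add: field_simps complex_norm_square[symmetric] False power2_eq_square)
  then have "cmod (cinner x y) = inner (a *\<^sub>C x) y"
    by (simp add: inner_eq_Re_cinner)
  also have "\<dots> \<le> norm (a *\<^sub>C x) * norm y" by (rule norm_cauchy_schwarz)
  finally show ?thesis by (simp add: norm_scaleC a)
qed simp

lemma bounded_bilinear_cinner: "bounded_bilinear (cinner :: 'a::complex_inner \<Rightarrow> 'a \<Rightarrow> complex)"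
proof (unfold_locales, goal_cases)
  case 5
  then show ?case using cinner_Cauchy_Schwarz by (intro exI[of _ 1]) auto
qed (simp_all add: cinner_add_left cinner_add_right cinner_scaleR_left cinner_scaleR_right
      scaleR_conv_of_real)

lemmas tendsto_cinner [tendsto_intros] = bounded_bilinear.tendsto[OF bounded_bilinear_cinner]

lemma bounded_linear_scaleC: "bounded_linear (\<lambda>x::'a::complex_inner. a *\<^sub>C x)"
  by (rule bounded_linear_intro[where K = "cmod a"])
     (simp_all add: scaleC_add_right scaleR_scaleC scaleC_scaleC norm_scaleC mult.commute)

lemma cinner_ext:
  assumes "\<And>y. cinner (x::'a::complex_inner) y = cinner x' y"
  shows "x = x'"
proof -
  have "cinner (x - x') (x - x') = 0" using assms by (simp add: cinner_diff_left)
  then show ?thesis by simp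
qed

section \<open>Closed subspaces and bounded operators\<close>

lemma closed_csubspaceD:
  assumes "closed_csubspace H"
  shows "closed H" "0 \<in> H" "\<And>x y. x \<in> H \<Longrightarrow> y \<in> H \<Longrightarrow> x + y \<in> H"
    "\<And>a x. x \<in> H \<Longrightarrow> a *\<^sub>C x \<in> H" "\<And>r x. x \<in> H \<Longrightarrow> r *\<^sub>R x \<in> H"
    "\<And>x y. x \<in> H \<Longrightarrow> y \<in> H \<Longrightarrow> x - y \<in> H" "subspace H"
proof -
  show *: "closed H" "0 \<in> H" "\<And>x y. x \<in> H \<Longrightarrow> y \<in> H \<Longrightarrow> x + y \<in> H"
    "\<And>a x. x \<in> H \<Longrightarrow> a *\<^sub>C x \<in> H"
    using assms by (auto simp: closed_csubspace_def)
  show **: "\<And>r x. x \<in> H \<Longrightarrow> r *\<^sub>R x \<in> H" by (simp add: scaleR_scaleC *)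
  show "subspace H" by (simp add: subspace_def * **)
  then show "\<And>x y. x \<in> H \<Longrightarrow> y \<in> H \<Longrightarrow> x - y \<in> H" by (rule subspace_diff)
qed

lemma bounded_op_on_UNIV:
  assumes "bounded_op_on UNIV T"
  shows "bounded_linear T" "\<And>a x. T (a *\<^sub>C x) = a *\<^sub>C T x"
proof -
  obtain C where C: "\<And>x. norm (T x) \<le> C * norm x"
    using assms by (auto simp: bounded_op_on_def)
  show sc: "\<And>a x. T (a *\<^sub>C x) = a *\<^sub>C T x"
    using assms by (auto simp: bounded_op_on_def clinear_on_def)
  show "bounded_linear T"
    by (rule bounded_linear_intro[where K = C])
       (use assms C in \<open>auto simp: bounded_op_on_def clinear_on_def scaleR_scaleC mult.commute\<close>)
qed

lemma bounded_op_on_UNIVI: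
  assumes "bounded_linear T" "\<And>a x. T (a *\<^sub>C x) = a *\<^sub>C T x"
  shows "bounded_op_on UNIV T"
proof -
  obtain K where "\<And>x. norm (T x) \<le> norm x * K" using assms(1) bounded_linear.bounded by blast
  then show ?thesis using assms
    by (auto simp: bounded_op_on_def clinear_on_def linear_add[OF bounded_linear.linear] mult.commute
        intro!: exI[of _ K])
qed

subsection \<open>Projections, the Riesz representation and adjoints\<close>

lemma nearest_point_exists:
  fixes S :: "'a::{real_inner,complete_space} set"
  assumes S: "closed S" "subspace S"
  shows "\<exists>p\<in>S. \<forall>y\<in>S. norm (x - p) \<le> norm (x - y)"
proof -
  define d where "d = (INF y\<in>S. norm (x - y))"
  have ne: "S \<noteq> {}" using S(2) subspace_0 by blast
  have bdd: "bdd_below ((\<lambda>y. norm (x - y)) ` S)" by (rule bdd_belowI2[of _ 0]) simp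
  have d_le: "d \<le> norm (x - y)" if "y \<in> S" for y
    unfolding d_def using bdd that by (rule cINF_lower)
  have d0: "0 \<le> d" unfolding d_def using ne by (intro cINF_greatest) auto
  have "\<exists>y\<in>S. norm (x - y) < d + 1 / real (Suc n)" for n
    using cINF_less_iff[OF ne bdd, of "d + 1 / real (Suc n)"] by (simp add: d_def)
  then obtain p where p: "\<And>n. p n \<in> S" "\<And>n. norm (x - p n) < d + 1 / real (Suc n)" by metis
  \<comment> \<open>Parallelogram law: the midpoint of \<open>p m\<close> and \<open>p n\<close>
    lies in \<open>S\<close>, hence has distance at least \<open>d\<close> from \<open>x\<close>,
    which makes the minimizing sequence Cauchy.\<close>
  have sq: "(norm (p m - p n))\<^sup>2 \<le> 2 * (d + 1 / real (Suc m))\<^sup>2 + 2 * (d + 1 / real (Suc n))\<^sup>2 - 4 * d\<^sup>2" for m n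
  proof -
    have "d \<le> norm (x - (1/2) *\<^sub>R (p m + p n))"
      by (intro d_le subspace_scale subspace_add S p)
    then have "d\<^sup>2 \<le> (norm (x - (1/2) *\<^sub>R (p m + p n)))\<^sup>2" using d0 by (rule power_mono)
    moreover have "(norm (p m - p n))\<^sup>2 + 4 * (norm (x - (1/2) *\<^sub>R (p m + p n)))\<^sup>2
        = 2 * (norm (x - p m))\<^sup>2 + 2 * (norm (x - p n))\<^sup>2"
      by (simp add: power2_norm_eq_inner inner_diff_left inner_diff_right inner_add_left inner_add_right
          inner_commute algebra_simps)
    moreover have "(norm (x - p k))\<^sup>2 \<le> (d + 1 / real (Suc k))\<^sup>2" for k
      using p(2)[of k] by (intro power_mono) auto
    ultimately show ?thesis using \<open>\<And>k. (norm (x - p k))\<^sup>2 \<le> (d + 1 / real (Suc k))\<^sup>2\<close>[of m] \<open>\<And>k. (norm (x - p k))\<^sup>2 \<le> (d + 1 / real (Suc k))\<^sup>2\<close>[of n] by linarith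
  qed
  have "Cauchy p"
  proof (rule metric_CauchyI)
    fix e :: real assume e: "0 < e"
    have "(\<lambda>n. 2 * (d + 1 / real (Suc n))\<^sup>2) \<longlonglongrightarrow> 2 * (d + 0)\<^sup>2"
      by (intro tendsto_intros LIMSEQ_Suc[OF lim_1_over_n])
    then have "\<forall>\<^sub>F n in sequentially. 2 * (d + 1 / real (Suc n))\<^sup>2 < 2 * d\<^sup>2 + e\<^sup>2 / 2"
      by (rule order_tendstoD(2)) (use e in simp)
    then obtain N where N: "\<And>n. n \<ge> N \<Longrightarrow> 2 * (d + 1 / real (Suc n))\<^sup>2 < 2 * d\<^sup>2 + e\<^sup>2 / 2"
      by (auto simp: eventually_sequentially)
    have "dist (p m) (p n) < e" if "m \<ge> N" "n \<ge> N" for m n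
    proof -
      have "(norm (p m - p n))\<^sup>2 < e\<^sup>2" using sq[of m n] N[OF that(1)] N[OF that(2)] by linarith
      then show ?thesis using e by (simp add: dist_norm power_less_imp_less_base)
    qed
    then show "\<exists>N. \<forall>m\<ge>N. \<forall>n\<ge>N. dist (p m) (p n) < e" by blast
  qed
  then obtain q where q: "p \<longlonglongrightarrow> q" by (auto simp: Cauchy_convergent_iff convergent_def)
  have qS: "q \<in> S" using closed_sequentially[OF S(1)] p(1) q by blast
  have "norm (x - q) \<le> d"
  proof (rule LIMSEQ_le)
    show "(\<lambda>n. norm (x - p n)) \<longlonglongrightarrow> norm (x - q)" by (intro tendsto_intros q)
    show "(\<lambda>n. d + 1 / real (Suc n)) \<longlonglongrightarrow> d"
      using tendsto_add[OF tendsto_const[of d] LIMSEQ_Suc[OF lim_1_over_n]] by simp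
    show "\<exists>N. \<forall>n\<ge>N. norm (x - p n) \<le> d + 1 / real (Suc n)" using p(2) by (meson less_imp_le)
  qed
  then show ?thesis using qS d_le by (meson order_trans)
qed

lemma orthogonal_decomposition:
  fixes S :: "'a::{real_inner,complete_space} set"
  assumes S: "closed S" "subspace S"
  shows "\<exists>p\<in>S. \<forall>y\<in>S. inner (x - p) y = 0"
proof -
  obtain p where p: "p \<in> S" "\<And>y. y \<in> S \<Longrightarrow> norm (x - p) \<le> norm (x - y)"
    using nearest_point_exists[OF S] by blast
  have "inner (x - p) y = 0" if y: "y \<in> S" for y
  proof (cases "y = 0")
    case False
    \<comment> \<open>The minimizer over \<open>t\<close> of the squared distance from
      \<open>x\<close> to \<open>p + t *\<^sub>R y\<close>; moving there would beat the nearest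
      point unless the inner product vanishes.\<close>
    define t where "t = inner (x - p) y / (norm y)\<^sup>2"
    have "p + t *\<^sub>R y \<in> S" using S y p(1) by (simp add: subspace_add subspace_scale)
    then have "(norm (x - p))\<^sup>2 \<le> (norm (x - (p + t *\<^sub>R y)))\<^sup>2" using p(2) by (intro power_mono) auto
    also have "\<dots> = (norm (x - p))\<^sup>2 - 2 * t * inner (x - p) y + t\<^sup>2 * (norm y)\<^sup>2"
    proof -
      have "(norm (u - t *\<^sub>R y))\<^sup>2 = (norm u)\<^sup>2 - 2 * t * inner u y + t\<^sup>2 * (norm y)\<^sup>2" for u
        unfolding power2_norm_eq_inner
        by (simp add: inner_diff_left inner_diff_right inner_commute algebra_simps power2_eq_square)
      then show ?thesis by (simp only: diff_diff_add[symmetric])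
    qed
    also have "\<dots> = (norm (x - p))\<^sup>2 - (inner (x - p) y)\<^sup>2 / (norm y)\<^sup>2"
      using False by (simp add: t_def power2_eq_square field_simps)
    finally have "(inner (x - p) y)\<^sup>2 / (norm y)\<^sup>2 \<le> 0" by simp
    then show ?thesis using False by (simp add: divide_le_0_iff)
  qed simp
  then show ?thesis using p(1) by blast
qed

text \<open>Orthogonality is demanded only for the real inner product; for a complex subspace
  \<open>H\<close>, which contains \<open>\<i> *\<^sub>C y\<close> along with \<open>y\<close>, this
  already gives orthogonality for \<open>cinner\<close>.\<close>

definition orth_proj :: "'h::complex_hilbert set \<Rightarrow> 'h \<Rightarrow> 'h" where
  "orth_proj H x = (SOME p. p \<in> H \<and> (\<forall>y\<in>H. inner (x - p) y = 0))"

context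
  fixes H :: "'h::complex_hilbert set"
  assumes H: "closed_csubspace H"
begin

lemma orth_proj_in [simp]: "orth_proj H x \<in> H"
  and inner_orth_proj: "y \<in> H \<Longrightarrow> inner (x - orth_proj H x) y = 0"
proof -
  have "\<exists>p. p \<in> H \<and> (\<forall>y\<in>H. inner (x - p) y = 0)"
    using orthogonal_decomposition closed_csubspaceD(1,7)[OF H] by blast
  from someI_ex[OF this] show "orth_proj H x \<in> H" "y \<in> H \<Longrightarrow> inner (x - orth_proj H x) y = 0"
    unfolding orth_proj_def by blast+
qed

lemma orth_proj_unique:
  assumes "p \<in> H" "\<And>y. y \<in> H \<Longrightarrow> inner (x - p) y = 0"
  shows "orth_proj H x = p"
proof -
  have "orth_proj H x - p \<in> H" using assms(1) by (simp add: closed_csubspaceD[OF H])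
  then have "inner (x - p) (orth_proj H x - p) = 0" "inner (x - orth_proj H x) (orth_proj H x - p) = 0"
    using assms(2) inner_orth_proj by auto
  then have "inner (orth_proj H x - p) (orth_proj H x - p) = 0"
    by (simp add: inner_diff_left)
  then show ?thesis by simp
qed

lemma cinner_orth_proj: "y \<in> H \<Longrightarrow> cinner (x - orth_proj H x) y = 0"
  unfolding cinner_conv_inner using inner_orth_proj closed_csubspaceD(4)[OF H]
  by (simp add: complex_eq_iff)

lemma orth_proj_id [simp]: "x \<in> H \<Longrightarrow> orth_proj H x = x"
  by (rule orth_proj_unique) simp_all

lemma cinner_orth_proj_left: "y \<in> H \<Longrightarrow> cinner (orth_proj H x) y = cinner x y"
  using cinner_orth_proj[of y x] by (simp add: cinner_diff_left)

lemma cinner_orth_proj_right: "y \<in> H \<Longrightarrow> cinner y (orth_proj H x) = cinner y x"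
  using cinner_orth_proj_left[of y x] by (metis cinner_commute)

lemma orth_proj_sym: "cinner (orth_proj H x) y = cinner x (orth_proj H y)"
  using cinner_orth_proj_left[of "orth_proj H y" x] cinner_orth_proj_right[of "orth_proj H x" y] by simp

lemma orth_proj_add: "orth_proj H (x + y) = orth_proj H x + orth_proj H y"
proof (rule orth_proj_unique)
  fix z assume "z \<in> H"
  then show "inner (x + y - (orth_proj H x + orth_proj H y)) z = 0"
    using inner_orth_proj[of z x] inner_orth_proj[of z y]
    by (simp add: inner_diff_left inner_add_left)
qed (simp add: closed_csubspaceD[OF H])

lemma orth_proj_scaleC: "orth_proj H (a *\<^sub>C x) = a *\<^sub>C orth_proj H x"
proof (rule orth_proj_unique)
  fix z assume "z \<in> H"
  then show "inner (a *\<^sub>C x - a *\<^sub>C orth_proj H x) z = 0"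
    using cinner_orth_proj[of z x]
    by (simp add: inner_eq_Re_cinner cinner_diff_left cinner_scaleC_left right_diff_distrib[symmetric]
        del: right_diff_distrib)
qed (simp add: closed_csubspaceD[OF H])

lemma norm_orth_proj_le: "norm (orth_proj H x) \<le> norm x"
proof -
  have "(norm (orth_proj H x))\<^sup>2 = inner x (orth_proj H x)"
    using inner_orth_proj[of "orth_proj H x" x] by (simp add: inner_diff_left power2_norm_eq_inner)
  also have "\<dots> \<le> norm x * norm (orth_proj H x)" by (rule norm_cauchy_schwarz)
  finally show ?thesis
    by (cases "orth_proj H x = 0") (simp_all add: power2_eq_square)
qed

lemma bounded_op_orth_proj: "bounded_op_on UNIV (orth_proj H)"
  by (auto simp: bounded_op_on_def clinear_on_def orth_proj_add orth_proj_scaleC norm_orth_proj_le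
      intro!: exI[of _ 1])

end

lemma closed_csubspace_dense:
  fixes K :: "'h::complex_hilbert set"
  assumes K: "closed_csubspace K" and "\<And>x. (\<And>y. y \<in> K \<Longrightarrow> cinner x y = 0) \<Longrightarrow> x = 0"
  shows "K = UNIV"
proof -
  have "x - orth_proj K x = 0" for x
    using assms(2) cinner_orth_proj[OF K] by blast
  then show ?thesis by (metis UNIV_eq_I eq_iff_diff_eq_0 orth_proj_in[OF K])
qed

lemma Riesz_representation:
  fixes f :: "'h::complex_hilbert \<Rightarrow> complex"
  assumes add: "\<And>x y. f (x + y) = f x + f y" and scale: "\<And>a x. f (a *\<^sub>C x) = a * f x"
    and bound: "\<And>x. cmod (f x) \<le> C * norm x"
  shows "\<exists>w. \<forall>x. f x = cinner x w"
proof (cases "\<forall>x. f x = 0")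
  case True
  then show ?thesis by (intro exI[of _ 0]) simp
next
  case False
  then obtain z where z: "f z \<noteq> 0" by blast
  have bl: "bounded_linear f"
    by (rule bounded_linear_intro[where K = C])
       (use bound in \<open>simp_all add: add scale scaleR_scaleC scaleR_conv_of_real mult.commute\<close>)
  have "closed {x. f x = 0}"
    using continuous_closed_vimage[of "{0}" f] bl by (simp add: vimage_def linear_continuous_at)
  then have K: "closed_csubspace {x. f x = 0}"
    using linear_0[OF bounded_linear.linear[OF bl]] by (auto simp: closed_csubspace_def add scale)
  \<comment> \<open>\<open>u\<close> spans the complement of the kernel; the representing vector is
    the multiple of \<open>u\<close> that gives the right value at \<open>u\<close>.\<close>
  define u where "u = z - orth_proj {x. f x = 0} z"
  have "f u = f z - f (orth_proj {x. f x = 0} z)"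
    unfolding u_def by (rule linear_diff[OF bounded_linear.linear[OF bl]])
  then have fu: "f u \<noteq> 0" using orth_proj_in[OF K, of z] z by simp
  then have u0: "norm u \<noteq> 0" using linear_0[OF bounded_linear.linear[OF bl]] by auto
  have "f x = cinner x ((cnj (f u) / of_real ((norm u)\<^sup>2)) *\<^sub>C u)" for x
  proof -
    have "f (x - (f x / f u) *\<^sub>C u) = 0"
      using fu by (simp add: linear_diff[OF bounded_linear.linear[OF bl]] scale)
    then have "cinner u (x - (f x / f u) *\<^sub>C u) = 0"
      using cinner_orth_proj[OF K, of _ z] by (simp add: u_def)
    then have "cinner (x - (f x / f u) *\<^sub>C u) u = 0"
      by (metis cinner_commute complex_cnj_zero)
    then have "cinner x u = (f x / f u) * of_real ((norm u)\<^sup>2)"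
      by (simp add: cinner_diff_left cinner_scaleC_left cinner_self)
    then show ?thesis
      using fu u0 by (simp add: cinner_scaleC_right field_simps)
  qed
  then show ?thesis by blast
qed

lemma cinner_ext_right:
  assumes "\<And>y. cinner y (x::'a::complex_inner) = cinner y x'"
  shows "x = x'"
  using assms by (metis cinner_ext cinner_commute)

lemma adjoint_exists:
  fixes T :: "'h::complex_hilbert \<Rightarrow> 'k::complex_hilbert"
  assumes T: "bounded_op_on UNIV T"
  shows "\<exists>A. bounded_op_on UNIV A \<and> (\<forall>x y. cinner (T x) y = cinner x (A y))"
proof -
  obtain C0 where C0: "\<And>x. norm (T x) \<le> C0 * norm x" and lin: "clinear_on UNIV T"
    using T by (auto simp: bounded_op_on_def)
  \<comment> \<open>The bound in \<open>bounded_op_on\<close> may be negative when the space is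
    trivial; the estimates need a nonnegative one.\<close>
  define C where "C = \<bar>C0\<bar>"
  have C: "norm (T x) \<le> C * norm x" for x
    using order_trans[OF C0[of x]] by (simp add: C_def mult_right_mono)
  have "\<exists>w. \<forall>x. cinner (T x) y = cinner x w" for y
  proof (rule Riesz_representation)
    fix x show "cmod (cinner (T x) y) \<le> (C * norm y) * norm x"
      using cinner_Cauchy_Schwarz[of "T x" y] mult_right_mono[OF C[of x], of "norm y"]
      by (simp add: mult.commute mult.left_commute)
  qed (use lin in \<open>simp_all add: clinear_on_def cinner_add_left cinner_scaleC_left\<close>)
  then obtain A where A: "\<And>x y. cinner (T x) y = cinner x (A y)" by metis
  have "norm (A y) \<le> C * norm y" for y
  proof (cases "A y = 0")
    case False
    have "complex_of_real (norm (A y) * norm (A y)) = cinner (T (A y)) y"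
      by (simp only: A cinner_self power2_eq_square)
    then have "norm (A y) * norm (A y) = cmod (cinner (T (A y)) y)"
      by (metis norm_of_real abs_of_nonneg mult_nonneg_nonneg norm_ge_zero)
    also have "\<dots> \<le> norm (T (A y)) * norm y" by (rule cinner_Cauchy_Schwarz)
    also have "\<dots> \<le> C * norm (A y) * norm y" by (rule mult_right_mono[OF C]) simp
    finally have "norm (A y) * norm (A y) \<le> norm (A y) * (C * norm y)" by (simp add: mult_ac)
    then show ?thesis using False by simp
  qed (simp add: C_def)
  moreover have "A (x + y) = A x + A y" for x y
    by (rule cinner_ext_right) (simp add: cinner_add_right A[symmetric])
  moreover have "A (a *\<^sub>C x) = a *\<^sub>C A x" for a x
    by (rule cinner_ext_right) (simp add: cinner_scaleC_right A[symmetric])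
  ultimately have "bounded_op_on UNIV A" by (auto simp: bounded_op_on_def clinear_on_def)
  then show ?thesis using A by blast
qed

lemma unitary_between_norm:
  assumes "unitary_between H K U" "x \<in> H"
  shows "norm (U x) = norm x"
proof -
  have "cinner (U x) (U x) = cinner x x" using assms by (auto simp: unitary_between_def)
  then have "(norm (U x))\<^sup>2 = (norm x)\<^sup>2" unfolding cinner_self by (simp only: of_real_eq_iff)
  then show ?thesis by (simp add: power2_eq_iff_nonneg)
qed

text \<open>The graph of an operator between two Hilbert spaces, and the projection onto it, live in
  this orthogonal sum.\<close>

instantiation prod :: (complex_inner, complex_inner) complex_inner
begin

definition "scaleC_prod a (p :: 'a \<times> 'b) = (a *\<^sub>C fst p, a *\<^sub>C snd p)"
definition "cinner_prod (p :: 'a \<times> 'b) q = cinner (fst p) (fst q) + cinner (snd p) (snd q)"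

instance
proof
  fix p q :: "'a \<times> 'b"
  show "cinner p q = cnj (cinner q p)"
    unfolding cinner_prod_def by (metis cinner_commute complex_cnj_add)
qed (simp_all add: scaleC_prod_def cinner_prod_def scaleC_add_right scaleC_add_left scaleC_scaleC
    cinner_add_left cinner_scaleC_left distrib_left inner_prod_def inner_eq_Re_cinner
    scaleR_prod_def scaleR_scaleC)

end

instance prod :: (complex_hilbert, complex_hilbert) complex_hilbert ..

subsection \<open>Schur's lemma\<close>

text \<open>With \<open>Q = I - Y\<close> the equation \<open>2 Y = S + Y\<^sup>2\<close> says \<open>Q\<^sup>2 = I - S\<close>; the iteration for \<open>Y\<close>
  is dominated in norm by the scalar one for \<open>S = 1\<close>.\<close>

lemma square_root_iteration:
  fixes S :: "'h::banach \<Rightarrow>\<^sub>L 'h"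
  assumes S: "norm S \<le> 1"
  shows "\<exists>Y. norm Y \<le> 1 \<and> 2 *\<^sub>R Y = S + (Y o\<^sub>L Y) \<and> (\<forall>T. T o\<^sub>L S = S o\<^sub>L T \<longrightarrow> T o\<^sub>L Y = Y o\<^sub>L T)"
proof -
  define Y where "Y n = ((\<lambda>Z. (1/2) *\<^sub>R (S + (Z o\<^sub>L Z))) ^^ n) 0" for n
  define y where "y n = ((\<lambda>z. (1/2) * (1 + z * z)) ^^ n) (0::real)" for n
  have Y0: "Y 0 = 0" and Y: "Y (Suc n) = (1/2) *\<^sub>R (S + (Y n o\<^sub>L Y n))" for n by (simp_all add: Y_def)
  have y0: "y 0 = 0" and y: "y (Suc n) = (1/2) * (1 + y n * y n)" for n by (simp_all add: y_def)
  note bl = bounded_bilinear_blinfun_compose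
  note comp_simps = bounded_bilinear.add_left[OF bl] bounded_bilinear.add_right[OF bl]
    bounded_bilinear.scaleR_left[OF bl] bounded_bilinear.scaleR_right[OF bl]
    bounded_bilinear.diff_left[OF bl] bounded_bilinear.diff_right[OF bl]
    bounded_bilinear.zero_left[OF bl] bounded_bilinear.zero_right[OF bl]
  have assoc: "(A o\<^sub>L B) o\<^sub>L C = A o\<^sub>L (B o\<^sub>L C)" for A B C :: "'h \<Rightarrow>\<^sub>L 'h"
    by (rule blinfun_eqI) simp
  have comm: "T o\<^sub>L Y n = Y n o\<^sub>L T" if "T o\<^sub>L S = S o\<^sub>L T" for T n
  proof (induction n)
    case (Suc n)
    have "T o\<^sub>L (Y n o\<^sub>L Y n) = (Y n o\<^sub>L Y n) o\<^sub>L T"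
      by (metis Suc assoc)
    then show ?case using that by (simp add: Y comp_simps)
  qed (simp add: Y0 comp_simps)
  have comm_YS: "Y n o\<^sub>L S = S o\<^sub>L Y n" for n using comm[of S n] by simp
  have y01: "0 \<le> y n \<and> y n \<le> 1" for n
  proof (induction n)
    case (Suc n)
    then have "y n * y n \<le> 1" by (simp add: mult_le_one)
    then show ?case using Suc by (simp add: y)
  qed (simp add: y0)
  have nY: "norm (Y n) \<le> y n" for n
  proof (induction n)
    case (Suc n)
    have "norm (S + (Y n o\<^sub>L Y n)) \<le> 1 + y n * y n"
      using S norm_blinfun_compose[of "Y n" "Y n"] mult_mono[OF Suc Suc] y01[of n]
      by (intro norm_triangle_le) auto
    then show ?case by (simp add: Y y)
  qed (simp add: Y0 y0)
  have step: "norm (Y (Suc n) - Y n) \<le> y (Suc n) - y n" for n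
  proof (induction n)
    case 0
    then show ?case using S by (simp add: Y y Y0 y0 comp_simps)
  next
    case (Suc n)
    \<comment> \<open>Iterates commute, so the difference of their squares factors as for
      scalars.\<close>
    have "Y (Suc n) o\<^sub>L Y n = Y n o\<^sub>L Y (Suc n)" by (intro comm comm_YS)
    then have "Y (Suc (Suc n)) - Y (Suc n) = (1/2) *\<^sub>R ((Y (Suc n) - Y n) o\<^sub>L (Y (Suc n) + Y n))"
      using arg_cong2[where f = minus, OF Y Y, of "Suc n" n] unfolding comp_simps
      by (simp add: scaleR_diff_right[symmetric] del: scaleR_diff_right)
    also have "norm \<dots> \<le> (1/2) * ((y (Suc n) - y n) * (y (Suc n) + y n))"
    proof -
      have "norm (Y (Suc n) + Y n) \<le> y (Suc n) + y n"
        by (intro norm_triangle_le add_mono nY)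
      then have "norm (Y (Suc n) - Y n) * norm (Y (Suc n) + Y n) \<le> (y (Suc n) - y n) * (y (Suc n) + y n)"
        using Suc order_trans[OF norm_ge_zero Suc] by (intro mult_mono) auto
      then show ?thesis
        using norm_blinfun_compose[of "Y (Suc n) - Y n" "Y (Suc n) + Y n"] by simp
    qed
    also have "\<dots> = y (Suc (Suc n)) - y (Suc n)"
      by (simp add: y algebra_simps)
    finally show ?case .
  qed
  have "y n \<le> y (Suc n)" for n using order_trans[OF norm_ge_zero step[of n]] by simp
  then have "incseq y" by (rule incseq_SucI)
  then have "convergent y"
    using incseq_convergent[of y 1] y01 by (metis convergentI)
  then have "summable (\<lambda>n. y (Suc n) - y n)"
    using telescope_summable convergent_LIMSEQ_iff by blast
  then have "summable (\<lambda>n. Y (Suc n) - Y n)"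
    by (rule summable_comparison_test'[where N = 0]) (rule step)
  then have "convergent (\<lambda>n. \<Sum>k<n. Y (Suc k) - Y k)" by (simp add: summable_iff_convergent)
  then have "convergent Y" by (simp add: sum_lessThan_telescope Y0)
  then obtain Z where Z: "Y \<longlonglongrightarrow> Z" by (auto simp: convergent_def)
  note lims = tendsto_intros bounded_bilinear.tendsto[OF bl] Z
  have "norm Z \<le> 1"
    by (rule tendsto_upperbound[OF tendsto_norm[OF Z]])
       (use order_trans[OF nY conjunct2[OF y01]] in \<open>auto intro!: always_eventually\<close>)
  moreover have "(\<lambda>n. 2 *\<^sub>R Y (Suc n)) \<longlonglongrightarrow> (S + (Z o\<^sub>L Z))"
    unfolding Y by (simp, intro lims)
  then have "2 *\<^sub>R Z = S + (Z o\<^sub>L Z)"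
    by (rule LIMSEQ_unique[rotated]) (intro lims LIMSEQ_Suc)
  moreover have "T o\<^sub>L Z = Z o\<^sub>L T" if "T o\<^sub>L S = S o\<^sub>L T" for T
  proof (rule LIMSEQ_unique)
    show "(\<lambda>n. T o\<^sub>L Y n) \<longlonglongrightarrow> (T o\<^sub>L Z)" by (intro lims)
    show "(\<lambda>n. T o\<^sub>L Y n) \<longlonglongrightarrow> (Z o\<^sub>L T)" unfolding comm[OF that] by (intro lims)
  qed
  ultimately show ?thesis by blast
qed

text \<open>Irreducibility is applied to the kernel of \<open>|B| - B\<close>.\<close>

lemma irreducible_definite:
  fixes B :: "'h::complex_hilbert \<Rightarrow>\<^sub>L 'h"
  assumes H: "closed_csubspace H" and irr: "irreducible_on \<pi> H"
    and unit: "\<And>s. unitary_between H H (\<pi> s)"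
    and B: "norm B \<le> 1" "\<And>a x. B (a *\<^sub>C x) = a *\<^sub>C B x" "\<And>x y. inner (B x) y = inner x (B y)"
      "\<And>x. B x \<in> H" "\<And>s x. x \<in> H \<Longrightarrow> B (\<pi> s x) = \<pi> s (B x)"
  shows "(\<forall>x\<in>H. 0 \<le> inner (B x) x) \<or> (\<forall>x\<in>H. inner (B x) x \<le> 0)"
proof -
  have pi: "\<pi> s x \<in> H" if "x \<in> H" for s x
    using unit that by (auto simp: unitary_between_def bij_betw_def)
  have pi_lin: "\<pi> s (x + y) = \<pi> s x + \<pi> s y" "\<pi> s (a *\<^sub>C x) = a *\<^sub>C \<pi> s x" if "x \<in> H" "y \<in> H" for s x y a
    using unit that by (auto simp: unitary_between_def clinear_on_def)
  have pi0: "\<pi> s 0 = 0" for s using pi_lin(2)[of 0 0 s 0] closed_csubspaceD(2)[OF H] by simp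
  have bP: "bounded_linear (orth_proj H)" by (rule bounded_op_on_UNIV[OF bounded_op_orth_proj[OF H]])
  \<comment> \<open>Self-adjoint with range in \<open>H\<close>, the operator \<open>B\<close>
    vanishes on the orthogonal complement of \<open>H\<close>.\<close>
  have BP: "B (orth_proj H x) = B x" for x
  proof -
    have "inner (B x - B (orth_proj H x)) y = 0" for y
      using inner_orth_proj[OF H, of "B y" x] B(3)[of "x - orth_proj H x" y] B(4)
      by (simp add: blinfun.diff_right)
    from this[of "B x - B (orth_proj H x)"] show ?thesis by simp
  qed
  \<comment> \<open>With this \<open>S\<close> the operator \<open>id_blinfun - Y\<close> has the
    same square as \<open>B\<close> and plays the role of |B|.\<close>
  define S where "S = id_blinfun - (B o\<^sub>L B)"
  have S: "S x = x - B (B x)" for x by (simp add: S_def blinfun.diff_left)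
  have nB: "norm (B x) \<le> norm x" for x
    using order_trans[OF norm_blinfun[of B x]] B(1) mult_right_mono[of "norm B" 1 "norm x"] by simp
  have "norm S \<le> 1"
  proof (rule norm_blinfun_bound)
    fix x
    have "(norm (S x))\<^sup>2 = (norm x)\<^sup>2 - 2 * inner (B (B x)) x + (norm (B (B x)))\<^sup>2"
      unfolding S power2_norm_eq_inner by (simp add: inner_diff_left inner_diff_right inner_commute)
    also have "inner (B (B x)) x = (norm (B x))\<^sup>2"
      by (simp add: B(3) power2_norm_eq_inner)
    also have "(norm x)\<^sup>2 - 2 * (norm (B x))\<^sup>2 + (norm (B (B x)))\<^sup>2 \<le> (norm x)\<^sup>2"
      using power_mono[OF nB[of "B x"] norm_ge_zero, of 2] zero_le_power2[of "norm (B x)"]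
      by linarith
    finally have "norm (S x) \<le> norm x" by (rule power2_le_imp_le) simp
    then show "norm (S x) \<le> 1 * norm x" by simp
  qed simp
  from square_root_iteration[OF this] obtain Y where Y: "norm Y \<le> 1" "2 *\<^sub>R Y = S + (Y o\<^sub>L Y)"
    "\<And>T. T o\<^sub>L S = S o\<^sub>L T \<Longrightarrow> T o\<^sub>L Y = Y o\<^sub>L T" by blast
  \<comment> \<open>What commutes with \<open>B\<close> commutes with \<open>S\<close> and hence
    with \<open>Y\<close>. This is used for \<open>B\<close> itself, for scalars, for the projection
    onto \<open>H\<close>, and for \<open>\<pi> s\<close> precomposed with that projection, which
    makes it linear on the whole space.\<close>
  have Ycomm: "T (Y x) = Y (T x)" if "bounded_linear T" "\<And>x. T (B x) = B (T x)" for T x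
  proof -
    have "Blinfun T o\<^sub>L S = S o\<^sub>L Blinfun T"
      by (rule blinfun_eqI) (simp add: S bounded_linear_Blinfun_apply[OF that(1)]
          linear_diff[OF bounded_linear.linear[OF that(1)]] that(2))
    then have "Blinfun T o\<^sub>L Y = Y o\<^sub>L Blinfun T" by (rule Y(3))
    then have "(Blinfun T o\<^sub>L Y) x = (Y o\<^sub>L Blinfun T) x" by simp
    then show ?thesis by (simp add: bounded_linear_Blinfun_apply[OF that(1)])
  qed
  have YB: "B (Y x) = Y (B x)" for x by (rule Ycomm) (simp_all add: blinfun.bounded_linear_right)
  have Y_scale: "Y (a *\<^sub>C x) = a *\<^sub>C Y x" for a x
    using Ycomm[OF bounded_linear_scaleC, of a x] B(2) by simp
  have YH: "Y x \<in> H" if "x \<in> H" for x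
  proof -
    have "orth_proj H (Y x) = Y (orth_proj H x)"
      by (rule Ycomm[OF bP]) (simp add: BP orth_proj_id[OF H B(4)])
    then show ?thesis using orth_proj_in[OF H, of "Y x"] that by (simp add: orth_proj_id[OF H])
  qed
  have Ypi: "Y (\<pi> s x) = \<pi> s (Y x)" if x: "x \<in> H" for s x
  proof -
    have 1: "bounded_linear (\<lambda>x. \<pi> s (orth_proj H x))"
      by (rule bounded_linear_intro[where K = 1])
         (simp_all add: linear_add[OF bounded_linear.linear[OF bP]] linear_scale[OF bounded_linear.linear[OF bP]]
           pi_lin(1) pi_lin(2)[OF orth_proj_in[OF H] orth_proj_in[OF H]] H orth_proj_in scaleR_scaleC orth_proj_scaleC unitary_between_norm[OF unit] norm_orth_proj_le)
    have "\<pi> s (orth_proj H (Y x)) = Y (\<pi> s (orth_proj H x))"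
      by (rule Ycomm[OF 1])
         (simp add: orth_proj_id[OF H B(4)] B(5)[OF orth_proj_in[OF H]] BP)
    then show ?thesis using x YH by (simp add: orth_proj_id[OF H])
  qed
  define W where "W = id_blinfun - Y - B"
  have W: "W x = x - Y x - B x" for x by (simp add: W_def blinfun.diff_left)
  define K where "K = {x\<in>H. W x = 0}"
  have "closed K"
  proof -
    have "K = H \<inter> W -` {0}" by (auto simp: K_def)
    moreover have "closed (W -` {0})"
      by (rule continuous_closed_vimage) (simp_all add: linear_continuous_at blinfun.bounded_linear_right)
    ultimately show ?thesis using closed_csubspaceD(1)[OF H] by auto
  qed
  moreover have "W (a *\<^sub>C x) = a *\<^sub>C W x" for a x
    by (simp add: W Y_scale B(2) scaleC_diff_right)
  ultimately have "closed_csubspace K"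
    using closed_csubspaceD(2-4)[OF H]
    by (simp add: closed_csubspace_def K_def blinfun.add_right blinfun.zero_right)
  moreover have "\<pi> s x \<in> K" if "x \<in> K" for s x
  proof -
    have x: "x \<in> H" "x = Y x + B x" using that by (simp_all add: K_def W algebra_simps)
    have "Y (\<pi> s x) + B (\<pi> s x) = \<pi> s (Y x + B x)"
      using x(1) by (simp add: Ypi B(5) pi_lin YH B(4))
    then show ?thesis using x pi by (simp add: K_def W algebra_simps)
  qed
  ultimately have "invariant_subspace \<pi> K" by (simp add: invariant_subspace_def)
  then have cases: "K = {0} \<or> K = H" using irr by (auto simp: irreducible_on_def K_def)
  \<comment> \<open>|B| is nonnegative because \<open>norm Y \<le> 1\<close>.\<close>
  have Qpos: "0 \<le> inner (x - Y x) x" for x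
  proof -
    have "inner (Y x) x \<le> norm (Y x) * norm x" by (rule norm_cauchy_schwarz)
    also have "\<dots> \<le> norm x * norm x"
      using order_trans[OF norm_blinfun[of Y x]] Y(1) mult_right_mono[of "norm Y" 1 "norm x"]
      by (intro mult_right_mono) auto
    finally show ?thesis by (simp add: inner_diff_left power2_norm_eq_inner[symmetric] power2_eq_square)
  qed
  from cases show ?thesis
  proof
    assume "K = H"
    then have "W x = 0" if "x \<in> H" for x using that by (auto simp: K_def)
    then have "B x = x - Y x" if "x \<in> H" for x using that by (simp add: W algebra_simps)
    then show ?thesis using Qpos by simp
  next
    assume K: "K = {0}"
    \<comment> \<open>|B| and B commute and have the same square, so |B| - B annihilates (|B| + B)
      x. With trivial kernel this gives B = -|B| on \<open>H\<close>.\<close>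
    have "B x = - (x - Y x)" if x: "x \<in> H" for x
    proof -
      have "2 *\<^sub>R Y x = S x + Y (Y x)"
        using arg_cong[OF Y(2), of "\<lambda>T. blinfun_apply T x"] by (simp add: blinfun.add_left blinfun.scaleR_left)
      then have "Y x + Y x = x - B (B x) + Y (Y x)" by (simp add: S scaleR_2)
      then have "W (x - Y x + B x) = 0"
        by (simp add: W blinfun.add_right blinfun.diff_right YB algebra_simps)
      moreover have "x - Y x + B x \<in> H"
        using x YH B(4) by (simp add: closed_csubspaceD[OF H])
      ultimately have "x - Y x + B x = 0" using K by (auto simp: K_def)
      then show ?thesis by (simp add: algebra_simps eq_neg_iff_add_eq_0)
    qed
    then show ?thesis using Qpos by (auto simp: inner_diff_left)
  qed
qed

text \<open>By \<open>irreducible_definite\<close> every shift \<open>A - a\<close> is semidefinite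
  on \<open>H\<close>. Taking for \<open>a\<close> the mean of two values of the Rayleigh quotient
  shows that they coincide; polarization then turns the constant quotient into an identity of
  operators.\<close>

lemma Schur_selfadjoint:
  fixes A :: "'h::complex_hilbert \<Rightarrow> 'h"
  assumes H: "closed_csubspace H" and irr: "irreducible_on \<pi> H"
    and unit: "\<And>s. unitary_between H H (\<pi> s)"
    and A: "bounded_op_on UNIV A" "\<And>x y. inner (A x) y = inner x (A y)" "\<And>x. A x \<in> H"
      "\<And>s x. x \<in> H \<Longrightarrow> A (\<pi> s x) = \<pi> s (A x)"
  shows "\<exists>c. \<forall>x\<in>H. A x = c *\<^sub>R x"
proof -
  have bA: "bounded_linear A" and scA: "\<And>a x. A (a *\<^sub>C x) = a *\<^sub>C A x" using bounded_op_on_UNIV[OF A(1)] by auto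
  have bP: "bounded_linear (orth_proj H)" and scP: "\<And>a x. orth_proj H (a *\<^sub>C x) = a *\<^sub>C orth_proj H x"
    using bounded_op_on_UNIV[OF bounded_op_orth_proj[OF H]] by auto
  have pi: "\<pi> s x \<in> H" if "x \<in> H" for s x
    using unit that by (auto simp: unitary_between_def bij_betw_def)
  have pi_lin: "\<pi> s (x + y) = \<pi> s x + \<pi> s y" "\<pi> s (a *\<^sub>C x) = a *\<^sub>C \<pi> s x" if "x \<in> H" "y \<in> H" for s x y a
    using unit that by (auto simp: unitary_between_def clinear_on_def)
  have pi_R: "\<pi> s (r *\<^sub>R x) = r *\<^sub>R \<pi> s x" if "x \<in> H" for s x r
    using pi_lin(2)[OF that that] by (simp add: scaleR_scaleC)
  have pi_diff: "\<pi> s (x - y) = \<pi> s x - \<pi> s y" if "x \<in> H" "y \<in> H" for s x y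
    using pi_lin(1)[of x "(-1) *\<^sub>R y" s] pi_R[of y s "-1"] that closed_csubspaceD(5)[OF H, of y "-1"] by simp
  have dich: "(\<forall>x\<in>H. a * (norm x)\<^sup>2 \<le> inner (A x) x) \<or> (\<forall>x\<in>H. inner (A x) x \<le> a * (norm x)\<^sup>2)" for a :: real
  proof -
    \<comment> \<open>The shift uses \<open>orth_proj H\<close> rather than the identity so that the
      range stays in \<open>H\<close>. The factor \<open>M\<close> below only normalizes the norm,
      with \<open>+ 1\<close> to keep it positive.\<close>
    define B' where "B' x = A x - a *\<^sub>R orth_proj H x" for x
    have bB: "bounded_linear B'"
      unfolding B'_def using bA bP by (intro bounded_linear_sub bounded_linear_scaleR_const bounded_linear_const_scaleR)
    define M where "M = norm (Blinfun B') + 1"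
    have M: "0 < M" by (simp add: M_def add_nonneg_pos)
    define B where "B = (1 / M) *\<^sub>R Blinfun B'"
    have B: "B x = (1 / M) *\<^sub>R B' x" for x
      by (simp add: B_def blinfun.scaleR_left bounded_linear_Blinfun_apply[OF bB])
    have "(\<forall>x\<in>H. 0 \<le> inner (B x) x) \<or> (\<forall>x\<in>H. inner (B x) x \<le> 0)"
    proof (rule irreducible_definite[OF H irr unit])
      show "norm B \<le> 1" using M by (simp add: B_def M_def divide_simps)
      show "B (c *\<^sub>C x) = c *\<^sub>C B x" for c x
      proof -
        have "B' (c *\<^sub>C x) = c *\<^sub>C B' x"
          unfolding B'_def scA scP by (simp add: scaleR_scaleC scaleC_scaleC scaleC_diff_right mult.commute)
        then show ?thesis by (simp add: B scaleR_scaleC scaleC_scaleC mult.commute)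
      qed
      show "inner (B x) y = inner x (B y)" for x y
      proof -
        have "inner (orth_proj H x) y = inner x (orth_proj H y)"
          by (simp add: inner_eq_Re_cinner orth_proj_sym[OF H])
        then show ?thesis by (simp add: B B'_def inner_diff_left inner_diff_right A(2))
      qed
      show "B x \<in> H" for x
        by (simp add: B B'_def closed_csubspaceD[OF H] A(3) orth_proj_in[OF H])
      show "B (\<pi> s x) = \<pi> s (B x)" if "x \<in> H" for s x
        using that by (simp add: B B'_def orth_proj_id[OF H] pi A(3,4) pi_R pi_diff closed_csubspaceD[OF H])
    qed
    moreover have "inner (B x) x = (1 / M) * (inner (A x) x - a * (norm x)\<^sup>2)" if "x \<in> H" for x
      using that by (simp add: B B'_def orth_proj_id[OF H] inner_diff_left power2_norm_eq_inner)
    ultimately show ?thesis using M by (simp add: zero_le_divide_iff divide_le_0_iff)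
  qed
  define q where "q x = inner (A x) x / (norm x)\<^sup>2" for x
  have "\<exists>c. \<forall>x\<in>H. inner (A x) x = c * (norm x)\<^sup>2"
  proof (cases "\<exists>z\<in>H. z \<noteq> 0")
    case True
    then obtain z where z: "z \<in> H" "z \<noteq> 0" by blast
    have "q x = q z" if "x \<in> H" "x \<noteq> 0" for x
    proof -
      define m where "m = (q x + q z) / 2"
      have "m \<le> q x \<and> m \<le> q z \<or> q x \<le> m \<and> q z \<le> m"
        using dich[of m] z that by (auto simp: q_def pos_le_divide_eq pos_divide_le_eq)
      then show ?thesis by (auto simp: m_def field_simps)
    qed
    moreover have "inner (A x) x = q x * (norm x)\<^sup>2" for x by (simp add: q_def)
    ultimately have "inner (A x) x = q z * (norm x)\<^sup>2" if "x \<in> H" for x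
      using that by (cases "x = 0") simp_all
    then show ?thesis by blast
  next
    case False
    then show ?thesis by (auto intro!: exI[of _ 0])
  qed
  then obtain c where c: "\<And>x. x \<in> H \<Longrightarrow> inner (A x) x = c * (norm x)\<^sup>2" by blast
  have "A x = c *\<^sub>R x" if x: "x \<in> H" for x
  proof -
    \<comment> \<open>Polarizing the quadratic identity at \<open>x\<close> with this particular
      \<open>y\<close> gives \<open>inner y y = 0\<close>.\<close>
    define y where "y = A x - c *\<^sub>R x"
    have y: "y \<in> H" "x + y \<in> H" using x A(3) by (simp_all add: y_def closed_csubspaceD[OF H])
    have "inner (A (x + y)) (x + y) = inner (A x) x + 2 * inner (A x) y + inner (A y) y"
      by (simp add: linear_add[OF bounded_linear.linear[OF bA]] inner_add_left inner_add_right)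
         (metis A(2) inner_commute)
    moreover have "c * (norm (x + y))\<^sup>2 = c * (norm x)\<^sup>2 + 2 * c * inner x y + c * (norm y)\<^sup>2"
      by (simp add: power2_norm_eq_inner inner_add_left inner_add_right inner_commute algebra_simps)
    ultimately have "inner (A x) y = c * inner x y" using c[OF x] c[OF y(1)] c[OF y(2)] by simp
    then have "inner y y = 0" by (subst y_def) (simp add: inner_diff_left)
    then show ?thesis by (simp add: y_def)
  qed
  then show ?thesis by blast
qed

section \<open>Compactly supported functions\<close>

text \<open>\<open>Cc\<close> for arbitrary values: bump functions and Haar functionals are treated
  over the reals, coefficients over the complex numbers.\<close>

definition csupp :: "('g::locally_compact_group \<Rightarrow> 'b::real_normed_vector) \<Rightarrow> bool" where
  "csupp f \<longleftrightarrow> continuous_on UNIV f \<and> compact (closure {s. f s \<noteq> 0})"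

lemma Cc_iff_csupp: "f \<in> Cc \<longleftrightarrow> csupp f"
  by (simp add: Cc_def csupp_def)

lemma csupp_iff:
  "csupp f \<longleftrightarrow> continuous_on UNIV f \<and> (\<exists>K. compact K \<and> (\<forall>x. x \<notin> K \<longrightarrow> f x = 0))"
proof safe
  assume "csupp f"
  then show "continuous_on UNIV f" "\<exists>K. compact K \<and> (\<forall>x. x \<notin> K \<longrightarrow> f x = 0)"
    using closure_subset[of "{s. f s \<noteq> 0}"] by (auto simp: csupp_def intro!: exI[of _ "closure {s. f s \<noteq> 0}"])
next
  fix K assume f: "continuous_on UNIV f" and K: "compact K" "\<forall>x. x \<notin> K \<longrightarrow> f x = 0"
  have "closure {s. f s \<noteq> 0} \<subseteq> K" using K by (intro closure_minimal compact_imp_closed) auto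
  then have "closure {s. f s \<noteq> 0} = K \<inter> closure {s. f s \<noteq> 0}" by blast
  then have "compact (closure {s. f s \<noteq> 0})" using compact_Int_closed[OF K(1) closed_closure] by metis
  then show "csupp f" using f by (simp add: csupp_def)
qed

lemma csuppE:
  assumes "csupp f"
  obtains K where "compact K" "\<And>x. x \<notin> K \<Longrightarrow> f x = 0"
  using assms by (auto simp: csupp_iff)

lemma csuppI:
  assumes "continuous_on UNIV f" "compact K" "\<And>x. x \<notin> K \<Longrightarrow> f x = 0"
  shows "csupp f"
  using assms by (auto simp: csupp_iff)

lemma csupp_continuous: "csupp f \<Longrightarrow> continuous_on UNIV f"
  by (simp add: csupp_def)

lemma csupp_measurable: "csupp f \<Longrightarrow> f \<in> borel_measurable borel"
  by (intro borel_measurable_continuous_onI csupp_continuous)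

lemma csupp_translate_right:
  assumes f: "csupp f" shows "csupp (\<lambda>t. f (t + s))"
proof -
  obtain K where K: "compact K" "\<And>x. x \<notin> K \<Longrightarrow> f x = 0" using csuppE[OF f] by blast
  show ?thesis
  proof (rule csuppI)
    show "continuous_on UNIV (\<lambda>t. f (t + s))"
      by (rule continuous_on_compose2[OF csupp_continuous[OF f]]) (auto intro!: continuous_intros)
    show "compact ((\<lambda>x. x + - s) ` K)" by (intro compact_continuous_image K continuous_intros)
    show "f (x + s) = 0" if "x \<notin> (\<lambda>x. x + - s) ` K" for x
    proof (rule K(2), rule notI)
      assume "x + s \<in> K"
      then have "x + s + - s \<in> (\<lambda>x. x + - s) ` K" by blast
      then show False using that by (simp add: add.assoc)
    qed
  qed
qed

lemma csupp_uminus: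
  assumes f: "csupp f" shows "csupp (\<lambda>t. f (- t))"
proof -
  obtain K where K: "compact K" "\<And>x. x \<notin> K \<Longrightarrow> f x = 0" using csuppE[OF f] by blast
  show ?thesis
  proof (rule csuppI)
    show "continuous_on UNIV (\<lambda>t. f (- t))"
      by (rule continuous_on_compose2[OF csupp_continuous[OF f]]) (auto intro!: continuous_intros)
    show "compact (uminus ` K)" by (intro compact_continuous_image K continuous_intros)
    show "f (- x) = 0" if "x \<notin> uminus ` K" for x
      using that K(2)[of "- x"] by (metis image_eqI minus_minus)
  qed
qed

lemma csupp_mult:
  fixes f g :: "'g::locally_compact_group \<Rightarrow> 'b::real_normed_algebra"
  assumes f: "csupp f" and g: "continuous_on UNIV g"
  shows "csupp (\<lambda>x. f x * g x)" "csupp (\<lambda>x. g x * f x)"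
proof -
  obtain K where K: "compact K" "\<And>x. x \<notin> K \<Longrightarrow> f x = 0" using csuppE[OF f] by blast
  show "csupp (\<lambda>x. f x * g x)" "csupp (\<lambda>x. g x * f x)"
    by (rule csuppI[OF _ K(1)]; simp add: K(2) continuous_on_mult csupp_continuous f g)+
qed

lemma csupp_compose:
  assumes f: "csupp f" and g: "continuous_on UNIV g" "g 0 = 0"
  shows "csupp (\<lambda>x. g (f x))"
proof -
  obtain K where K: "compact K" "\<And>x. x \<notin> K \<Longrightarrow> f x = 0" using csuppE[OF f] by blast
  show ?thesis
    by (rule csuppI[OF continuous_on_compose2[OF g(1) csupp_continuous[OF f]] K(1)]) (auto simp: K(2) g(2))
qed

lemma csupp_bounded:
  assumes "csupp f"
  obtains B where "0 < B" "\<And>x. norm (f x) \<le> B"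
proof -
  obtain K where K: "compact K" "\<And>x. x \<notin> K \<Longrightarrow> f x = 0" using csuppE[OF assms] by blast
  have "compact (f ` K)"
    using K(1) csupp_continuous[OF assms] continuous_on_subset by (blast intro: compact_continuous_image)
  then obtain B where B: "0 < B" "\<And>y. y \<in> f ` K \<Longrightarrow> norm y \<le> B"
    using compact_imp_bounded bounded_pos by metis
  have "norm (f x) \<le> B" for x using B K(2)[of x] by (cases "x \<in> K") auto
  with B(1) show thesis by (rule that)
qed

lemma compact_borel: "compact (K :: 'g::locally_compact_group set) \<Longrightarrow> K \<in> sets borel"
  by (simp add: borel_closed compact_imp_closed del: closed_closedin)

lemma compact_set_minus:
  fixes K L :: "'g::locally_compact_group set"
  assumes "compact K" "compact L"
  shows "compact ((\<lambda>(x, y). x + - y) ` (K \<times> L))"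
  unfolding case_prod_beta by (intro compact_continuous_image compact_Times assms continuous_intros)

lemma csupp_integrable:
  fixes f :: "'g::locally_compact_group \<Rightarrow> 'b::{banach,second_countable_topology}"
  assumes f: "csupp f"
  shows "integrable haar f"
proof -
  obtain K where K: "compact K" "\<And>x. x \<notin> K \<Longrightarrow> f x = 0" using csuppE[OF f] by blast
  obtain B where B: "0 < B" "\<And>x. norm (f x) \<le> B" using csupp_bounded[OF f] by blast
  show ?thesis
  proof (rule Bochner_Integration.integrable_bound)
    show "integrable haar (\<lambda>x. indicat_real K x * B)"
      using haar_finite_compact[OF K(1)] compact_borel[OF K(1)]
      by (intro integrable_mult_left integrable_real_indicator) auto
    show "AE x in haar. norm (f x) \<le> norm (indicat_real K x * B)"
      using B K(2) by (intro AE_I2) (auto simp: indicator_def)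
  qed (simp add: csupp_measurable[OF f])
qed

lemma csupp_square_integrable:
  assumes "csupp f" shows "square_integrable f"
proof -
  have "csupp (\<lambda>x. (cmod (f x))\<^sup>2)"
    by (rule csupp_compose[OF assms]) (auto intro!: continuous_intros)
  then show ?thesis
    using csupp_measurable[OF assms] csupp_integrable by (auto simp: square_integrable_def)
qed

section \<open>Compact neighbourhoods and Urysohn functions\<close>

lemma compact_nhd:
  fixes x :: "'g::locally_compact_group"
  obtains U K where "open U" "compact K" "x \<in> U" "U \<subseteq> K"
proof -
  have "\<exists>U K. open U \<and> compact K \<and> x \<in> U \<and> U \<subseteq> K"
    using locally_compact[where 'a='g] unfolding locally_compact_space_def by auto
  then show thesis using that by blast
qed

lemma compact_nhd_compact:
  fixes K :: "'g::locally_compact_group set"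
  assumes K: "compact K"
  obtains W C where "open W" "compact C" "K \<subseteq> W" "W \<subseteq> C"
proof -
  have "\<forall>x::'g. \<exists>U C. open U \<and> compact C \<and> x \<in> U \<and> U \<subseteq> C" by (meson compact_nhd)
  then obtain U C where UC: "\<And>x::'g. open (U x)" "\<And>x. compact (C x)" "\<And>x. x \<in> U x" "\<And>x. U x \<subseteq> C x"
    by metis
  obtain F where F: "F \<subseteq> K" "finite F" "K \<subseteq> (\<Union>x\<in>F. U x)"
    using compactE_image[OF K, of K U] UC(1,3) by blast
  show thesis
  proof
    show "open (\<Union>x\<in>F. U x)" using UC(1) by blast
    show "compact (\<Union>x\<in>F. C x)" using F(2) UC(2) by (intro compact_UN) auto
    show "K \<subseteq> (\<Union>x\<in>F. U x)" by fact
    show "(\<Union>x\<in>F. U x) \<subseteq> (\<Union>x\<in>F. C x)" using UC(4) by blast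
  qed
qed

lemma csupp_Urysohn:
  fixes K U :: "'g::locally_compact_group set"
  assumes K: "compact K" and U: "open U" "K \<subseteq> U"
  obtains f :: "'g \<Rightarrow> real" where "csupp f" "\<And>x. 0 \<le> f x" "\<And>x. f x \<le> 1"
    "\<And>x. x \<in> K \<Longrightarrow> f x = 1" "\<And>x. x \<notin> U \<Longrightarrow> f x = 0"
proof -
  obtain W C where W: "open W" "compact C" "K \<subseteq> W" "W \<subseteq> C" 
    by (rule compact_nhd_compact[OF K])
  have "locally_compact_space (euclidean :: 'g topology)" by (rule locally_compact)
  moreover have "Hausdorff_space (euclidean :: 'g topology)"
    unfolding Hausdorff_space_def disjnt_def open_openin[symmetric]
    by simp (meson hausdorff)
  ultimately have cr: "completely_regular_space (euclidean :: 'g topology)"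
    by (simp add: locally_compact_regular_imp_completely_regular_space)
  \<comment> \<open>Cutting \<open>U\<close> down to \<open>U \<inter> W\<close> confines the
    function to the compact set \<open>C\<close>, which turns complete regularity into compact
    support.\<close>
  have cd: "closedin euclidean (- (U \<inter> W))" "disjnt K (- (U \<inter> W))"
    using U W(1,3) by (auto simp: disjnt_def closed_Compl open_Int)
  obtain f :: "'g \<Rightarrow> real" where f: "continuous_map euclidean (top_of_set {0..1}) f"
    "f ` (- (U \<inter> W)) \<subseteq> {0}" "f ` K \<subseteq> {1}"
    by (rule Urysohn_completely_regular_compact_closed[OF zero_le_one cr _ cd]) (use K in simp_all)
  have f01: "f x \<in> {0..1}" for x
    using f(1) by (auto simp: continuous_map_in_subtopology)
  show thesis
  proof
    have "continuous_on UNIV f" using f(1) by (simp add: continuous_map_in_subtopology)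
    then show "csupp f" by (rule csuppI[OF _ W(2)]) (use f(2) W(4) in blast)
  qed (use f f01 in auto)
qed

section \<open>Haar integrals\<close>

lemma measurable_haar [simp]: "measurable haar haar = measurable borel (borel :: 'g::locally_compact_group measure)"
  by (rule measurable_cong_sets) simp_all

lemma integral_haar_translate:
  fixes f :: "'g::locally_compact_group \<Rightarrow> 'b::{banach,second_countable_topology}"
  assumes [measurable]: "f \<in> borel_measurable borel"
  shows "(\<integral>t. f (s + t) \<partial>haar) = (\<integral>t. f t \<partial>haar)"
proof -
  have "(\<integral>t. f t \<partial>distr haar haar ((+) s)) = (\<integral>t. f (s + t) \<partial>haar)"
    by (rule integral_distr) simp_all
  then show ?thesis by (simp add: distr_haar_translate)
qed

section \<open>Uniform continuity and the product theorem\<close>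

lemma csupp_uniformly_continuous:
  fixes f :: "'g::locally_compact_group \<Rightarrow> 'b::real_normed_vector"
  assumes f: "csupp f" and e: "0 < e"
  obtains U where "open U" "0 \<in> U" "\<And>u s. u \<in> U \<Longrightarrow> norm (f (u + s) - f s) < e"
proof -
  obtain K where K: "compact K" "\<And>x. x \<notin> K \<Longrightarrow> f x = 0" using csuppE[OF f] by blast
  \<comment> \<open>The tube lemma around \<open>{0} \<times> K\<close> makes the estimate uniform
    for \<open>s\<close> in the compact set \<open>K\<close>.\<close>
  define W where "W = (\<lambda>(u, s). norm (f (u + s) - f s)) -` {..<e}"
  have "continuous_on UNIV (\<lambda>p. norm (f (fst p + snd p) - f (snd p)))"
    by (intro continuous_intros continuous_on_compose2[OF csupp_continuous[OF f]]) auto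
  then have "open W" unfolding W_def case_prod_beta by (simp add: open_vimage)
  moreover have "\<forall>y\<in>K. (0, y) \<in> W" using e by (simp add: W_def)
  ultimately have "\<exists>V. 0 \<in> V \<and> open V \<and> V \<times> K \<subseteq> W"
    using K(1) by (intro Elementary_Topology.tube_lemma) auto
  then obtain V where V: "open V" "0 \<in> V" "V \<times> K \<subseteq> W"
    by blast
  have VK: "norm (f (u + s) - f s) < e" if "u \<in> V" "s \<in> K" for u s
    using V(3) that by (auto simp: W_def)
  show thesis
  proof
    \<comment> \<open>Symmetrized so that a point outside \<open>K\<close> moved into
      \<open>K\<close> by \<open>u\<close> is reached from inside \<open>K\<close> by
      \<open>- u\<close>.\<close>
    show "open (V \<inter> uminus -` V)" using V(1) by (intro open_Int open_vimage continuous_intros)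
    show "0 \<in> V \<inter> uminus -` V" using V(2) by simp
    fix u s assume u: "u \<in> V \<inter> uminus -` V"
    show "norm (f (u + s) - f s) < e"
    proof (cases "s \<in> K \<or> u + s \<notin> K")
      case True
      then show ?thesis using VK[of u s] u e K(2)[of s] K(2)[of "u + s"] by (cases "s \<in> K") auto
    next
      case False
      then have "norm (f (- u + (u + s)) - f (u + s)) < e" using u by (intro VK) auto
      then show ?thesis by (simp add: norm_minus_commute)
    qed
  qed
qed

lemma csupp_uniformly_continuous_right:
  fixes f :: "'g::locally_compact_group \<Rightarrow> 'b::real_normed_vector"
  assumes f: "csupp f" and e: "0 < e"
  obtains U where "open U" "0 \<in> U" "\<And>u s. u \<in> U \<Longrightarrow> norm (f (s + u) - f s) < e"
proof -
  obtain U where U: "open U" "0 \<in> U" "\<And>u s. u \<in> U \<Longrightarrow> norm (f (- (u + s)) - f (- s)) < e"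
    using csupp_uniformly_continuous[OF csupp_uminus[OF f] e] by blast
  show thesis
  proof
    show "open (uminus -` U)" using U(1) by (intro open_vimage continuous_intros)
    show "0 \<in> uminus -` U" using U(2) by simp
    show "norm (f (s + u) - f s) < e" if "u \<in> uminus -` U" for u s
      using U(3)[of "- u" "- s"] that by (simp add: minus_add)
  qed
qed

text \<open>Without second countability the Borel sets of \<open>G \<times> G\<close> need not be generated by
  rectangles. On \<open>K \<times> G\<close> with \<open>K\<close> compact, \<open>h (\<sigma> t + s)\<close> is nevertheless a uniform limit
  of sums of products, which makes the product theorem applicable.\<close>

lemma kernel_measurable:
  fixes h :: "'g::locally_compact_group \<Rightarrow> 'b::{banach,second_countable_topology}" and \<sigma> :: "'g \<Rightarrow> 'g"
  assumes h: "csupp h" and \<sigma>: "continuous_on UNIV \<sigma>" and K: "compact K"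
  shows "(\<lambda>(t, s). indicat_real K t *\<^sub>R h (\<sigma> t + s)) \<in> borel_measurable (borel \<Otimes>\<^sub>M borel)"
proof -
  have hm [measurable]: "h \<in> borel_measurable borel" by (rule csupp_measurable[OF h])
  have Km [measurable]: "K \<in> sets borel" by (rule compact_borel[OF K])
  have "\<exists>Q\<in>borel_measurable (borel \<Otimes>\<^sub>M borel).
      \<forall>t\<in>K. \<forall>s. norm (Q (t, s) - h (\<sigma> t + s)) \<le> 1 / real (Suc n)" for n
  proof -
    obtain U where U: "open U" "0 \<in> U" "\<And>u s. u \<in> U \<Longrightarrow> norm (h (u + s) - h s) < 1 / real (Suc n)"
      by (rule csupp_uniformly_continuous[OF h, of "1 / real (Suc n)"]) auto
    define V where "V x = (\<lambda>t. \<sigma> t + - \<sigma> x) -` U" for x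
    have V: "open (V x)" for x
      unfolding V_def using U(1) by (intro open_vimage continuous_intros \<sigma>)
    have "x \<in> V x" for x using U(2) by (simp add: V_def)
    then have "K \<subseteq> (\<Union>x\<in>K. V x)" by blast
    then obtain F where F: "F \<subseteq> K" "finite F" "K \<subseteq> (\<Union>x\<in>F. V x)"
      by (rule compactE_image[OF K V])
    from F(2) obtain xs where xs: "set xs = F" using finite_list by blast
    \<comment> \<open>The cover is made disjoint: exactly one summand of \<open>Q\<close> is active
      at each \<open>t\<close> in \<open>K\<close>.\<close>
    define A where "A i = V (xs ! i) - (\<Union>j<i. V (xs ! j))" for i
    have Am [measurable]: "A i \<in> sets borel" for i unfolding A_def using V by auto
    define Q where "Q p = (\<Sum>i<length xs. indicat_real (A i) (fst p) *\<^sub>R h (\<sigma> (xs ! i) + snd p))" for p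
    have "Q \<in> borel_measurable (borel \<Otimes>\<^sub>M borel)" unfolding Q_def
    proof (intro borel_measurable_sum borel_measurable_scaleR)
      fix i
      show "(\<lambda>p. indicat_real (A i) (fst p)) \<in> borel_measurable (borel \<Otimes>\<^sub>M borel)" by measurable
      have "(\<lambda>s. h (\<sigma> (xs ! i) + s)) \<in> borel_measurable borel" by measurable
      then show "(\<lambda>p. h (\<sigma> (xs ! i) + snd p)) \<in> borel_measurable (borel \<Otimes>\<^sub>M borel)"
        by (rule measurable_compose[OF measurable_snd])
    qed
    moreover have "norm (Q (t, s) - h (\<sigma> t + s)) \<le> 1 / real (Suc n)" if t: "t \<in> K" for t s
    proof -
      have ex: "\<exists>i. i < length xs \<and> t \<in> V (xs ! i)"
      proof -
        obtain x where "x \<in> set xs" "t \<in> V x" using F(3) t xs by blast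
        then show ?thesis by (metis in_set_conv_nth)
      qed
      define i where "i = (LEAST i. i < length xs \<and> t \<in> V (xs ! i))"
      have i: "i < length xs" "t \<in> V (xs ! i)" using LeastI_ex[OF ex] by (simp_all add: i_def)
      have "j < i \<Longrightarrow> t \<notin> V (xs ! j)" for j using not_less_Least[of j] i(1) unfolding i_def by fastforce
      then have tA: "t \<in> A j \<longleftrightarrow> j = i" for j
        using i(2) by (auto simp: A_def) (metis lessThan_iff linorder_neqE_nat)
      have "Q (t, s) = (\<Sum>j<length xs. if j = i then h (\<sigma> (xs ! i) + s) else 0)"
        unfolding Q_def by (intro sum.cong) (auto simp: tA indicator_def)
      then have "Q (t, s) = h (\<sigma> (xs ! i) + s)" using i(1) by simp
      moreover have "\<sigma> t + s = (\<sigma> t + - \<sigma> (xs ! i)) + (\<sigma> (xs ! i) + s)"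
        by (simp only: add.assoc minus_add_cancel)
      ultimately show ?thesis
        using U(3)[of "\<sigma> t + - \<sigma> (xs ! i)" "\<sigma> (xs ! i) + s"] i(2)
        by (simp add: V_def norm_minus_commute less_imp_le)
    qed
    ultimately show ?thesis by blast
  qed
  then obtain Q where Q: "\<And>n. Q n \<in> borel_measurable (borel \<Otimes>\<^sub>M borel)"
    "\<And>n t s. t \<in> K \<Longrightarrow> norm (Q n (t, s) - h (\<sigma> t + s)) \<le> 1 / real (Suc n)" by metis
  show ?thesis
  proof (rule borel_measurable_LIMSEQ_metric)
    show "(\<lambda>p. indicat_real K (fst p) *\<^sub>R Q n p) \<in> borel_measurable (borel \<Otimes>\<^sub>M borel)" for n
      using Q(1)[of n] by measurable
    fix p :: "'g \<times> 'g"
    show "(\<lambda>n. indicat_real K (fst p) *\<^sub>R Q n p) \<longlonglongrightarrow> (case p of (t, s) \<Rightarrow> indicat_real K t *\<^sub>R h (\<sigma> t + s))"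
    proof (cases "fst p \<in> K")
      case True
      have "(\<lambda>n. Q n p - h (\<sigma> (fst p) + snd p)) \<longlonglongrightarrow> 0"
        using Q(2)[OF True, of _ "snd p"]
        by (intro Lim_null_comparison[OF _ LIMSEQ_Suc[OF lim_1_over_n]]) auto
      then show ?thesis using True by (simp add: LIM_zero_iff case_prod_beta)
    qed (simp add: case_prod_beta)
  qed
qed

text \<open>The compact supports of \<phi> and g cut Haar measure down to finite measures on
  \<open>K\<close> and \<open>L\<close>, where the classical theorem applies;
  \<open>kernel_measurable\<close> supplies joint measurability. The map \<sigma> allows for both
  kernels \<open>h (t + s)\<close> and \<open>h (- t + s)\<close>.\<close>

lemma kernel_Fubini:
  fixes \<phi> g h :: "'g::locally_compact_group \<Rightarrow> 'b::{banach,second_countable_topology,real_normed_field}"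
    and \<sigma> :: "'g \<Rightarrow> 'g"
  assumes \<phi>: "csupp \<phi>" and g: "csupp g" and h: "csupp h" and \<sigma>: "continuous_on UNIV \<sigma>"
  shows "(\<integral>t. (\<integral>s. \<phi> t * h (\<sigma> t + s) * g s \<partial>haar) \<partial>haar) = (\<integral>s. (\<integral>t. \<phi> t * h (\<sigma> t + s) * g s \<partial>haar) \<partial>haar)"
proof -
  obtain K where K: "compact K" "\<And>x. x \<notin> K \<Longrightarrow> \<phi> x = 0" using csuppE[OF \<phi>] by blast
  obtain L where L: "compact L" "\<And>x. x \<notin> L \<Longrightarrow> g x = 0" using csuppE[OF g] by blast
  obtain B1 where B1: "0 < B1" "\<And>x. norm (\<phi> x) \<le> B1" using csupp_bounded[OF \<phi>] by blast
  obtain B2 where B2: "0 < B2" "\<And>x. norm (g x) \<le> B2" using csupp_bounded[OF g] by blast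
  obtain B3 where B3: "0 < B3" "\<And>x. norm (h x) \<le> B3" using csupp_bounded[OF h] by blast
  have [measurable]: "K \<in> sets borel" "L \<in> sets borel" using K(1) L(1) by (simp_all add: compact_borel)
  have [measurable]: "\<phi> \<in> borel_measurable borel" "g \<in> borel_measurable borel" "h \<in> borel_measurable borel"
    using \<phi> g h by (simp_all add: csupp_measurable)
  have \<sigma>m [measurable]: "\<sigma> \<in> borel_measurable borel" using \<sigma> by (rule borel_measurable_continuous_onI)
  define M :: "'g set \<Rightarrow> 'g measure" where "M C = density haar (\<lambda>x. ennreal (indicat_real C x))" for C
  have fin: "finite_measure (M C)" if "compact C" for C
  proof
    have "emeasure (M C) UNIV = emeasure haar C"
      using compact_borel[OF that] by (simp add: M_def emeasure_density ennreal_indicator)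
    then show "emeasure (M C) (space (M C)) \<noteq> \<infinity>" using haar_finite_compact[OF that] by (simp add: M_def)
  qed
  have sets_M [measurable_cong, simp]: "sets (M C) = sets borel" for C by (simp add: M_def)
  interpret M1: finite_measure "M K" by (rule fin[OF K(1)])
  interpret M2: finite_measure "M L" by (rule fin[OF L(1)])
  interpret P: pair_sigma_finite "M K" "M L" ..
  interpret PF: finite_measure "M K \<Otimes>\<^sub>M M L"
    by (rule finite_measure_pair_measure) unfold_locales
  define F where "F = (\<lambda>t s. \<phi> t * h (\<sigma> t + s) * g s)"
  have Fm: "case_prod F \<in> borel_measurable (M K \<Otimes>\<^sub>M M L)"
  proof -
    have "(\<lambda>p. \<phi> (fst p) * (case p of (t, s) \<Rightarrow> indicat_real K t *\<^sub>R h (\<sigma> t + s)) * g (snd p))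
        \<in> borel_measurable (borel \<Otimes>\<^sub>M borel)"
      using kernel_measurable[OF h \<sigma> K(1)] by measurable
    also have "(\<lambda>p. \<phi> (fst p) * (case p of (t, s) \<Rightarrow> indicat_real K t *\<^sub>R h (\<sigma> t + s)) * g (snd p)) = case_prod F"
      using K(2) by (auto simp: F_def fun_eq_iff indicator_def)
    finally show ?thesis
      by (simp cong: measurable_cong_sets sets_pair_measure_cong)
  qed
  have "integrable (M K \<Otimes>\<^sub>M M L) (case_prod F)"
  proof (rule PF.integrable_const_bound[OF _ Fm])
    show "AE p in M K \<Otimes>\<^sub>M M L. norm (case_prod F p) \<le> B1 * B3 * B2"
      using B1 B2 B3 by (intro AE_I2) (auto simp: F_def norm_mult intro!: mult_mono)
  qed
  then have Fub: "(\<integral>s. (\<integral>t. F t s \<partial>M K) \<partial>M L) = (\<integral>t. (\<integral>s. F t s \<partial>M L) \<partial>M K)"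
    by (rule P.Fubini_integral)
  have inner_t: "(\<integral>t. F t s \<partial>M K) = (\<integral>t. F t s \<partial>haar)" for s
  proof -
    have cF: "continuous_on UNIV (\<lambda>t. F t s)"
      unfolding F_def
      by (intro continuous_intros csupp_continuous[OF \<phi>] continuous_on_compose2[OF csupp_continuous[OF h]] \<sigma>) auto
    have "(\<integral>t. F t s \<partial>M K) = (\<integral>t. indicat_real K t *\<^sub>R F t s \<partial>haar)"
      unfolding M_def by (rule integral_density) (use cF in \<open>auto simp: borel_measurable_continuous_onI\<close>)
    also have "(\<lambda>t. indicat_real K t *\<^sub>R F t s) = (\<lambda>t. F t s)"
      using K(2) by (auto simp: F_def indicator_def)
    finally show ?thesis .
  qed
  have inner_s: "(\<integral>s. F t s \<partial>M L) = (\<integral>s. F t s \<partial>haar)" for t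
  proof -
    have "(\<integral>s. F t s \<partial>M L) = (\<integral>s. indicat_real L s *\<^sub>R F t s \<partial>haar)"
      unfolding M_def F_def by (rule integral_density) auto
    also have "(\<lambda>s. indicat_real L s *\<^sub>R F t s) = (\<lambda>s. F t s)"
      using L(2) by (auto simp: F_def indicator_def)
    finally show ?thesis .
  qed
  have "(\<lambda>t. \<integral>s. F t s \<partial>M L) \<in> borel_measurable (M K)"
    by (rule M2.borel_measurable_lebesgue_integral) (rule Fm)
  then have mt: "(\<lambda>t. \<integral>s. F t s \<partial>haar) \<in> borel_measurable borel"
    by (simp add: inner_s cong: measurable_cong_sets)
  have "(\<lambda>s. \<integral>t. F t s \<partial>M K) \<in> borel_measurable (M L)"
  proof (rule M1.borel_measurable_lebesgue_integral)
    have "(\<lambda>p. case_prod F (snd p, fst p)) \<in> borel_measurable (M L \<Otimes>\<^sub>M M K)"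
      using Fm by measurable
    then show "(\<lambda>(s, t). F t s) \<in> borel_measurable (M L \<Otimes>\<^sub>M M K)" by (simp add: case_prod_beta)
  qed
  then have ms: "(\<lambda>s. \<integral>t. F t s \<partial>haar) \<in> borel_measurable borel"
    by (simp add: inner_t cong: measurable_cong_sets)
  have "(\<integral>s. (\<integral>t. F t s \<partial>haar) \<partial>M L) = (\<integral>s. indicat_real L s *\<^sub>R (\<integral>t. F t s \<partial>haar) \<partial>haar)"
    unfolding M_def by (rule integral_density) (use ms in auto)
  also have "(\<lambda>s. indicat_real L s *\<^sub>R (\<integral>t. F t s \<partial>haar)) = (\<lambda>s. \<integral>t. F t s \<partial>haar)"
    using L(2) by (auto simp: F_def indicator_def)
  finally have outer_s: "(\<integral>s. (\<integral>t. F t s \<partial>haar) \<partial>M L) = (\<integral>s. (\<integral>t. F t s \<partial>haar) \<partial>haar)" .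
  have "(\<integral>t. (\<integral>s. F t s \<partial>haar) \<partial>M K) = (\<integral>t. indicat_real K t *\<^sub>R (\<integral>s. F t s \<partial>haar) \<partial>haar)"
    unfolding M_def by (rule integral_density) (use mt in auto)
  also have "(\<lambda>t. indicat_real K t *\<^sub>R (\<integral>s. F t s \<partial>haar)) = (\<lambda>t. \<integral>s. F t s \<partial>haar)"
    using K(2) by (auto simp: F_def indicator_def)
  finally have outer_t: "(\<integral>t. (\<integral>s. F t s \<partial>haar) \<partial>M K) = (\<integral>t. (\<integral>s. F t s \<partial>haar) \<partial>haar)" .
  show ?thesis using Fub[symmetric] unfolding inner_t inner_s outer_s outer_t by (simp only: F_def)
qed

subsection \<open>The modular function\<close>

lemma translate_image_vimage: "(+) a ` U = (+) (- a) -` (U :: 'g::group_add set)"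
proof safe
  fix y assume "- a + y \<in> U"
  then have "a + (- a + y) \<in> (+) a ` U" by (rule imageI)
  then show "y \<in> (+) a ` U" by simp
qed simp

text \<open>Finitely many left translates of \<open>U\<close> cover a given compact set. A null
  \<open>U\<close> would make all compact sets null and, by inner regularity, the whole
  group.\<close>

lemma haar_open_pos:
  fixes U :: "'g::locally_compact_group set"
  assumes U: "open U" "U \<noteq> {}"
  shows "emeasure haar U \<noteq> 0"
proof
  assume U0: "emeasure haar U = 0"
  obtain x where x: "x \<in> U" using U(2) by blast
  have "emeasure haar K = 0" if K: "compact K" for K :: "'g set"
  proof -
    define V where "V k = (+) (- (k + - x)) -` U" for k
    have V: "open (V k)" for k unfolding V_def using U(1) by (intro open_vimage continuous_intros)
    have "k \<in> V k" for k using x by (simp add: V_def minus_add add.assoc)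
    then have "K \<subseteq> (\<Union>k\<in>K. V k)" by blast
    then obtain F where F: "F \<subseteq> K" "finite F" "K \<subseteq> (\<Union>k\<in>F. V k)"
      by (rule compactE_image[OF K V])
    have "V k = (+) (k + - x) ` U" for k
      unfolding V_def by (rule translate_image_vimage[symmetric])
    then have V0: "emeasure haar (V k) = 0" for k
      using haar_left_invariant[of U "k + - x"] U U0 by simp
    have "emeasure haar (\<Union>k\<in>F. V k) \<le> (\<Sum>k\<in>F. emeasure haar (V k))"
      using V F(2) by (intro emeasure_subadditive_finite) auto
    moreover have "emeasure haar K \<le> emeasure haar (\<Union>k\<in>F. V k)"
      using F(3) V by (intro emeasure_mono) (auto intro!: borel_open)
    ultimately show ?thesis by (simp add: V0)
  qed
  then have "emeasure haar (UNIV :: 'g set) = 0"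
    by (subst haar_inner_regular) (auto intro!: antisym SUP_least)
  then show False using haar_nonzero[where 'a='g] by simp
qed

lemma csupp_integral_pos:
  fixes f :: "'g::locally_compact_group \<Rightarrow> real"
  assumes f: "csupp f" "\<And>x. 0 \<le> f x" and x: "f x \<noteq> 0"
  shows "0 < (\<integral>t. f t \<partial>haar)"
proof -
  have int: "integrable haar f" by (rule csupp_integrable[OF f(1)])
  have "(\<integral>t. f t \<partial>haar) \<noteq> 0"
  proof
    assume "(\<integral>t. f t \<partial>haar) = 0"
    then have "AE t in haar. f t = 0"
      using integral_nonneg_eq_0_iff_AE[OF int] f(2) by simp
    then have "emeasure haar {t \<in> space haar. 0 < f t} = 0"
      by (intro emeasure_eq_0_AE) (auto elim: eventually_mono)
    moreover have "{t \<in> space haar. 0 < f t} = f -` {0<..}" by auto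
    moreover have "open (f -` {0<..})" using csupp_continuous[OF f(1)] by (simp add: open_vimage)
    moreover have "x \<in> f -` {0<..}" using f(2)[of x] x by simp
    ultimately show False using haar_open_pos[of "f -` {0<..}"] by auto
  qed
  moreover have "0 \<le> (\<integral>t. f t \<partial>haar)" using f(2) by simp
  ultimately show ?thesis by simp
qed

lemma csupp_test_zero:
  fixes F :: "'g::locally_compact_group \<Rightarrow> real"
  assumes F: "continuous_on UNIV F" and 0: "\<And>g. csupp g \<Longrightarrow> (\<integral>t. g t * F t \<partial>haar) = 0"
  shows "F x = 0"
proof (rule ccontr)
  assume x: "F x \<noteq> 0"
  obtain b :: "'g \<Rightarrow> real" where b: "csupp b" "\<And>x. 0 \<le> b x" "\<And>y. y \<in> {x} \<Longrightarrow> b y = 1"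
    by (rule csupp_Urysohn[of "{x}" UNIV]) auto
  \<comment> \<open>Testing against \<open>F\<close> times a bump at \<open>x\<close> produces the
    integral of \<open>b * F\<^sup>2\<close>, which is positive when \<open>F x\<close> is
    nonzero.\<close>
  have bF: "csupp (\<lambda>t. b t * F t)" by (rule csupp_mult(1)[OF b(1) F])
  have "0 < (\<integral>t. (b t * F t) * F t \<partial>haar)"
    by (rule csupp_integral_pos[where x = x])
       (use b x in \<open>auto simp: mult.assoc intro!: csupp_mult(1) bF F continuous_on_mult\<close>)
  then show False using 0[OF bF] by simp
qed

text \<open>Both sides equal the double integral of \<open>f s * g (- t + s)\<close>. Left
  invariance in \<open>t\<close> makes the inner integral of g independent of \<open>s\<close>; in
  the other order, substituting \<open>t + s\<close> for \<open>s\<close> moves the shift to f. This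
  separation of f from g is what determines the right translates of a Haar integral.\<close>

lemma integral_reflect_double:
  fixes f g :: "'g::locally_compact_group \<Rightarrow> real"
  assumes f: "csupp f" and g: "csupp g"
  shows "(\<integral>s. f s \<partial>haar) * (\<integral>t. g (- t) \<partial>haar) = (\<integral>s. g s * (\<integral>t. f (t + s) \<partial>haar) \<partial>haar)"
proof -
  obtain Kf where Kf: "compact Kf" "\<And>x. x \<notin> Kf \<Longrightarrow> f x = 0" using csuppE[OF f] by blast
  obtain Kg where Kg: "compact Kg" "\<And>x. x \<notin> Kg \<Longrightarrow> g x = 0" using csuppE[OF g] by blast
  \<comment> \<open>Wherever an integrand is nonzero, \<open>t\<close> lies in \<open>C\<close>; the
    cutoff \<phi> equals 1 there and only supplies the compact support in \<open>t\<close> that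
    \<open>kernel_Fubini\<close> asks for.\<close>
  define C where "C = (\<lambda>(x, y). x + - y) ` (Kf \<times> Kg)"
  have C: "compact C" unfolding C_def by (rule compact_set_minus[OF Kf(1) Kg(1)])
  obtain \<phi> :: "'g \<Rightarrow> real" where \<phi>: "csupp \<phi>" "\<And>x. x \<in> C \<Longrightarrow> \<phi> x = 1"
    by (rule csupp_Urysohn[OF C, of UNIV]) auto
  have inC: "t \<in> C" if "t + s \<in> Kf" "s \<in> Kg" for t s
  proof -
    have "(t + s) + - s \<in> C" unfolding C_def using that by force
    then show ?thesis by (simp add: add.assoc)
  qed
  have [measurable]: "f \<in> borel_measurable borel" "g \<in> borel_measurable borel"
    using f g by (simp_all add: csupp_measurable)
  have reflect: "(\<integral>t. g (- t) \<partial>haar) = (\<integral>t. g (- t + s) \<partial>haar)" for s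
    using integral_haar_translate[OF csupp_measurable[OF csupp_uminus[OF g]], of "- s"]
    by (simp only: minus_add minus_minus)
  have 1: "f s * g (- t + s) = \<phi> t * g (- t + s) * f s" for s t
  proof (cases "s \<in> Kf \<and> - t + s \<in> Kg")
    case True
    then have "t \<in> C" using inC[of t "- t + s"] by simp
    then show ?thesis by (simp add: \<phi>(2))
  qed (use Kf(2) Kg(2) in auto)
  have 2: "g s * f (t + s) = \<phi> t * f (t + s) * g s" for s t
    using inC[of t s] \<phi>(2)[of t] Kf(2)[of "t + s"] Kg(2)[of s] by (cases "t + s \<in> Kf \<and> s \<in> Kg") auto
  have "(\<integral>s. f s \<partial>haar) * (\<integral>t. g (- t) \<partial>haar) = (\<integral>s. f s * (\<integral>t. g (- t) \<partial>haar) \<partial>haar)" by simp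
  also have "\<dots> = (\<integral>s. (\<integral>t. \<phi> t * g (- t + s) * f s \<partial>haar) \<partial>haar)"
    unfolding 1[symmetric] by (rule Bochner_Integration.integral_cong) (simp_all add: reflect)
  also have "\<dots> = (\<integral>t. (\<integral>s. \<phi> t * g (- t + s) * f s \<partial>haar) \<partial>haar)"
    by (rule kernel_Fubini[symmetric, OF \<phi>(1) f g]) (intro continuous_intros)
  also have "\<dots> = (\<integral>t. (\<integral>s. \<phi> t * f (t + s) * g s \<partial>haar) \<partial>haar)"
  proof (rule Bochner_Integration.integral_cong[OF refl])
    fix t :: 'g
    have "(\<integral>s. \<phi> t * g (- t + s) * f s \<partial>haar) = (\<integral>s. \<phi> t * g (- t + (t + s)) * f (t + s) \<partial>haar)"
      by (rule integral_haar_translate[symmetric]) measurable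
    then show "(\<integral>s. \<phi> t * g (- t + s) * f s \<partial>haar) = (\<integral>s. \<phi> t * f (t + s) * g s \<partial>haar)"
      by (simp add: mult_ac)
  qed
  also have "\<dots> = (\<integral>s. (\<integral>t. \<phi> t * f (t + s) * g s \<partial>haar) \<partial>haar)"
    by (rule kernel_Fubini[OF \<phi>(1) g f, of "\<lambda>t. t"]) (intro continuous_intros)
  also have "\<dots> = (\<integral>s. g s * (\<integral>t. f (t + s) \<partial>haar) \<partial>haar)"
    unfolding 2[symmetric] by simp
  finally show ?thesis .
qed

text \<open>For \<open>s\<close> in a compact neighbourhood of \<open>s0\<close> all the functions
  \<open>f (t + s)\<close> vanish outside one compact set \<open>L\<close>, so uniform continuity of
  f bounds the change of the integral by a small multiple of the measure of
  \<open>L\<close>.\<close>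

lemma right_integral_continuous:
  fixes f :: "'g::locally_compact_group \<Rightarrow> real"
  assumes f: "csupp f"
  shows "continuous_on UNIV (\<lambda>s. \<integral>t. f (t + s) \<partial>haar)"
proof -
  have "((\<lambda>s. \<integral>t. f (t + s) \<partial>haar) \<longlongrightarrow> (\<integral>t. f (t + s0) \<partial>haar)) (at s0)" for s0
  proof (rule tendstoI)
    fix e :: real assume e: "0 < e"
    obtain K where K: "compact K" "\<And>x. x \<notin> K \<Longrightarrow> f x = 0" using csuppE[OF f] by blast
    obtain N C where N: "open N" "compact C" "s0 \<in> N" "N \<subseteq> C" by (rule compact_nhd)
    define L where "L = (\<lambda>(x, y). x + - y) ` (K \<times> C)"
    have L: "compact L" unfolding L_def by (rule compact_set_minus[OF K(1) N(2)])
    have L_fin: "emeasure haar L < \<infinity>" "L \<in> sets borel"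
      using haar_finite_compact[OF L] compact_borel[OF L] by auto
    define d where "d = e / (measure haar L + 1)"
    have d: "0 < d" using e by (simp add: d_def add_nonneg_pos)
    obtain U where U: "open U" "0 \<in> U" "\<And>u s. u \<in> U \<Longrightarrow> norm (f (s + u) - f s) < d"
      using csupp_uniformly_continuous_right[OF f d] by metis
    have "open (N \<inter> (+) (- s0) -` U)" using N(1) U(1) by (intro open_Int open_vimage continuous_intros)
    moreover have "s0 \<in> N \<inter> (+) (- s0) -` U" using N(3) U(2) by simp
    moreover have "dist (\<integral>t. f (t + s) \<partial>haar) (\<integral>t. f (t + s0) \<partial>haar) < e"
      if s: "s \<in> N \<inter> (+) (- s0) -` U" for s
    proof -
      have inL: "t \<in> L" if "t + r \<in> K" "r \<in> C" for t r
      proof -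
        have "(t + r) + - r \<in> L" unfolding L_def using that by force
        then show ?thesis by (simp add: add.assoc)
      qed
      have le: "\<bar>f (t + s) - f (t + s0)\<bar> \<le> d * indicat_real L t" for t
      proof (cases "t \<in> L")
        case True
        then show ?thesis
          using U(3)[of "- s0 + s" "t + s0"] s by (simp add: add.assoc less_imp_le)
      next
        case False
        then have "f (t + s) = 0" "f (t + s0) = 0" using inL[of t s] inL[of t s0] s N K(2) by auto
        then show ?thesis using d by simp
      qed
      have int: "integrable haar (\<lambda>t. f (t + r))" for r by (intro csupp_integrable csupp_translate_right f)
      have "\<bar>(\<integral>t. f (t + s) \<partial>haar) - (\<integral>t. f (t + s0) \<partial>haar)\<bar> = \<bar>\<integral>t. f (t + s) - f (t + s0) \<partial>haar\<bar>"
        by (simp add: int)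
      also have "\<dots> \<le> (\<integral>t. d * indicat_real L t \<partial>haar)"
        using L_fin le by (intro integral_abs_bound[THEN order_trans] integral_mono)
          (auto intro!: integrable_abs int integrable_mult_right integrable_real_indicator Bochner_Integration.integrable_diff)
      also have "\<dots> = d * measure haar L" using L_fin by simp
      also have "\<dots> < e"
        using e measure_nonneg[of haar L] 
        by (simp add: d_def pos_divide_less_eq add_nonneg_pos distrib_left)
      finally show ?thesis by (simp add: dist_real_def)
    qed
    ultimately show "\<forall>\<^sub>F s in at s0. dist (\<integral>t. f (t + s) \<partial>haar) (\<integral>t. f (t + s0) \<partial>haar) < e"
      unfolding eventually_at_topological by blast
  qed
  then show ?thesis by (simp add: continuous_on_def)
qed

text \<open>Integrated against any compactly supported g, the right translates of f and
  \<open>f0\<close> have proportional integrals by \<open>integral_reflect_double\<close>, with a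
  factor independent of \<open>s\<close>. Hence the ratio \<open>D\<close> obtained from
  \<open>f0\<close> works for all f. It is the inverse of the modular function.\<close>

lemma modular_functional_exists:
  obtains D :: "'g::locally_compact_group \<Rightarrow> real" where "continuous_on UNIV D" "\<And>s. 0 < D s" "\<And>s. D (- s) = 1 / D s"
    "\<And>f s. csupp f \<Longrightarrow> (\<integral>t. f (t + s) \<partial>haar) = D s * (\<integral>t. f t \<partial>haar)"
    "\<And>f. csupp f \<Longrightarrow> (\<integral>t. f (- t) \<partial>haar) = (\<integral>t. f t * D t \<partial>haar)"
proof -
  obtain f0 :: "'g \<Rightarrow> real" where f0: "csupp f0" "\<And>x. 0 \<le> f0 x" "\<And>y. y \<in> {0} \<Longrightarrow> f0 y = 1"
    by (rule csupp_Urysohn[of "{0}" UNIV]) auto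
  define I where "I f = (\<integral>t. f t \<partial>haar)" for f :: "'g \<Rightarrow> real"
  have I0: "0 < I f0" unfolding I_def by (rule csupp_integral_pos[OF f0(1,2), of 0]) (simp add: f0(3))
  define D where "D s = (\<integral>t. f0 (t + s) \<partial>haar) / I f0" for s
  have D: "continuous_on UNIV D"
    unfolding D_def using I0 by (intro continuous_intros right_integral_continuous f0) auto
  have right: "(\<integral>t. f (t + s) \<partial>haar) = D s * I f" if f: "csupp f" for f s
  proof -
    have "I f0 * (\<integral>t. f (t + s) \<partial>haar) - I f * (\<integral>t. f0 (t + s) \<partial>haar) = 0"
    proof (rule csupp_test_zero)
      show "continuous_on UNIV (\<lambda>s. I f0 * (\<integral>t. f (t + s) \<partial>haar) - I f * (\<integral>t. f0 (t + s) \<partial>haar))"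
        by (intro continuous_intros right_integral_continuous f f0)
      fix g :: "'g \<Rightarrow> real" assume g: "csupp g"
      have int: "integrable haar (\<lambda>s. g s * (\<integral>t. h (t + s) \<partial>haar))" if "csupp h" for h :: "'g \<Rightarrow> real"
        by (intro csupp_integrable csupp_mult(1) g right_integral_continuous that)
      have "(\<integral>s. g s * (I f0 * (\<integral>t. f (t + s) \<partial>haar) - I f * (\<integral>t. f0 (t + s) \<partial>haar)) \<partial>haar)
          = (\<integral>s. I f0 * (g s * (\<integral>t. f (t + s) \<partial>haar)) - I f * (g s * (\<integral>t. f0 (t + s) \<partial>haar)) \<partial>haar)"
        by (rule Bochner_Integration.integral_cong) (simp_all add: algebra_simps)
      also have "\<dots> = I f0 * (I f * (\<integral>t. g (- t) \<partial>haar)) - I f * (I f0 * (\<integral>t. g (- t) \<partial>haar))"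
        using int[OF f] int[OF f0(1)]
        by (simp add: integral_reflect_double[OF f g, symmetric] integral_reflect_double[OF f0(1) g, symmetric] I_def)
      finally show "(\<integral>s. g s * (I f0 * (\<integral>t. f (t + s) \<partial>haar) - I f * (\<integral>t. f0 (t + s) \<partial>haar)) \<partial>haar) = 0"
        by simp
    qed
    then show ?thesis using I0 by (simp add: D_def field_simps)
  qed
  have "D (- s) * D s = 1" for s
  proof -
    have "I f0 = (\<integral>t. f0 ((t + - s) + s) \<partial>haar)" by (simp add: I_def add.assoc)
    also have "\<dots> = D (- s) * (\<integral>t. f0 (t + s) \<partial>haar)"
      using right[OF csupp_translate_right[OF f0(1)], of "- s" s] by (simp add: I_def)
    also have "\<dots> = D (- s) * D s * I f0" by (simp add: right[OF f0(1)])
    finally show ?thesis using I0 by simp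
  qed
  moreover have "0 \<le> D s" for s
    unfolding D_def using I0 f0(2) by (intro divide_nonneg_nonneg integral_nonneg_AE) auto
  ultimately have pos: "0 < D s" and inv: "D (- s) = 1 / D s" for s
    by (metis less_le mult_zero_right zero_neq_one, metis eq_divide_eq mult_zero_right zero_neq_one)
  have "(\<integral>t. f (- t) \<partial>haar) = (\<integral>t. f t * D t \<partial>haar)" if "csupp f" for f
    using integral_reflect_double[OF f0(1) that] I0 by (simp add: D_def I_def field_simps)
  with D pos inv right show thesis by (intro that[of D]) (auto simp: I_def)
qed

subsection \<open>Radon measures\<close>

text \<open>Regularity in the form demanded of \<open>haar\<close>, stated for any measure so that
  images of \<open>haar\<close> under translation and inversion can be compared with it.\<close>

definition radon :: "'g::locally_compact_group measure \<Rightarrow> bool" where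
  "radon M \<longleftrightarrow> sets M = sets borel \<and>
     (\<forall>A\<in>sets borel. emeasure M A = (INF U\<in>{U. open U \<and> A \<subseteq> U}. emeasure M U)) \<and>
     (\<forall>U. open U \<longrightarrow> emeasure M U = (SUP K\<in>{K. compact K \<and> K \<subseteq> U}. emeasure M K))"

lemma radon_outer:
    "radon M \<Longrightarrow> A \<in> sets borel \<Longrightarrow> emeasure M A = (INF U\<in>{U. open U \<and> A \<subseteq> U}. emeasure M U)"
  and radon_inner:
    "radon M \<Longrightarrow> open U \<Longrightarrow> emeasure M U = (SUP K\<in>{K. compact K \<and> K \<subseteq> U}. emeasure M K)"
  unfolding radon_def by blast+

lemma radon_haar: "radon haar"
  unfolding radon_def
  by (intro conjI ballI allI impI haar_outer_regular haar_inner_regular) simp_all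

lemma radon_distr_homeomorphism:
  fixes p q :: "'g::locally_compact_group \<Rightarrow> 'g"
  assumes p: "continuous_on UNIV p" and q: "continuous_on UNIV q"
    and qp: "\<And>x. q (p x) = x" and pq: "\<And>x. p (q x) = x"
  shows "radon (distr haar borel p)"
proof -
  have pm: "p \<in> measurable haar borel" using p by (simp add: borel_measurable_continuous_onI)
  have em: "emeasure (distr haar borel p) A = emeasure haar (p -` A)" if "A \<in> sets borel" for A
    using that by (simp add: emeasure_distr[OF pm])
  have vp: "p -` A \<in> sets borel" if "A \<in> sets borel" for A
    using measurable_sets[OF pm that] by simp
  show ?thesis unfolding radon_def
  proof (intro conjI ballI allI impI)
    fix A :: "'g set" assume A: "A \<in> sets borel"
    show "emeasure (distr haar borel p) A = (INF U\<in>{U. open U \<and> A \<subseteq> U}. emeasure (distr haar borel p) U)"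
    proof (rule antisym)
      show "emeasure (distr haar borel p) A \<le> (INF U\<in>{U. open U \<and> A \<subseteq> U}. emeasure (distr haar borel p) U)"
        by (intro INF_greatest emeasure_mono) auto
      have "(INF U\<in>{U. open U \<and> A \<subseteq> U}. emeasure (distr haar borel p) U) \<le> emeasure haar U"
        if U: "open U" "p -` A \<subseteq> U" for U
      proof (rule INF_lower2)
        have "open (q -` U)" using U(1) q by (simp add: open_vimage)
        moreover have "A \<subseteq> q -` U" using U(2) pq by auto
        ultimately show "q -` U \<in> {U. open U \<and> A \<subseteq> U}" by simp
        show "emeasure (distr haar borel p) (q -` U) \<le> emeasure haar U"
          using \<open>open (q -` U)\<close> by (simp add: em vimage_def qp)
      qed
      then show "(INF U\<in>{U. open U \<and> A \<subseteq> U}. emeasure (distr haar borel p) U) \<le> emeasure (distr haar borel p) A"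
        unfolding em[OF A] by (subst haar_outer_regular[of "p -` A"]) (auto simp: vp A intro: INF_greatest)
    qed
  next
    fix U :: "'g set" assume U: "open U"
    have pU: "open (p -` U)" using U p by (simp add: open_vimage)
    show "emeasure (distr haar borel p) U = (SUP K\<in>{K. compact K \<and> K \<subseteq> U}. emeasure (distr haar borel p) K)"
    proof (rule antisym)
      have "emeasure haar K \<le> (SUP K\<in>{K. compact K \<and> K \<subseteq> U}. emeasure (distr haar borel p) K)"
        if K: "compact K" "K \<subseteq> p -` U" for K
      proof (rule SUP_upper2)
        have "compact (p ` K)" using K(1) p continuous_on_subset by (blast intro: compact_continuous_image)
        then show "p ` K \<in> {K. compact K \<and> K \<subseteq> U}" using K(2) by auto
        have "p -` p ` K = K" by (rule inj_vimage_image_eq) (metis injI qp)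
        then show "emeasure haar K \<le> emeasure (distr haar borel p) (p ` K)"
          using \<open>compact (p ` K)\<close> by (simp add: em compact_borel)
      qed
      then show "emeasure (distr haar borel p) U \<le> (SUP K\<in>{K. compact K \<and> K \<subseteq> U}. emeasure (distr haar borel p) K)"
        using U by (simp add: em) (subst haar_inner_regular[OF pU], auto intro: SUP_least)
      show "(SUP K\<in>{K. compact K \<and> K \<subseteq> U}. emeasure (distr haar borel p) K) \<le> emeasure (distr haar borel p) U"
        using U by (intro SUP_least emeasure_mono) auto
    qed
  qed simp
qed

text \<open>Urysohn functions between a compact set and an open one carry the bound on integrals to
  open sets, by inner regularity of \<open>M\<close>; outer regularity of \<open>N\<close> carries
  it on to Borel sets. The open set \<open>W\<close> localizes the comparison, since a density is
  comparable to a constant only locally.\<close>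

lemma radon_le:
  fixes M N :: "'g::locally_compact_group measure"
  assumes M: "radon M" and N: "radon N" and c: "0 < c" and W: "open W"
    and le: "\<And>f. csupp f \<Longrightarrow> (\<And>x. 0 \<le> f x) \<Longrightarrow> (\<And>x. x \<notin> W \<Longrightarrow> f x = 0) \<Longrightarrow>
      (\<integral>\<^sup>+x. ennreal (f x) \<partial>M) \<le> ennreal c * (\<integral>\<^sup>+x. ennreal (f x) \<partial>N)"
    and A: "A \<in> sets borel" "A \<subseteq> W"
  shows "emeasure M A \<le> ennreal c * emeasure N A"
proof -
  have sets_MN [measurable_cong, simp]: "sets M = sets borel" "sets N = sets borel"
    using M N by (auto simp: radon_def)
  have U_le: "emeasure M U \<le> ennreal c * emeasure N U" if U: "open U" "U \<subseteq> W" for U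
  proof -
    have "emeasure M K \<le> ennreal c * emeasure N U" if K: "compact K" "K \<subseteq> U" for K
    proof -
      obtain f :: "'g \<Rightarrow> real" where f: "csupp f" "\<And>x. 0 \<le> f x" "\<And>x. f x \<le> 1"
        "\<And>x. x \<in> K \<Longrightarrow> f x = 1" "\<And>x. x \<notin> U \<Longrightarrow> f x = 0"
        by (rule csupp_Urysohn[OF K(1) U(1) K(2)], rule that, assumption) auto
      have "emeasure M K = (\<integral>\<^sup>+x. indicator K x \<partial>M)" using K(1) by (simp add: compact_borel)
      also have "\<dots> \<le> (\<integral>\<^sup>+x. ennreal (f x) \<partial>M)"
        by (intro nn_integral_mono) (auto simp: indicator_def f)
      also have "\<dots> \<le> ennreal c * (\<integral>\<^sup>+x. ennreal (f x) \<partial>N)"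
        using U(2) f(5) by (intro le[OF f(1,2)]) blast
      also have "(\<integral>\<^sup>+x. ennreal (f x) \<partial>N) \<le> (\<integral>\<^sup>+x. indicator U x \<partial>N)"
        using f(3,5) by (intro nn_integral_mono) (auto simp: indicator_def ennreal_le_1)
      also have "\<dots> = emeasure N U" using U(1) by simp
      finally show ?thesis by (simp add: mult_left_mono)
    qed
    then show ?thesis by (subst radon_inner[OF M U(1)]) (auto intro: SUP_least)
  qed
  have cancel: "ennreal (1 / c) * (ennreal c * x) = x" "ennreal c * (ennreal (1 / c) * x) = x" for x
    using c by (simp_all add: mult.assoc[symmetric] ennreal_mult[symmetric])
  \<comment> \<open>Dividing by \<open>c\<close> brings the estimate into the form of a lower bound
    for the infimum that gives the \<open>N\<close>-measure of \<open>A\<close>.\<close>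
  have "ennreal (1 / c) * emeasure M A \<le> emeasure N U" if U: "open U" "A \<subseteq> U" for U
  proof -
    have "emeasure M A \<le> emeasure M (U \<inter> W)" using U A W by (intro emeasure_mono) auto
    also have "\<dots> \<le> ennreal c * emeasure N (U \<inter> W)" using U W by (intro U_le) auto
    also have "\<dots> \<le> ennreal c * emeasure N U"
      using U W by (intro mult_left_mono emeasure_mono) auto
    finally have "ennreal (1 / c) * emeasure M A \<le> ennreal (1 / c) * (ennreal c * emeasure N U)"
      by (rule mult_left_mono) simp
    then show ?thesis by (simp only: cancel)
  qed
  then have "ennreal (1 / c) * emeasure M A \<le> emeasure N A"
    unfolding radon_outer[OF N A(1)] by (intro INF_greatest) auto
  then have "ennreal c * (ennreal (1 / c) * emeasure M A) \<le> ennreal c * emeasure N A"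
    by (rule mult_left_mono) simp
  then show ?thesis by (simp only: cancel)
qed

lemma nn_integral_csupp:
  fixes f :: "'g::locally_compact_group \<Rightarrow> real"
  assumes "csupp f" "\<And>x. 0 \<le> f x"
  shows "(\<integral>\<^sup>+x. ennreal (f x) \<partial>haar) = ennreal (\<integral>x. f x \<partial>haar)"
  using assms by (intro nn_integral_eq_integral csupp_integrable) auto

lemma ennreal_le_of_factors:
  fixes x y :: ennreal
  assumes "\<And>q. 1 < q \<Longrightarrow> x \<le> ennreal q * y"
  shows "x \<le> y"
proof (rule ennreal_le_epsilon)
  fix e :: real assume y: "y < top" and e: "0 < e"
  obtain r where r: "y = ennreal r" "0 \<le> r" using y by (cases y) auto
  have "x \<le> ennreal (1 + e / (r + 1)) * y" using e r by (intro assms) (simp add: add_nonneg_pos)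
  also have "\<dots> = ennreal (r + e * r / (r + 1))"
    using r e by (simp add: ennreal_mult[symmetric] distrib_right)
  also have "\<dots> \<le> ennreal (r + e)"
    using r e by (intro ennreal_leI add_left_mono) (simp add: pos_divide_le_eq)
  finally show "x \<le> y + ennreal e" using r e by (simp add: ennreal_plus)
qed

text \<open>On the sets where \<open>q\<^sup>n \<le> D < q\<^bsup>n+1\<^esup>\<close> both sides are comparable to multiples of \<open>haar\<close>
  up to powers of \<open>q\<close>; then \<open>q \<rightarrow> 1\<close>.\<close>

lemma radon_density:
  fixes M :: "'g::locally_compact_group measure"
  assumes M: "radon M" and D: "continuous_on UNIV D" "\<And>x. 0 < D x"
    and eq: "\<And>f. csupp f \<Longrightarrow> (\<And>x. 0 \<le> f x) \<Longrightarrow>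
      (\<integral>\<^sup>+x. ennreal (f x) \<partial>M) = (\<integral>\<^sup>+x. ennreal (f x * D x) \<partial>haar)"
  shows "M = density haar (\<lambda>x. ennreal (D x))"
proof (rule measure_eqI)
  show sets_eq: "sets M = sets (density haar (\<lambda>x. ennreal (D x)))" using M by (simp add: radon_def)
  have sets_M [measurable_cong, simp]: "sets M = sets borel" using M by (simp add: radon_def)
  define N where "N = density haar (\<lambda>x. ennreal (D x))"
  have sets_N [simp]: "sets N = sets borel" by (simp add: N_def)
  have Dm [measurable]: "D \<in> borel_measurable borel" by (rule borel_measurable_continuous_onI[OF D(1)])
  fix A assume "A \<in> sets M"
  then have A: "A \<in> sets borel" by simp
  have both: "emeasure M A \<le> ennreal q * emeasure N A \<and> emeasure N A \<le> ennreal (q * q) * emeasure M A"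
    if q: "1 < q" for q
  proof -
    define B where "B n = {x. \<lfloor>log q (D x)\<rfloor> = n}" for n :: int
    have B: "x \<in> B n \<longleftrightarrow> q powr n \<le> D x \<and> D x < q powr (n + 1)" for x n
      using floor_log_eq_powr_iff[OF D(2) q] by (simp add: B_def)
    have Bm [measurable]: "B n \<in> sets borel" for n
    proof -
      have "B n = D -` {q powr n ..< q powr (n + 1)}" using B by auto
      then show ?thesis using measurable_sets[OF Dm, of "{q powr n ..< q powr (n + 1)}"] by simp
    qed
    \<comment> \<open>\<open>radon_le\<close> works inside open sets, so \<open>B n\<close> is
      enlarged downwards by one power of \<open>q\<close>; this costs the extra factor in
      \<open>q * q\<close>.\<close>
    define W where "W n = D -` {q powr (n - 1) <..< q powr (n + 1)}" for n :: int
    have W: "open (W n)" for n unfolding W_def using D(1) by (simp add: open_vimage)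
    have BW: "B n \<subseteq> W n" for n
    proof
      fix x assume "x \<in> B n"
      moreover have "q powr (n - 1) < q powr n" using q by simp
      ultimately show "x \<in> W n" by (simp add: B W_def)
    qed
    have D_bounds: "q powr (n - 1) \<le> D x" "D x \<le> q powr (n + 1)" if "x \<in> W n" for x n
      using that by (auto simp: W_def)
    have pw: "q powr (n + 1) = q * q powr n" "q powr (1 - n) * q powr (n + 1) = q * q" for n :: int
      using q by (simp_all add: powr_add powr_diff)
    have piece: "emeasure M C \<le> ennreal q * emeasure N C \<and> emeasure N C \<le> ennreal (q * q) * emeasure M C"
      if C: "C \<in> sets borel" "C \<subseteq> B n" for C n
    proof -
      have M_le: "emeasure M C \<le> ennreal (q powr (n + 1)) * emeasure haar C"
      proof (rule radon_le[OF M radon_haar _ W[of n] _ C(1)])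
        fix f :: "'g \<Rightarrow> real" assume f: "csupp f" "\<And>x. 0 \<le> f x" "\<And>x. x \<notin> W n \<Longrightarrow> f x = 0"
        have [measurable]: "f \<in> borel_measurable borel" by (rule csupp_measurable[OF f(1)])
        have "(\<integral>\<^sup>+x. ennreal (f x) \<partial>M) = (\<integral>\<^sup>+x. ennreal (f x * D x) \<partial>haar)" by (rule eq[OF f(1,2)])
        also have "\<dots> \<le> (\<integral>\<^sup>+x. ennreal (q powr (n + 1)) * ennreal (f x) \<partial>haar)"
        proof (intro nn_integral_mono)
          fix x show "ennreal (f x * D x) \<le> ennreal (q powr (n + 1)) * ennreal (f x)"
          proof (cases "x \<in> W n")
            case True
            have "f x * D x \<le> q powr (n + 1) * f x"
              using mult_left_mono[OF D_bounds(2)[OF True] f(2)[of x]] by (simp add: mult.commute)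
            then show ?thesis using f(2)[of x] by (simp add: ennreal_mult[symmetric] ennreal_leI)
          qed (simp add: f(3))
        qed
        also have "\<dots> = ennreal (q powr (n + 1)) * (\<integral>\<^sup>+x. ennreal (f x) \<partial>haar)"
          by (rule nn_integral_cmult) simp
        finally show "(\<integral>\<^sup>+x. ennreal (f x) \<partial>M) \<le> ennreal (q powr (n + 1)) * (\<integral>\<^sup>+x. ennreal (f x) \<partial>haar)" .
      qed (use C BW q in auto)
      have haar_le: "emeasure haar C \<le> ennreal (q powr (1 - n)) * emeasure M C"
      proof (rule radon_le[OF radon_haar M _ W[of n] _ C(1)])
        fix f :: "'g \<Rightarrow> real" assume f: "csupp f" "\<And>x. 0 \<le> f x" "\<And>x. x \<notin> W n \<Longrightarrow> f x = 0"
        have [measurable]: "f \<in> borel_measurable borel" by (rule csupp_measurable[OF f(1)])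
        have "(\<integral>\<^sup>+x. ennreal (f x) \<partial>haar) \<le> (\<integral>\<^sup>+x. ennreal (q powr (1 - n)) * ennreal (f x * D x) \<partial>haar)"
        proof (intro nn_integral_mono)
          fix x
          show "ennreal (f x) \<le> ennreal (q powr (1 - n)) * ennreal (f x * D x)"
          proof (cases "x \<in> W n")
            case True
            have "1 = q powr (1 - n) * q powr (n - 1)" using q by (simp add: powr_add[symmetric])
            also have "\<dots> \<le> q powr (1 - n) * D x" using D_bounds(1)[OF True] by (intro mult_left_mono) auto
            finally have "f x * 1 \<le> f x * (q powr (1 - n) * D x)" using f(2)[of x] by (rule mult_left_mono)
            then show ?thesis using f(2)[of x] less_imp_le[OF D(2)[of x]]
              by (simp add: ennreal_mult[symmetric] mult_ac)
          qed (simp add: f(3))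
        qed
        also have "\<dots> = ennreal (q powr (1 - n)) * (\<integral>\<^sup>+x. ennreal (f x) \<partial>M)"
          unfolding eq[OF f(1,2)] by (rule nn_integral_cmult) simp
        finally show "(\<integral>\<^sup>+x. ennreal (f x) \<partial>haar) \<le> ennreal (q powr (1 - n)) * (\<integral>\<^sup>+x. ennreal (f x) \<partial>M)" .
      qed (use C BW q in auto)
      have N_C: "emeasure N C = (\<integral>\<^sup>+x. ennreal (D x) * indicator C x \<partial>haar)"
        unfolding N_def using C(1) by (intro emeasure_density) auto
      have "ennreal (q powr n) * emeasure haar C = (\<integral>\<^sup>+x. ennreal (q powr n) * indicator C x \<partial>haar)"
        using C(1) by (simp add: nn_integral_cmult)
      also have "\<dots> \<le> emeasure N C"
        unfolding N_C using C(2) B by (intro nn_integral_mono) (auto simp: indicator_def intro!: ennreal_leI)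
      finally have N_ge: "ennreal (q powr n) * emeasure haar C \<le> emeasure N C" .
      have "emeasure N C \<le> (\<integral>\<^sup>+x. ennreal (q powr (n + 1)) * indicator C x \<partial>haar)"
        unfolding N_C using C(2) B by (intro nn_integral_mono) (auto simp: indicator_def intro!: ennreal_leI)
      also have "\<dots> = ennreal (q powr (n + 1)) * emeasure haar C"
        using C(1) by (simp add: nn_integral_cmult)
      finally have N_le: "emeasure N C \<le> ennreal (q powr (n + 1)) * emeasure haar C" .
      have "emeasure M C \<le> ennreal q * (ennreal (q powr n) * emeasure haar C)"
        using M_le q unfolding pw(1) by (simp add: ennreal_mult mult.assoc)
      also have "\<dots> \<le> ennreal q * emeasure N C" using N_ge by (rule mult_left_mono) simp
      finally have 1: "emeasure M C \<le> ennreal q * emeasure N C" .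
      have "emeasure N C \<le> ennreal (q powr (n + 1)) * (ennreal (q powr (1 - n)) * emeasure M C)"
        by (rule order_trans[OF N_le]) (rule mult_left_mono[OF haar_le], simp)
      also have "\<dots> = ennreal (q powr (1 - n) * q powr (n + 1)) * emeasure M C"
        by (subst ennreal_mult) (simp_all add: mult_ac)
      finally have "emeasure N C \<le> ennreal (q * q) * emeasure M C" unfolding pw(2) .
      with 1 show ?thesis by simp
    qed
    have split: "emeasure L A = (\<integral>\<^sup>+n. emeasure L (A \<inter> B n) \<partial>count_space UNIV)" if L: "sets L = sets borel" for L
    proof -
      have "A = (\<Union>n. A \<inter> B n)" by (auto simp: B_def)
      then have "emeasure L A = emeasure L (\<Union>n. A \<inter> B n)" by simp
      also have "\<dots> = (\<integral>\<^sup>+n. emeasure L (A \<inter> B n) \<partial>count_space UNIV)"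
        using A by (intro emeasure_UN_countable) (auto simp: L disjoint_family_on_def B_def)
      finally show ?thesis .
    qed
    have pieces: "emeasure M (A \<inter> B n) \<le> ennreal q * emeasure N (A \<inter> B n)"
      "emeasure N (A \<inter> B n) \<le> ennreal (q * q) * emeasure M (A \<inter> B n)" for n
      using piece[of "A \<inter> B n" n] A by simp_all
    have "emeasure M A \<le> (\<integral>\<^sup>+n. ennreal q * emeasure N (A \<inter> B n) \<partial>count_space UNIV)"
      unfolding split[OF sets_M] by (intro nn_integral_mono pieces)
    moreover have "emeasure N A \<le> (\<integral>\<^sup>+n. ennreal (q * q) * emeasure M (A \<inter> B n) \<partial>count_space UNIV)"
      unfolding split[OF sets_N] by (intro nn_integral_mono pieces)
    ultimately show ?thesis
      by (simp add: nn_integral_cmult split[OF sets_M] split[OF sets_N])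
  qed
  show "emeasure M A = emeasure (density haar (\<lambda>x. ennreal (D x))) A"
    unfolding N_def[symmetric]
  proof (rule antisym)
    show "emeasure M A \<le> emeasure N A" by (rule ennreal_le_of_factors) (rule conjunct1[OF both])
    show "emeasure N A \<le> emeasure M A"
    proof (rule ennreal_le_of_factors)
      fix q :: real assume q: "1 < q"
      then have "1 < sqrt q" "sqrt q * sqrt q = q" by simp_all
      then show "emeasure N A \<le> ennreal q * emeasure M A" using both[of "sqrt q"] by simp
    qed
  qed
qed

section \<open>The modular function as a density\<close>

lemma modular_eqI:
  fixes c :: real and t :: "'g::locally_compact_group"
  assumes c: "0 < c" and eq: "\<And>A::'g set. A \<in> sets borel \<Longrightarrow>
    emeasure haar ((\<lambda>s. s + t) ` A) = ennreal c * emeasure haar A"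
  shows "modular t = c"
  unfolding modular_def
proof (rule the_equality)
  show "0 < c \<and> (\<forall>A\<in>sets (borel :: 'g measure). emeasure haar ((\<lambda>s. s + t) ` A) = ennreal c * emeasure haar A)"
    using c eq by blast
next
  fix d assume d: "0 < d \<and> (\<forall>A\<in>sets (borel :: 'g measure). emeasure haar ((\<lambda>s. s + t) ` A) = ennreal d * emeasure haar A)"
  \<comment> \<open>A nonempty open set inside a compact one has measure neither zero nor infinite,
    so it can be cancelled and the scaling factor is determined.\<close>
  obtain U K :: "'g set" where UK: "open U" "compact K" "0 \<in> U" "U \<subseteq> K" by (rule compact_nhd)
  have U0: "emeasure haar U \<noteq> 0" using haar_open_pos UK(1,3) by blast
  have "emeasure haar U \<le> emeasure haar K" using UK by (intro emeasure_mono) (auto simp: compact_borel)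
  then have Ufin: "emeasure haar U \<noteq> top" using haar_finite_compact[OF UK(2)] by (auto simp: top_unique)
  have "ennreal d * emeasure haar U = ennreal c * emeasure haar U"
    using d eq[of U] UK(1) by auto
  then have "ennreal d = ennreal c" using U0 Ufin by (metis mult_divide_eq_ennreal)
  then show "d = c" using d c by simp
qed

text \<open>The functional identities for \<open>D\<close> become identities of measures:
  \<open>radon_le\<close> in both directions handles right translation, and
  \<open>radon_density\<close> handles inversion. The description defining \<open>modular\<close> is
  thereby resolved to a continuous positive function.\<close>

lemma modular_properties:
  shows continuous_inverse_modular: "continuous_on UNIV (\<lambda>s::'g::locally_compact_group. inverse (modular s))"
    and inverse_modular_pos: "0 < inverse (modular (s::'g))"
    and distr_haar_uminus: "distr haar borel uminus = density haar (\<lambda>s::'g. ennreal (inverse (modular s)))"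
proof -
  obtain D :: "'g \<Rightarrow> real" where D: "continuous_on UNIV D" "\<And>s. 0 < D s" "\<And>s. D (- s) = 1 / D s"
    "\<And>f s. csupp f \<Longrightarrow> (\<integral>t. f (t + s) \<partial>haar) = D s * (\<integral>t. f t \<partial>haar)"
    "\<And>f. csupp f \<Longrightarrow> (\<integral>t. f (- t) \<partial>haar) = (\<integral>t. f t * D t \<partial>haar)"
    by (rule modular_functional_exists, rule that, assumption) auto
  \<comment> \<open>The sign arises because the image under right translation by \<open>- s\<close>
    is the preimage under right translation by \<open>s\<close>.\<close>
  have "modular (- s) = D s" for s :: 'g
  proof (rule modular_eqI[OF D(2)])
    fix A :: "'g set" assume A: "A \<in> sets borel"
    define M where "M = distr haar borel (\<lambda>t. t + s)"
    have m: "(\<lambda>t. t + s) \<in> borel_measurable borel"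
      by (intro borel_measurable_continuous_onI continuous_intros)
    have M: "radon M" unfolding M_def
      by (rule radon_distr_homeomorphism[where q = "\<lambda>t. t + - s"])
         (auto simp: add.assoc simp del: add_uminus_conv_diff intro!: continuous_intros)
    have I: "(\<integral>\<^sup>+x. ennreal (f x) \<partial>M) = ennreal (D s) * (\<integral>\<^sup>+x. ennreal (f x) \<partial>haar)"
      if f: "csupp f" "\<And>x. 0 \<le> f x" for f
    proof -
      have "(\<integral>\<^sup>+x. ennreal (f x) \<partial>M) = (\<integral>\<^sup>+x. ennreal (f (x + s)) \<partial>haar)"
        unfolding M_def by (rule nn_integral_distr) (use m csupp_measurable[OF f(1)] in auto)
      also have "\<dots> = ennreal (\<integral>x. f (x + s) \<partial>haar)"
        by (rule nn_integral_csupp) (use f csupp_translate_right in auto)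
      also have "\<dots> = ennreal (D s) * (\<integral>\<^sup>+x. ennreal (f x) \<partial>haar)"
        using f D(2)[of s] by (simp add: D(4) nn_integral_csupp ennreal_mult)
      finally show ?thesis .
    qed
    have "emeasure M A \<le> ennreal (D s) * emeasure haar A"
      by (rule radon_le[OF M radon_haar D(2) open_UNIV _ A]) (simp_all add: I)
    moreover have "emeasure haar A \<le> ennreal (1 / D s) * emeasure M A"
      by (rule radon_le[OF radon_haar M _ open_UNIV _ A])
         (use D(2)[of s] in \<open>simp_all add: I mult.assoc[symmetric] ennreal_mult[symmetric]\<close>)
    then have "ennreal (D s) * emeasure haar A \<le> ennreal (D s) * (ennreal (1 / D s) * emeasure M A)"
      by (rule mult_left_mono) simp
    then have "ennreal (D s) * emeasure haar A \<le> emeasure M A"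
      using D(2)[of s] by (simp add: mult.assoc[symmetric] ennreal_mult[symmetric])
    moreover have "emeasure M A = emeasure haar ((\<lambda>t. t + s) -` A)"
      unfolding M_def using A m by (simp add: emeasure_distr)
    moreover have "(\<lambda>t. t + s) -` A = (\<lambda>t. t + - s) ` A"
    proof safe
      fix x assume "x + s \<in> A"
      then have "(x + s) + - s \<in> (\<lambda>t. t + - s) ` A" by (rule imageI)
      then show "x \<in> (\<lambda>t. t + - s) ` A" by (simp add: add.assoc)
    qed (simp add: add.assoc)
    ultimately show "emeasure haar ((\<lambda>t. t + - s) ` A) = ennreal (D s) * emeasure haar A"
      by (simp add: antisym)
  qed
  then have inv: "inverse (modular s) = D s" for s :: 'g
    using D(3)[of s] \<open>\<And>s. modular (- s) = D s\<close>[of "- s"] by (simp add: field_simps)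
  show "continuous_on UNIV (\<lambda>s::'g. inverse (modular s))" by (simp add: inv D(1))
  show "0 < inverse (modular (s::'g))" by (simp add: inv D(2))
  show "distr haar borel uminus = density haar (\<lambda>s::'g. ennreal (inverse (modular s)))"
    unfolding inv
  proof (rule radon_density[OF _ D(1,2)])
    show "radon (distr haar borel uminus :: 'g measure)"
      by (rule radon_distr_homeomorphism[where q = uminus]) (auto intro!: continuous_intros)
    fix f :: "'g \<Rightarrow> real" assume f: "csupp f" "\<And>x. 0 \<le> f x"
    have "(\<integral>\<^sup>+x. ennreal (f x) \<partial>distr haar borel uminus) = (\<integral>\<^sup>+x. ennreal (f (- x)) \<partial>haar)"
      by (rule nn_integral_distr)
         (use csupp_measurable[OF f(1)] in \<open>auto intro!: borel_measurable_continuous_onI continuous_intros\<close>)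
    also have "\<dots> = ennreal (\<integral>x. f (- x) \<partial>haar)"
      by (rule nn_integral_csupp) (use f csupp_uminus in auto)
    also have "\<dots> = (\<integral>\<^sup>+x. ennreal (f x * D x) \<partial>haar)"
      unfolding D(5)[OF f(1)] using f D(1) less_imp_le[OF D(2)]
      by (intro nn_integral_csupp[symmetric] csupp_mult(1)) auto
    finally show "(\<integral>\<^sup>+x. ennreal (f x) \<partial>distr haar borel uminus) = (\<integral>\<^sup>+x. ennreal (f x * D x) \<partial>haar)" .
  qed
qed

lemma nn_integral_haar_uminus:
  fixes f :: "'g::locally_compact_group \<Rightarrow> ennreal"
  assumes [measurable]: "f \<in> borel_measurable borel"
  shows "(\<integral>\<^sup>+s. f (- s) \<partial>haar) = (\<integral>\<^sup>+s. ennreal (inverse (modular s)) * f s \<partial>haar)"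
proof -
  have [measurable]: "(\<lambda>s::'g. inverse (modular s)) \<in> borel_measurable borel"
    by (intro borel_measurable_continuous_onI continuous_inverse_modular)
  have "(\<integral>\<^sup>+s. f (- s) \<partial>haar) = (\<integral>\<^sup>+s. f s \<partial>distr haar borel uminus)"
    by (rule nn_integral_distr[symmetric]) (auto intro!: borel_measurable_continuous_onI continuous_intros)
  also have "\<dots> = (\<integral>\<^sup>+s. ennreal (inverse (modular s)) * f s \<partial>haar)"
    unfolding distr_haar_uminus by (rule nn_integral_density) auto
  finally show ?thesis .
qed

text \<open>Inversion carries Haar measure to a measure with a density with respect to it, so null
  sets stay null.\<close>

lemma AE_haar_uminus:
  assumes "AE s in (haar :: 'g::locally_compact_group measure). P s"
  shows "AE s in haar. P (- s)"
proof -
  have "AE s in density haar (\<lambda>s::'g. ennreal (inverse (modular s))). P s"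
    using assms by (subst AE_density)
      (auto intro!: borel_measurable_continuous_onI continuous_inverse_modular measurable_compose[OF _ measurable_ennreal] elim: eventually_mono)
  then have "AE s in distr haar borel uminus. P s" by (simp only: distr_haar_uminus)
  then show ?thesis
    by (rule AE_distrD[rotated]) (auto intro!: borel_measurable_continuous_onI continuous_intros)
qed

section \<open>The Hilbert space of square-integrable functions\<close>

lemma cinner_abs_l2:
  assumes "square_integrable f" "square_integrable g"
  shows "cinner (abs_l2 f) (abs_l2 g) = (\<integral>s. f s * cnj (g s) \<partial>haar)"
  using assms by (simp add: cinner_l2.abs_eq l2_rel_refl)

lemma abs_l2_cong:
  assumes "square_integrable f" "square_integrable g" "AE s in haar. f s = g s"
  shows "abs_l2 f = abs_l2 g"
  using Quotient3_rel_abs[OF Quotient3_l2] assms by (metis l2_rel_def)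

lemma abs_l2_eqD:
  assumes "square_integrable f" "square_integrable g" "abs_l2 f = abs_l2 g"
  shows "AE s in haar. f s = g s"
  using Quotient3_rel[OF Quotient3_l2, of f g] assms by (simp add: l2_rel_refl l2_rel_def)

lemma scaleC_abs_l2: "square_integrable f \<Longrightarrow> a *\<^sub>C abs_l2 f = abs_l2 (\<lambda>s. a * f s)"
  by (simp add: scaleC_l2.abs_eq l2_rel_refl)

lemma add_abs_l2:
  "square_integrable f \<Longrightarrow> square_integrable g \<Longrightarrow> abs_l2 f + abs_l2 g = abs_l2 (\<lambda>s. f s + g s)"
  by (simp add: plus_l2.abs_eq l2_rel_refl)

lemma square_integrable_measurable: "square_integrable f \<Longrightarrow> f \<in> borel_measurable borel"
  by (simp add: square_integrable_def)

lemma square_integrable_iff_nn: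
  "square_integrable f \<longleftrightarrow> f \<in> borel_measurable borel \<and> (\<integral>\<^sup>+s. ennreal ((cmod (f s))\<^sup>2) \<partial>haar) < \<infinity>"
  unfolding square_integrable_def by (auto simp: integrable_iff_bounded)

lemma square_integrable_AE_cong:
  assumes "square_integrable f" "g \<in> borel_measurable borel" "AE s in haar. g s = f s"
  shows "square_integrable g"
proof -
  have "(\<integral>\<^sup>+s. ennreal ((cmod (g s))\<^sup>2) \<partial>haar) = (\<integral>\<^sup>+s. ennreal ((cmod (f s))\<^sup>2) \<partial>haar)"
    using assms(3) by (intro nn_integral_cong_AE) (auto elim: eventually_mono)
  then show ?thesis using assms(1,2) by (simp add: square_integrable_iff_nn)
qed

section \<open>The involution on measurable functions\<close>

lemma measurable_uminus: "uminus \<in> measurable borel (borel :: 'g::locally_compact_group measure)"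
  by (intro borel_measurable_continuous_onI continuous_intros)

lemma flat_measurable:
  assumes "f \<in> borel_measurable borel" shows "flat f \<in> borel_measurable borel"
proof -
  have "(\<lambda>s. f (- s)) \<in> borel_measurable borel"
    using assms measurable_uminus by (rule measurable_compose[rotated])
  then have "(\<lambda>s. cnj (f (- s))) \<in> borel_measurable borel"
    by (rule borel_measurable_continuous_on[rotated]) (intro continuous_intros)
  then show ?thesis by (simp add: flat_def[abs_def])
qed

lemma flat_flat [simp]: "flat (flat f) = f"
  by (simp add: flat_def fun_eq_iff)

lemma modular_nonneg: "0 \<le> modular s"
  using inverse_modular_pos[of s] by simp

lemma nn_integral_flat:
  assumes "f \<in> borel_measurable borel"
  shows "(\<integral>\<^sup>+s. ennreal ((cmod (flat f s))\<^sup>2) \<partial>haar)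
    = (\<integral>\<^sup>+s. ennreal (inverse (modular s) * (cmod (f s))\<^sup>2) \<partial>haar)"
proof -
  have "(\<integral>\<^sup>+s. ennreal ((cmod (flat f s))\<^sup>2) \<partial>haar)
      = (\<integral>\<^sup>+s. ennreal (inverse (modular s)) * ennreal ((cmod (f s))\<^sup>2) \<partial>haar)"
    unfolding flat_def complex_mod_cnj
    by (rule nn_integral_haar_uminus[where f = "\<lambda>s. ennreal ((cmod (f s))\<^sup>2)"]) (use assms in measurable)
  then show ?thesis
    by (simp add: ennreal_mult modular_nonneg)
qed

text \<open>The weight in \<open>flat_domain\<close> is the density of the inverted Haar measure, so
  the weighted integral is the squared norm of the reflected function.\<close>

lemma flat_domain_iff: "x \<in> flat_domain \<longleftrightarrow> square_integrable (flat (rep_l2 x))"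
proof -
  have "rep_l2 x \<in> borel_measurable borel"
    by (rule square_integrable_measurable[OF square_integrable_rep])
  then show ?thesis
    by (simp add: flat_domain_def square_integrable_iff_nn nn_integral_flat flat_measurable)
qed

lemma AE_flat_cong:
  assumes "AE s in haar. f s = g s"
  shows "AE s in haar. flat f s = flat g s"
  using AE_haar_uminus[OF assms] by (auto simp: flat_def elim: eventually_mono)

lemma square_integrable_flat_cong:
  assumes "square_integrable f" "square_integrable g" "AE s in haar. f s = g s" "square_integrable (flat f)"
  shows "square_integrable (flat g)"
  using assms(4) flat_measurable[OF square_integrable_measurable[OF assms(2)]]
  by (rule square_integrable_AE_cong) (use AE_flat_cong[OF assms(3)] in \<open>auto elim: eventually_mono\<close>)

subsection \<open>The left regular representation\<close>

lemma left_regular_abs_l2: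
  "square_integrable f \<Longrightarrow> left_regular s (abs_l2 f) = abs_l2 (\<lambda>t. f (- s + t))"
  by (simp add: left_regular.abs_eq l2_rel_refl)

lemma l2_cases:
  obtains f where "square_integrable f" "x = abs_l2 f"
  using square_integrable_rep[of x] abs_rep_l2[of x] by metis

lemma left_regular_add: "left_regular s (x + y) = left_regular s x + left_regular s y"
  by (rule l2_cases[of x], rule l2_cases[of y])
     (simp add: left_regular_abs_l2 add_abs_l2 square_integrable_add square_integrable_translate)

lemma left_regular_scaleC: "left_regular s (a *\<^sub>C x) = a *\<^sub>C left_regular s x"
  by (rule l2_cases[of x])
     (simp add: left_regular_abs_l2 scaleC_abs_l2 square_integrable_scale square_integrable_translate)

lemma left_regular_comp: "left_regular (s + t) x = left_regular s (left_regular t x)"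
  by (rule l2_cases[of x])
     (simp add: left_regular_abs_l2 square_integrable_translate minus_add add.assoc del: add_uminus_conv_diff)

lemma left_regular_0 [simp]: "left_regular 0 x = x"
  by (rule l2_cases[of x]) (simp add: left_regular_abs_l2)

lemma left_regular_inverse [simp]:
  "left_regular s (left_regular (- s) x) = x" "left_regular (- s) (left_regular s x) = x"
  by (simp_all add: left_regular_comp[symmetric])

lemma cinner_left_regular: "cinner (left_regular s x) (left_regular s y) = cinner x y"
proof (rule l2_cases[of x], rule l2_cases[of y])
  fix f g assume fg: "square_integrable f" "x = abs_l2 f" "square_integrable g" "y = abs_l2 g"
  have "(\<integral>t. f (- s + t) * cnj (g (- s + t)) \<partial>haar) = (\<integral>t. f t * cnj (g t) \<partial>haar)"
    by (rule integral_haar_translate)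
       (use borel_measurable_integrable[OF square_integrable_product[OF fg(1,3)]] in simp)
  then show ?thesis
    by (simp add: fg left_regular_abs_l2 cinner_abs_l2 square_integrable_translate)
qed

lemma cinner_left_regular_left: "cinner (left_regular s x) y = cinner x (left_regular (- s) y)"
  using cinner_left_regular[of s x "left_regular (- s) y"] by simp

lemma cinner_left_regular_right: "cinner x (left_regular s y) = cinner (left_regular (- s) x) y"
  using cinner_left_regular[of s "left_regular (- s) x" y] by simp

lemma norm_left_regular [simp]: "norm (left_regular s x) = norm x"
proof -
  have "(norm (left_regular s x))\<^sup>2 = (norm x)\<^sup>2"
    using cinner_left_regular[of s x x] unfolding cinner_self by (simp only: of_real_eq_iff)
  then show ?thesis by (simp add: power2_eq_iff_nonneg)
qed

lemma left_regular_diff: "left_regular s (x - y) = left_regular s x - left_regular s y"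
  using left_regular_add[of s "x - y" y] by (simp add: algebra_simps)

lemma left_regular_unitary:
  assumes K: "invariant_subspace left_regular K"
  shows "unitary_between K K (left_regular s)"
  unfolding unitary_between_def clinear_on_def
proof (intro conjI ballI allI)
  have inv: "left_regular t x \<in> K" if "x \<in> K" for t x
    using K that by (simp add: invariant_subspace_def)
  show "bij_betw (left_regular s) K K"
    by (rule bij_betw_byWitness[where f' = "left_regular (- s)"]) (auto simp: inv)
qed (simp_all add: left_regular_add left_regular_scaleC cinner_left_regular)

text \<open>For \<open>u\<close> near the identity, \<phi> and its translate vanish outside one
  compact set \<open>L\<close>, on which uniform closeness gives closeness in
  \<open>L\<^sup>2\<close>; the choice of \<open>d\<close> absorbs the measure of
  \<open>L\<close>.\<close>

lemma csupp_abs_diff: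
  fixes \<phi> :: "'g::locally_compact_group \<Rightarrow> complex"
  assumes \<phi>: "csupp \<phi>" and e: "0 < e"
  obtains U where "open U" "0 \<in> U" "\<And>u. u \<in> U \<Longrightarrow> norm (left_regular u (abs_l2 \<phi>) - abs_l2 \<phi>) < e"
proof -
  obtain K where K: "compact K" "\<And>x. x \<notin> K \<Longrightarrow> \<phi> x = 0" using csuppE[OF \<phi>] by blast
  obtain N C :: "'g set" where N: "open N" "compact C" "0 \<in> N" "N \<subseteq> C" by (rule compact_nhd[of 0])
  define L where "L = (\<lambda>(x, y). x + y) ` (C \<times> K)"
  have L: "compact L" unfolding L_def case_prod_beta
    by (intro compact_continuous_image compact_Times N K continuous_intros)
  have KL: "u + k \<in> L" if "u \<in> C" "k \<in> K" for u k using that by (auto simp: L_def)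
  have L_fin: "emeasure haar L < \<infinity>" "L \<in> sets borel"
    using haar_finite_compact[OF L] compact_borel[OF L] by auto
  define d where "d = e / sqrt (measure haar L + 1)"
  have m1: "0 < measure haar L + 1" by (simp add: add_nonneg_pos)
  have d: "0 < d" using e m1 by (simp add: d_def)
  obtain U where U: "open U" "0 \<in> U" "\<And>u s. u \<in> U \<Longrightarrow> norm (\<phi> (u + s) - \<phi> s) < d"
    using csupp_uniformly_continuous[OF \<phi> d] by metis
  have sq: "square_integrable \<phi>" by (rule csupp_square_integrable[OF \<phi>])
  show thesis
  proof
    \<comment> \<open>\<open>left_regular u\<close> translates arguments by \<open>- u\<close>,
      hence the reflected neighbourhood.\<close>
    show "open (N \<inter> uminus -` U)" using N(1) U(1) by (intro open_Int open_vimage continuous_intros)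
    show "0 \<in> N \<inter> uminus -` U" using N(3) U(2) by simp
    fix u assume u: "u \<in> N \<inter> uminus -` U"
    define f where "f t = \<phi> (- u + t) - \<phi> t" for t
    have f: "square_integrable f"
      unfolding f_def by (intro square_integrable_diff square_integrable_translate sq)
    have le: "(cmod (f t))\<^sup>2 \<le> d\<^sup>2 * indicat_real L t" for t
    proof (cases "t \<in> L")
      case True
      then show ?thesis using U(3)[of "- u" t] u by (simp add: f_def power_mono less_imp_le)
    next
      case False
      have "t \<notin> K" using KL[of 0 t] N False by auto
      moreover have "- u + t \<notin> K" using KL[of u "- u + t"] u N False by auto
      ultimately show ?thesis by (simp add: f_def K(2))
    qed
    have "(norm (abs_l2 f))\<^sup>2 = (\<integral>t. (cmod (f t))\<^sup>2 \<partial>haar)" by (simp add: norm_abs_l2 f)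
    also have "\<dots> \<le> (\<integral>t. d\<^sup>2 * indicat_real L t \<partial>haar)"
      using f L_fin le by (intro integral_mono) (auto simp: square_integrable_def intro!: integrable_mult_right integrable_real_indicator)
    also have "\<dots> = d\<^sup>2 * measure haar L" using L_fin by simp
    also have "\<dots> < e\<^sup>2"
      using e m1 by (simp add: d_def power_divide pos_divide_less_eq distrib_left)
    finally have "norm (abs_l2 f) < e" using e by (simp add: power_less_imp_less_base)
    moreover have "left_regular u (abs_l2 \<phi>) - abs_l2 \<phi> = abs_l2 f"
      by (simp add: left_regular_abs_l2 sq diff_abs_l2 square_integrable_translate f_def[abs_def])
    ultimately show "norm (left_regular u (abs_l2 \<phi>) - abs_l2 \<phi>) < e" by simp
  qed
qed

text \<open>Unitarity moves the translation onto \<phi>, so continuity of the translates of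
  compactly supported functions suffices, for arbitrary \<open>x\<close>.\<close>

lemma csupp_coefficient_continuous:
  fixes \<phi> :: "'g::locally_compact_group \<Rightarrow> complex"
  assumes \<phi>: "csupp \<phi>"
  shows "continuous_on UNIV (\<lambda>s. cinner (abs_l2 \<phi>) (left_regular s x))"
proof -
  have "((\<lambda>s. cinner (abs_l2 \<phi>) (left_regular s x)) \<longlongrightarrow> cinner (abs_l2 \<phi>) (left_regular s0 x)) (at s0)" for s0
  proof (rule tendstoI)
    fix e :: real assume e: "0 < e"
    define d where "d = e / (norm x + 1)"
    have d: "0 < d" using e by (simp add: d_def add_nonneg_pos)
    obtain U where U: "open U" "0 \<in> U" "\<And>u. u \<in> U \<Longrightarrow> norm (left_regular u (abs_l2 \<phi>) - abs_l2 \<phi>) < d"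
      by (rule csupp_abs_diff[OF \<phi> d]) blast
    have "open ((\<lambda>s. s0 + - s) -` U)" using U(1) by (intro open_vimage continuous_intros)
    moreover have "s0 \<in> (\<lambda>s. s0 + - s) -` U" using U(2) by simp
    moreover have "dist (cinner (abs_l2 \<phi>) (left_regular s x)) (cinner (abs_l2 \<phi>) (left_regular s0 x)) < e"
      if s: "s \<in> (\<lambda>s. s0 + - s) -` U" for s
    proof -
      have "left_regular (- s) (abs_l2 \<phi>) - left_regular (- s0) (abs_l2 \<phi>)
          = left_regular (- s0) (left_regular (s0 + - s) (abs_l2 \<phi>) - abs_l2 \<phi>)"
        unfolding left_regular_diff by (simp add: left_regular_comp[symmetric] del: add_uminus_conv_diff)
      then have n: "norm (left_regular (- s) (abs_l2 \<phi>) - left_regular (- s0) (abs_l2 \<phi>)) < d"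
        using U(3)[of "s0 + - s"] s by simp
      have "cmod (cinner (abs_l2 \<phi>) (left_regular s x) - cinner (abs_l2 \<phi>) (left_regular s0 x))
          = cmod (cinner (left_regular (- s) (abs_l2 \<phi>) - left_regular (- s0) (abs_l2 \<phi>)) x)"
        by (simp add: cinner_left_regular_right cinner_diff_left)
      also have "\<dots> \<le> norm (left_regular (- s) (abs_l2 \<phi>) - left_regular (- s0) (abs_l2 \<phi>)) * norm x"
        by (rule cinner_Cauchy_Schwarz)
      also have "\<dots> \<le> d * norm x" using n by (intro mult_right_mono) auto
      also have "\<dots> < e" using e
        by (simp add: d_def pos_divide_less_eq add_nonneg_pos distrib_left)
      finally show ?thesis by (simp add: dist_norm)
    qed
    ultimately show "\<forall>\<^sub>F s in at s0. dist (cinner (abs_l2 \<phi>) (left_regular s x)) (cinner (abs_l2 \<phi>) (left_regular s0 x)) < e"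
      unfolding eventually_at_topological by blast
  qed
  then show ?thesis by (simp add: continuous_on_def)
qed

subsection \<open>Compactly supported functions are dense\<close>

lemma haar_Diff_le:
  fixes C U :: "'g::locally_compact_group set"
  assumes C: "C \<subseteq> U" "C \<in> sets borel" and U: "U \<in> sets borel" "emeasure haar U < \<infinity>"
    and less: "emeasure haar U < emeasure haar C + ennreal e"
  shows "emeasure haar (U - C) \<le> ennreal e"
proof -
  have Cfin: "emeasure haar C \<noteq> \<infinity>"
    using emeasure_mono[OF C(1), of haar] U by (auto simp: top_unique)
  have "emeasure haar (U - C) = emeasure haar U - emeasure haar C"
    by (rule emeasure_Diff) (use C Cfin U in auto)
  also have "\<dots> \<le> (emeasure haar C + ennreal e) - emeasure haar C"
    by (rule ennreal_minus_mono[OF less_imp_le[OF less] order_refl])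
  also have "\<dots> = ennreal e"
    by (subst add.commute) (rule ennreal_add_diff_cancel[OF Cfin])
  finally show ?thesis .
qed

lemma open_inner_approx:
  fixes U :: "'g::locally_compact_group set"
  assumes U: "open U" "emeasure haar U < \<infinity>" and e: "0 < (e::real)"
  shows "\<exists>K. compact K \<and> K \<subseteq> U \<and> emeasure haar (U - K) \<le> ennreal e"
proof -
  have ne: "{K. compact K \<and> K \<subseteq> U} \<noteq> {}" by (auto intro: exI[of _ "{}"])
  from U(2) have "emeasure haar U \<noteq> \<infinity>" by auto
  from SUP_approx_ennreal[OF e ne haar_inner_regular[OF U(1)] this]
  obtain K where K: "compact K" "K \<subseteq> U" "emeasure haar U < emeasure haar K + ennreal e" by blast
  then have "emeasure haar (U - K) \<le> ennreal e"
    using U by (intro haar_Diff_le) (auto simp: compact_borel)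
  then show ?thesis using K by blast
qed

lemma square_integrable_indicator:
  fixes A :: "'g::locally_compact_group set"
  assumes A: "A \<in> sets borel" "emeasure haar A < \<infinity>"
  shows "square_integrable (indicator A)"
proof -
  have "(\<lambda>s. (cmod (indicator A s))\<^sup>2) = indicat_real A" by (auto simp: fun_eq_iff indicator_def)
  moreover have "integrable haar (indicat_real A)"
    by (rule integrable_real_indicator) (use A in auto)
  ultimately show ?thesis using A(1) by (simp add: square_integrable_def)
qed

lemma indicator_approx:
  fixes A :: "'g::locally_compact_group set"
  assumes A: "A \<in> sets borel" "emeasure haar A < \<infinity>" and e: "0 < (e::real)"
  obtains \<phi> :: "'g \<Rightarrow> complex" where "csupp \<phi>" "norm (abs_l2 (indicator A) - abs_l2 \<phi>) \<le> e"
proof -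
  have e2: "0 < e\<^sup>2 / 2" using e by simp
  obtain U where U: "open U" "A \<subseteq> U" "emeasure haar U < emeasure haar A + ennreal (e\<^sup>2 / 2)"
    using INF_approx_ennreal[OF e2 haar_outer_regular[OF A(1)[folded sets_haar]]] A(2)
    by (auto simp: less_top)
  have Ufin: "emeasure haar U < \<infinity>" using U(3) A(2) by (auto simp: top_unique less_top[symmetric])
  obtain K where K: "compact K" "K \<subseteq> U" "emeasure haar (U - K) \<le> ennreal (e\<^sup>2 / 2)"
    using open_inner_approx[OF U(1) Ufin e2] by blast
  have Kb: "K \<in> sets borel" "U \<in> sets borel" using K(1) U(1) by (simp_all add: compact_borel)
  obtain f :: "'g \<Rightarrow> real" where f: "csupp f" "\<And>x. 0 \<le> f x" "\<And>x. f x \<le> 1"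
    "\<And>x. x \<in> K \<Longrightarrow> f x = 1" "\<And>x. x \<notin> U \<Longrightarrow> f x = 0"
    by (rule csupp_Urysohn[OF K(1) U(1) K(2)], rule that, assumption) auto
  define \<phi> where "\<phi> x = complex_of_real (f x)" for x
  have \<phi>: "csupp \<phi>" unfolding \<phi>_def by (rule csupp_compose[OF f(1)]) (auto intro!: continuous_intros)
  have iA: "square_integrable (indicator A :: 'g \<Rightarrow> complex)"
    by (rule square_integrable_indicator[OF A])
  have s\<phi>: "square_integrable \<phi>" by (rule csupp_square_integrable[OF \<phi>])
  have "ennreal ((norm (abs_l2 (\<lambda>s. indicator A s - \<phi> s)))\<^sup>2)
      = (\<integral>\<^sup>+s. ennreal ((cmod (indicator A s - \<phi> s))\<^sup>2) \<partial>haar)"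
    by (rule nn_integral_square[symmetric, OF square_integrable_diff[OF iA s\<phi>]])
  \<comment> \<open>The error is at most 1 and vanishes outside \<open>U\<close> and on
    \<open>A \<inter> K\<close>, so it is controlled by two sets of measure at most
    \<open>e\<^sup>2 / 2\<close>.\<close>
  also have "\<dots> \<le> (\<integral>\<^sup>+s. indicator (U - A) s + indicator (U - K) s \<partial>haar)"
  proof (rule nn_integral_mono)
    fix s
    have "indicator A s - \<phi> s = complex_of_real (indicat_real A s - f s)"
      by (simp add: \<phi>_def indicator_def)
    then have "cmod (indicator A s - \<phi> s) = \<bar>indicat_real A s - f s\<bar>"
      by (simp only: norm_of_real)
    also have "\<dots> \<le> 1" using f(2,3)[of s] by (auto simp: indicator_def)
    finally have "(cmod (indicator A s - \<phi> s))\<^sup>2 \<le> 1" by (simp add: abs_square_le_1)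
    then have le: "ennreal ((cmod (indicator A s - \<phi> s))\<^sup>2) \<le> 1" by (simp add: ennreal_le_1)
    consider "s \<notin> U" | "s \<in> U - A" | "s \<in> U - K" | "s \<in> A" "s \<in> K" by blast
    then show "ennreal ((cmod (indicator A s - \<phi> s))\<^sup>2) \<le> indicator (U - A) s + indicator (U - K) s"
    proof cases
      case 1
      then have "s \<notin> A" "f s = 0" using U(2) f(5) by auto
      then show ?thesis by (simp add: \<phi>_def)
    next
      case 2
      then show ?thesis using order_trans[OF le, of "1 + indicator (U - K) s"] by simp
    next
      case 3
      then show ?thesis using order_trans[OF le, of "indicator (U - A) s + 1"] by simp
    next
      case 4
      then show ?thesis by (simp add: \<phi>_def f(4))
    qed
  qed
  also have "\<dots> = emeasure haar (U - A) + emeasure haar (U - K)"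
    using A Kb by (subst nn_integral_add) auto
  also have "\<dots> \<le> ennreal (e\<^sup>2 / 2) + ennreal (e\<^sup>2 / 2)"
  proof (rule add_mono)
    show "emeasure haar (U - A) \<le> ennreal (e\<^sup>2 / 2)"
      by (rule haar_Diff_le[OF U(2) A(1) Kb(2) Ufin U(3)])
  qed (rule K(3))
  also have "\<dots> = ennreal (e\<^sup>2)" by (simp flip: ennreal_plus)
  finally have "(norm (abs_l2 (\<lambda>s. indicator A s - \<phi> s)))\<^sup>2 \<le> e\<^sup>2" by (subst (asm) ennreal_le_iff) auto
  then have "norm (abs_l2 (\<lambda>s. indicator A s - \<phi> s)) \<le> e"
    by (rule power2_le_imp_le) (use e in simp)
  then have "norm (abs_l2 (indicator A) - abs_l2 \<phi>) \<le> e" by (simp add: diff_abs_l2 iA s\<phi>)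
  with \<phi> show thesis by (rule that)
qed

text \<open>Where the real part exceeds \<open>1 / real (Suc n)\<close> the measure is finite
  because f is square-integrable. The indicator of that set is then a limit of compactly supported
  functions, so f is orthogonal to it as well, which forces the set to be null.\<close>

lemma orthogonal_csupp_Re_nonpos:
  fixes f :: "'g::locally_compact_group \<Rightarrow> complex"
  assumes f: "square_integrable f" and orth: "\<And>\<phi>. csupp \<phi> \<Longrightarrow> cinner (abs_l2 f) (abs_l2 \<phi>) = 0"
  shows "AE s in haar. Re (f s) \<le> 0"
proof -
  have fm [measurable]: "f \<in> borel_measurable borel" by (rule square_integrable_measurable[OF f])
  define A where "A n = {s. 1 / real (Suc n) < Re (f s)}" for n
  have Am [measurable]: "A n \<in> sets borel" for n
  proof -
    have "{s \<in> space borel. 1 / real (Suc n) < Re (f s)} \<in> sets borel" by measurable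
    then show ?thesis by (simp add: A_def)
  qed
  have null: "emeasure haar (A n) = 0" for n
  proof -
    have le: "1 \<le> real (Suc n) * Re (f s)" if "s \<in> A n" for s
      using that by (simp add: A_def field_simps)
    have "emeasure haar (A n) = (\<integral>\<^sup>+s. indicator (A n) s \<partial>haar)" by simp
    also have "\<dots> \<le> (\<integral>\<^sup>+s. ennreal ((real (Suc n))\<^sup>2) * ennreal ((cmod (f s))\<^sup>2) \<partial>haar)"
    proof (rule nn_integral_mono)
      fix s
      show "indicator (A n) s \<le> ennreal ((real (Suc n))\<^sup>2) * ennreal ((cmod (f s))\<^sup>2)"
      proof (cases "s \<in> A n")
        case True
        have "1 \<le> real (Suc n) * cmod (f s)"
          using le[OF True] complex_Re_le_cmod[of "f s"] mult_left_mono[of "Re (f s)" "cmod (f s)" "real (Suc n)"]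
          by linarith
        then have "1 \<le> (real (Suc n) * cmod (f s))\<^sup>2" by (rule one_le_power)
        then have "ennreal 1 \<le> ennreal ((real (Suc n))\<^sup>2 * (cmod (f s))\<^sup>2)"
          by (intro ennreal_leI) (simp add: power_mult_distrib)
        then show ?thesis using True by (simp add: ennreal_mult)
      qed simp
    qed
    also have "\<dots> = ennreal ((real (Suc n))\<^sup>2) * ennreal ((norm (abs_l2 f))\<^sup>2)"
      by (subst nn_integral_cmult) (auto simp: nn_integral_square[OF f])
    also have "\<dots> < \<infinity>" by (simp add: ennreal_mult_less_top)
    finally have fin: "emeasure haar (A n) < \<infinity>" .
    have iA: "square_integrable (indicator (A n) :: 'g \<Rightarrow> complex)"
      by (rule square_integrable_indicator[OF Am fin])
    have "cmod (cinner (abs_l2 f) (abs_l2 (indicator (A n)))) \<le> e" if e: "0 < e" for e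
    proof -
      obtain \<phi> where \<phi>: "csupp \<phi>" "norm (abs_l2 (indicator (A n)) - abs_l2 \<phi>) \<le> e / (norm (abs_l2 f) + 1)"
        by (rule indicator_approx[OF Am fin, of "e / (norm (abs_l2 f) + 1)"]) (use e in \<open>auto simp: add_nonneg_pos\<close>)
      have "cinner (abs_l2 f) (abs_l2 (indicator (A n))) = cinner (abs_l2 f) (abs_l2 (indicator (A n)) - abs_l2 \<phi>)"
        by (simp add: cinner_diff_right orth[OF \<phi>(1)])
      also have "cmod \<dots> \<le> norm (abs_l2 f) * (e / (norm (abs_l2 f) + 1))"
        by (rule order_trans[OF cinner_Cauchy_Schwarz]) (rule mult_left_mono[OF \<phi>(2)], simp)
      also have "\<dots> \<le> e" using e by (simp add: pos_divide_le_eq add_nonneg_pos distrib_left mult.commute)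
      finally show ?thesis .
    qed
    then have "cinner (abs_l2 f) (abs_l2 (indicator (A n))) = 0"
      using field_le_epsilon[of "cmod (cinner (abs_l2 f) (abs_l2 (indicator (A n))))" 0] by simp
    then have "(\<integral>s. f s * cnj (indicator (A n) s) \<partial>haar) = 0" by (simp add: cinner_abs_l2 f iA)
    then have "0 = Re (\<integral>s. f s * cnj (indicator (A n) s) \<partial>haar)" by simp
    also have "\<dots> = (\<integral>s. Re (f s * cnj (indicator (A n) s)) \<partial>haar)"
      by (rule integral_Re[symmetric]) (rule square_integrable_product[OF f iA])
    also have "\<dots> \<ge> (\<integral>s. (1 / real (Suc n)) * indicat_real (A n) s \<partial>haar)"
    proof (rule integral_mono)
      show "integrable haar (\<lambda>s. (1 / real (Suc n)) * indicat_real (A n) s)"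
        using fin by (intro integrable_mult_right integrable_real_indicator) auto
      show "integrable haar (\<lambda>s. Re (f s * cnj (indicator (A n) s)))"
        by (intro integrable_Re square_integrable_product f iA)
    qed (auto simp: A_def indicator_def)
    finally have "measure haar (A n) \<le> 0" using fin by (simp add: divide_le_0_iff)
    then show ?thesis using fin by (simp add: emeasure_eq_ennreal_measure measure_le_0_iff less_top)
  qed
  have "AE s in haar. \<forall>n. s \<notin> A n"
    using null unfolding AE_all_countable by (intro allI AE_not_in null_setsI) auto
  then show ?thesis
  proof (rule eventually_mono)
    fix s assume s: "\<forall>n. s \<notin> A n"
    show "Re (f s) \<le> 0"
    proof (rule ccontr)
      assume "\<not> Re (f s) \<le> 0"
      then have "0 < Re (f s)" by simp
      then obtain n where "inverse (real (Suc n)) < Re (f s)" using reals_Archimedean by blast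
      then have "s \<in> A n" by (simp add: A_def inverse_eq_divide)
      then show False using s by blast
    qed
  qed
qed

lemma orthogonal_csupp_zero:
  fixes x :: "'g::locally_compact_group l2"
  assumes orth: "\<And>\<phi>. csupp \<phi> \<Longrightarrow> cinner x (abs_l2 \<phi>) = 0"
  shows "x = 0"
proof (rule l2_cases[of x])
  fix f assume f: "square_integrable f" "x = abs_l2 f"
  have "AE s in haar. Re (c * f s) \<le> 0" for c
  proof (rule orthogonal_csupp_Re_nonpos[OF square_integrable_scale[OF f(1)]])
    fix \<phi> :: "'g \<Rightarrow> complex" assume "csupp \<phi>"
    then show "cinner (abs_l2 (\<lambda>s. c * f s)) (abs_l2 \<phi>) = 0"
      using orth[of \<phi>] f by (simp add: scaleC_abs_l2[symmetric] cinner_scaleC_left)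
  qed
  \<comment> \<open>The four rotations bound the real and imaginary parts from both sides.\<close>
  from this[of 1] this[of "-1"] this[of \<i>] this[of "-\<i>"]
  have "AE s in haar. f s = 0" by eventually_elim (auto simp: complex_eq_iff)
  then have "abs_l2 f = abs_l2 (\<lambda>_. 0)" by (intro abs_l2_cong f square_integrable_zero)
  then show "x = 0" by (simp add: f zero_l2_def)
qed

lemma csupp_add:
  assumes f: "csupp f" and g: "csupp g" shows "csupp (\<lambda>s. f s + g s)"
proof -
  obtain K where K: "compact K" "\<And>x. x \<notin> K \<Longrightarrow> f x = 0" using csuppE[OF f] by blast
  obtain L where L: "compact L" "\<And>x. x \<notin> L \<Longrightarrow> g x = 0" using csuppE[OF g] by blast
  show ?thesis
    by (rule csuppI[OF _ compact_Un[OF K(1) L(1)]])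
       (auto simp: K L intro!: continuous_on_add csupp_continuous[OF f] csupp_continuous[OF g])
qed

lemma csupp_dense:
  fixes x :: "'g::locally_compact_group l2"
  obtains \<phi> where "\<And>n::nat. csupp (\<phi> n)" "(\<lambda>n. abs_l2 (\<phi> n)) \<longlonglongrightarrow> x"
proof -
  define S :: "'g l2 set" where "S = {abs_l2 \<phi> |\<phi>. csupp \<phi>}"
  have add: "a + b \<in> S" if "a \<in> S" "b \<in> S" for a b
  proof -
    obtain \<phi> \<psi> where "csupp \<phi>" "a = abs_l2 \<phi>" "csupp \<psi>" "b = abs_l2 \<psi>"
      using \<open>a \<in> S\<close> \<open>b \<in> S\<close> by (auto simp: S_def)
    moreover from this have "csupp (\<lambda>s. \<phi> s + \<psi> s)" by (intro csupp_add)
    ultimately show ?thesis by (auto simp: S_def add_abs_l2 csupp_square_integrable)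
  qed
  have scale: "c *\<^sub>C a \<in> S" if "a \<in> S" for a c
  proof -
    obtain \<phi> where "csupp \<phi>" "a = abs_l2 \<phi>" using \<open>a \<in> S\<close> by (auto simp: S_def)
    moreover from this have "csupp (\<lambda>s. c * \<phi> s)" by (intro csupp_mult(2)) auto
    ultimately show ?thesis by (auto simp: S_def scaleC_abs_l2 csupp_square_integrable)
  qed
  have "closed_csubspace (closure S)" unfolding closed_csubspace_def
  proof (intro conjI ballI allI)
    have "csupp (\<lambda>_. 0 :: complex)" by (rule csuppI[of _ "{}"]) auto
    then have "0 \<in> S" by (auto simp: S_def zero_l2_def)
    then show "0 \<in> closure S" using closure_subset by blast
    show "a + b \<in> closure S" if ab: "a \<in> closure S" "b \<in> closure S" for a b
    proof -
      obtain p q where pq: "\<And>n. p n \<in> S" "p \<longlonglongrightarrow> a" "\<And>n. q n \<in> S" "q \<longlonglongrightarrow> b"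
        using ab unfolding closure_sequential by blast
      then show ?thesis unfolding closure_sequential
        by (intro exI[of _ "\<lambda>n. p n + q n"] conjI allI add tendsto_add)
    qed
    show "c *\<^sub>C a \<in> closure S" if a: "a \<in> closure S" for a c
    proof -
      obtain p where p: "\<And>n. p n \<in> S" "p \<longlonglongrightarrow> a" using a unfolding closure_sequential by blast
      then show ?thesis unfolding closure_sequential
        by (intro exI[of _ "\<lambda>n. c *\<^sub>C p n"] conjI allI scale bounded_linear.tendsto[OF bounded_linear_scaleC])
    qed
  qed simp
  then have "closure S = UNIV"
  proof (rule closed_csubspace_dense)
    fix y assume y: "\<And>z. z \<in> closure S \<Longrightarrow> cinner y z = 0"
    show "y = 0" by (intro orthogonal_csupp_zero y subsetD[OF closure_subset]) (auto simp: S_def)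
  qed
  then obtain p where p: "\<And>n. p n \<in> S" "p \<longlonglongrightarrow> x" using closure_sequential[of x S] by auto
  then have "\<forall>n. \<exists>\<phi>. csupp \<phi> \<and> p n = abs_l2 \<phi>" by (auto simp: S_def)
  then obtain \<phi> where "\<And>n. csupp (\<phi> n)" "\<And>n. p n = abs_l2 (\<phi> n)" by metis
  moreover from this(2) have "p = (\<lambda>n. abs_l2 (\<phi> n))" by (simp add: fun_eq_iff)
  ultimately show thesis using p(2) by (intro that[of \<phi>]) simp_all
qed

subsection \<open>Square-integrability by duality and by limits\<close>

text \<open>The Haar measure need not be \<open>\<sigma>\<close>-finite, so the bound on compact sets is first extended to the
  open sets \<open>{1/n < \<bar>F\<bar>\<^sup>2 < n}\<close>, which have finite measure.\<close>

lemma square_integrable_by_duality: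
  fixes F :: "'g::locally_compact_group \<Rightarrow> complex"
  assumes F: "continuous_on UNIV F"
    and bound: "\<And>g. csupp g \<Longrightarrow> cmod (\<integral>s. F s * cnj (g s) \<partial>haar) \<le> C * norm (abs_l2 g)"
  shows "square_integrable F"
proof -
  have Fm [measurable]: "F \<in> borel_measurable borel" by (rule borel_measurable_continuous_onI[OF F])
  define N where "N = density haar (\<lambda>s. ennreal ((cmod (F s))\<^sup>2))"
  have N: "emeasure N A = (\<integral>\<^sup>+s. ennreal ((cmod (F s))\<^sup>2) * indicator A s \<partial>haar)" if "A \<in> sets borel" for A
    unfolding N_def using that by (intro emeasure_density) auto
  have sets_N [simp]: "sets N = sets borel" by (simp add: N_def)
  have N_compact: "emeasure N K \<le> ennreal (C\<^sup>2)" if K: "compact K" for K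
  proof -
    obtain u :: "'g \<Rightarrow> real" where u: "csupp u" "\<And>x. 0 \<le> u x" "\<And>x. u x \<le> 1"
      "\<And>x. x \<in> K \<Longrightarrow> u x = 1"
      by (rule csupp_Urysohn[OF K open_UNIV subset_UNIV], rule that, assumption) auto
    \<comment> \<open>Tested against \<open>F\<close> times a cutoff, the hypothesis improves
      itself: the pairing is \<open>X\<close>, and the squared norm of g is at most
      \<open>X\<close>, so \<open>X\<^sup>2 \<le> C\<^sup>2 * X\<close>.\<close>
    define g where "g s = F s * complex_of_real (u s)" for s
    have cu: "csupp (\<lambda>s. complex_of_real (u s))"
      by (rule csupp_compose[OF u(1)]) (auto intro!: continuous_intros)
    have g: "csupp g" unfolding g_def by (rule csupp_mult(2)[OF cu F])
    have cF2: "continuous_on UNIV (\<lambda>s. (cmod (F s))\<^sup>2)" by (intro continuous_intros F)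
    define X where "X = (\<integral>s. u s * (cmod (F s))\<^sup>2 \<partial>haar)"
    have int: "integrable haar (\<lambda>s. u s * (cmod (F s))\<^sup>2)"
      by (rule csupp_integrable[OF csupp_mult(1)[OF u(1) cF2]])
    have X0: "0 \<le> X" unfolding X_def using u(2) by simp
    have "(\<integral>s. F s * cnj (g s) \<partial>haar) = (\<integral>s. complex_of_real (u s * (cmod (F s))\<^sup>2) \<partial>haar)"
      by (rule Bochner_Integration.integral_cong)
         (simp_all add: g_def complex_norm_square mult_ac del: of_real_power)
    also have "\<dots> = of_real X" unfolding X_def by (rule integral_of_real[OF int])
    finally have 1: "X \<le> C * norm (abs_l2 g)" using bound[OF g] X0 by simp
    have "(norm (abs_l2 g))\<^sup>2 = (\<integral>s. (cmod (g s))\<^sup>2 \<partial>haar)"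
      by (simp add: norm_abs_l2 csupp_square_integrable[OF g])
    also have "\<dots> \<le> X" unfolding X_def
    proof (rule integral_mono[OF _ int])
      show "integrable haar (\<lambda>s. (cmod (g s))\<^sup>2)"
        using csupp_square_integrable[OF g] by (simp add: square_integrable_def)
      fix s
      have "(u s)\<^sup>2 \<le> u s" using u(2,3)[of s] by (simp add: power2_eq_square mult_left_le)
      then show "(cmod (g s))\<^sup>2 \<le> u s * (cmod (F s))\<^sup>2"
        using mult_right_mono[of "(u s)\<^sup>2" "u s" "(cmod (F s))\<^sup>2"]
        by (simp add: g_def norm_mult power_mult_distrib mult.commute)
    qed
    finally have 2: "(norm (abs_l2 g))\<^sup>2 \<le> X" .
    have "X\<^sup>2 \<le> (C * norm (abs_l2 g))\<^sup>2" using 1 X0 by (rule power_mono)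
    also have "\<dots> \<le> C\<^sup>2 * X" unfolding power_mult_distrib using 2 by (rule mult_left_mono) simp
    finally have "X * X \<le> C\<^sup>2 * X" by (simp add: power2_eq_square)
    then have XC: "X \<le> C\<^sup>2" using X0 by (cases "X = 0") simp_all
    have "emeasure N K \<le> (\<integral>\<^sup>+s. ennreal (u s * (cmod (F s))\<^sup>2) \<partial>haar)"
      unfolding N[OF compact_borel[OF K]] by (rule nn_integral_mono) (auto simp: indicator_def u)
    also have "\<dots> = ennreal X" unfolding X_def
      by (rule nn_integral_eq_integral[OF int]) (simp add: u)
    also have "\<dots> \<le> ennreal (C\<^sup>2)" using XC by (rule ennreal_leI)
    finally show ?thesis .
  qed
  define r where "r n = real (Suc n)" for n
  have r: "0 < r n" for n by (simp add: r_def)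
  \<comment> \<open>On \<open>G n\<close> the measures \<open>N\<close> and \<open>haar\<close>
    dominate each other up to the factor \<open>r n\<close>. The bound on compact sets thus yields
    finite Haar measure, and then an inner approximation whose remainder is small for
    \<open>N\<close> too.\<close>
  define G where "G n = (\<lambda>s. (cmod (F s))\<^sup>2) -` {1 / r n <..< r n}" for n
  have Go: "open (G n)" for n
    unfolding G_def by (intro open_vimage continuous_intros F)
  have Gb: "G n \<in> sets borel" for n using Go by simp
  have N_le: "emeasure N A \<le> ennreal (r n) * emeasure haar A" if A: "A \<in> sets borel" "A \<subseteq> G n" for A n
  proof -
    have "emeasure N A \<le> (\<integral>\<^sup>+s. ennreal (r n) * indicator A s \<partial>haar)"
      unfolding N[OF A(1)] using A(2)
      by (intro nn_integral_mono) (auto simp: indicator_def G_def intro!: ennreal_leI)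
    also have "\<dots> = ennreal (r n) * emeasure haar A" using A(1) by (simp add: nn_integral_cmult)
    finally show ?thesis .
  qed
  have haar_le: "emeasure haar A \<le> ennreal (r n) * emeasure N A" if A: "A \<in> sets borel" "A \<subseteq> G n" for A n
  proof -
    have "emeasure haar A = (\<integral>\<^sup>+s. indicator A s \<partial>haar)" using A by simp
    also have "\<dots> \<le> (\<integral>\<^sup>+s. ennreal (r n) * (ennreal ((cmod (F s))\<^sup>2) * indicator A s) \<partial>haar)"
    proof (rule nn_integral_mono)
      fix s
      show "indicator A s \<le> ennreal (r n) * (ennreal ((cmod (F s))\<^sup>2) * indicator A s)"
      proof (cases "s \<in> A")
        case True
        then have "1 / r n < (cmod (F s))\<^sup>2" using A(2) by (auto simp: G_def)
        then have "1 \<le> r n * (cmod (F s))\<^sup>2" using r[of n] by (simp add: field_simps)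
        then have "ennreal 1 \<le> ennreal (r n * (cmod (F s))\<^sup>2)" by (rule ennreal_leI)
        then show ?thesis using True r[of n] by (simp add: ennreal_mult)
      qed simp
    qed
    also have "\<dots> = ennreal (r n) * emeasure N A"
      unfolding N[OF A(1)] using A(1) by (intro nn_integral_cmult) simp
    finally show ?thesis .
  qed
  have G_fin: "emeasure haar (G n) < \<infinity>" for n
  proof -
    have "emeasure haar (G n) \<le> ennreal (r n) * ennreal (C\<^sup>2)"
    proof (subst haar_inner_regular[OF Go], rule SUP_least)
      fix K assume "K \<in> {K. compact K \<and> K \<subseteq> G n}"
      then have K: "compact K" "K \<subseteq> G n" by auto
      have "emeasure haar K \<le> ennreal (r n) * emeasure N K"
        using K by (intro haar_le compact_borel)
      also have "\<dots> \<le> ennreal (r n) * ennreal (C\<^sup>2)"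
        by (rule mult_left_mono[OF N_compact[OF K(1)]]) simp
      finally show "emeasure haar K \<le> ennreal (r n) * ennreal (C\<^sup>2)" .
    qed
    also have "\<dots> < \<infinity>" by (simp add: ennreal_mult_less_top)
    finally show ?thesis .
  qed
  have N_G: "emeasure N (G n) \<le> ennreal (C\<^sup>2)" for n
  proof (rule ennreal_le_epsilon)
    fix e :: real assume e: "0 < e"
    then have "0 < e / r n" using r[of n] by simp
    then obtain K where K: "compact K" "K \<subseteq> G n" "emeasure haar (G n - K) \<le> ennreal (e / r n)"
      using open_inner_approx[OF Go G_fin] by blast
    have Kb: "K \<in> sets borel" by (rule compact_borel[OF K(1)])
    have "emeasure N (G n) = emeasure N (K \<union> (G n - K))" using K(2) by (simp add: Un_absorb1)
    also have "\<dots> \<le> emeasure N K + emeasure N (G n - K)"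
      using Kb Gb by (intro emeasure_subadditive) auto
    also have "\<dots> \<le> ennreal (C\<^sup>2) + ennreal (r n) * emeasure haar (G n - K)"
      using Kb Gb by (intro add_mono N_compact K N_le) auto
    also have "\<dots> \<le> ennreal (C\<^sup>2) + ennreal (r n) * ennreal (e / r n)"
      by (intro add_left_mono mult_left_mono K) simp
    also have "ennreal (r n) * ennreal (e / r n) = ennreal e"
      using e r[of n] by (subst ennreal_mult[symmetric]) auto
    finally show "emeasure N (G n) \<le> ennreal (C\<^sup>2) + ennreal e" .
  qed
  have "incseq G"
  proof (rule incseq_SucI)
    fix n
    have "1 / r (Suc n) \<le> 1 / r n" "r n \<le> r (Suc n)" by (simp_all add: r_def field_simps)
    then show "G n \<subseteq> G (Suc n)" unfolding G_def by auto
  qed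
  then have "emeasure N (\<Union>n. G n) = (SUP n. emeasure N (G n))"
    using Gb by (intro SUP_emeasure_incseq[symmetric]) auto
  also have "\<dots> \<le> ennreal (C\<^sup>2)" by (intro SUP_least N_G)
  finally have "emeasure N (\<Union>n. G n) \<le> ennreal (C\<^sup>2)" .
  moreover have "(\<integral>\<^sup>+s. ennreal ((cmod (F s))\<^sup>2) \<partial>haar) = emeasure N (\<Union>n. G n)"
  proof -
    have "s \<in> (\<Union>n. G n)" if "F s \<noteq> 0" for s
    proof -
      have p: "0 < (cmod (F s))\<^sup>2" using that by simp
      obtain n where n: "inverse (r n) < (cmod (F s))\<^sup>2" using reals_Archimedean[OF p] unfolding r_def by blast
      obtain m where m: "(cmod (F s))\<^sup>2 < real m" using reals_Archimedean2 by blast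
      have "1 / r (max n m) \<le> 1 / r n" by (simp add: r_def field_simps)
      then have "1 / r (max n m) < (cmod (F s))\<^sup>2" using n by (simp add: inverse_eq_divide)
      moreover have "(cmod (F s))\<^sup>2 < r (max n m)" using m by (simp add: r_def)
      ultimately have "s \<in> G (max n m)" by (simp add: G_def)
      then show ?thesis by blast
    qed
    then have "ennreal ((cmod (F s))\<^sup>2) = ennreal ((cmod (F s))\<^sup>2) * indicator (\<Union>n. G n) s" for s
      by (cases "F s = 0") (auto simp: indicator_def)
    moreover have "(\<Union>n. G n) \<in> sets borel" using Gb by auto
    ultimately show ?thesis by (simp add: N)
  qed
  ultimately have "(\<integral>\<^sup>+s. ennreal ((cmod (F s))\<^sup>2) \<partial>haar) < \<infinity>"
    using order_le_less_trans[of _ "ennreal (C\<^sup>2)" top] by simp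
  then show ?thesis by (simp add: square_integrable_iff_nn)
qed

text \<open>Fatou's lemma for the squared distance to \<open>y\<close>. For coefficients pointwise
  convergence is automatic, so this identifies \<open>L\<^sup>2\<close> limits of
  coefficients.\<close>

lemma square_integrable_limit:
  fixes F :: "'g::locally_compact_group \<Rightarrow> complex"
  assumes Fn: "\<And>n. square_integrable (Fn n)" and lim: "\<And>s. (\<lambda>n. Fn n s) \<longlonglongrightarrow> F s"
    and y: "(\<lambda>n. abs_l2 (Fn n)) \<longlonglongrightarrow> y"
  shows "square_integrable F" "abs_l2 F = y"
proof -
  have Fnm [measurable]: "Fn n \<in> borel_measurable borel" for n
    by (rule square_integrable_measurable[OF Fn])
  have Fm [measurable]: "F \<in> borel_measurable borel"
    by (rule borel_measurable_LIMSEQ_metric[OF Fnm lim])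
  have ym [measurable]: "rep_l2 y \<in> borel_measurable borel"
    by (rule square_integrable_measurable[OF square_integrable_rep])
  have "(\<integral>\<^sup>+s. ennreal ((cmod (F s - rep_l2 y s))\<^sup>2) \<partial>haar)
      = (\<integral>\<^sup>+s. liminf (\<lambda>n. ennreal ((cmod (Fn n s - rep_l2 y s))\<^sup>2)) \<partial>haar)"
  proof (rule nn_integral_cong)
    fix s
    have "(\<lambda>n. ennreal ((cmod (Fn n s - rep_l2 y s))\<^sup>2)) \<longlonglongrightarrow> ennreal ((cmod (F s - rep_l2 y s))\<^sup>2)"
      by (intro tendsto_intros lim)
    then show "ennreal ((cmod (F s - rep_l2 y s))\<^sup>2) = liminf (\<lambda>n. ennreal ((cmod (Fn n s - rep_l2 y s))\<^sup>2))"
      by (intro lim_imp_Liminf[symmetric] sequentially_bot)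
  qed
  also have "\<dots> \<le> liminf (\<lambda>n. \<integral>\<^sup>+s. ennreal ((cmod (Fn n s - rep_l2 y s))\<^sup>2) \<partial>haar)"
    by (rule nn_integral_liminf) measurable
  also have "(\<lambda>n. \<integral>\<^sup>+s. ennreal ((cmod (Fn n s - rep_l2 y s))\<^sup>2) \<partial>haar) = (\<lambda>n. ennreal ((norm (abs_l2 (Fn n) - y))\<^sup>2))"
    using diff_abs_l2[OF Fn square_integrable_rep[of y]]
    by (simp add: nn_integral_square square_integrable_diff Fn square_integrable_rep)
  also have "liminf \<dots> = ennreal (0\<^sup>2)"
  proof (intro lim_imp_Liminf sequentially_bot)
    have "(\<lambda>n. norm (abs_l2 (Fn n) - y)) \<longlonglongrightarrow> 0" using y by (simp add: LIM_zero tendsto_norm_zero)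
    then show "(\<lambda>n. ennreal ((norm (abs_l2 (Fn n) - y))\<^sup>2)) \<longlonglongrightarrow> ennreal (0\<^sup>2)" by (intro tendsto_intros)
  qed
  finally have "(\<integral>\<^sup>+s. ennreal ((cmod (F s - rep_l2 y s))\<^sup>2) \<partial>haar) = 0" by simp
  then have AE: "AE s in haar. F s = rep_l2 y s"
    by (subst (asm) nn_integral_0_iff_AE) (auto elim: eventually_mono)
  show F: "square_integrable F" by (rule square_integrable_AE_cong[OF square_integrable_rep Fm AE])
  have "abs_l2 F = abs_l2 (rep_l2 y)" by (rule abs_l2_cong[OF F square_integrable_rep AE])
  then show "abs_l2 F = y" by simp
qed

lemma continuous_AE_zero:
  fixes F :: "'g::locally_compact_group \<Rightarrow> complex"
  assumes F: "continuous_on UNIV F" and AE: "AE s in haar. F s = 0"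
  shows "F s = 0"
proof -
  have "emeasure haar {s \<in> space haar. F s \<noteq> 0} = 0"
    by (rule emeasure_eq_0_AE) (use AE in simp)
  moreover have "{s \<in> space haar. F s \<noteq> 0} = F -` (- {0})" by auto
  moreover have "open (F -` (- {0}))" using F by (intro open_vimage) auto
  ultimately have "F -` (- {0}) = {}" using haar_open_pos[of "F -` (- {0})"] by auto
  then show ?thesis by blast
qed

lemma norm_integral_le:
  fixes f :: "'a \<Rightarrow> 'b::{banach,second_countable_topology}"
  assumes "integrable M f" "\<And>x. norm (f x) \<le> g x" "integrable M g"
  shows "norm (\<integral>x. f x \<partial>M) \<le> (\<integral>x. g x \<partial>M)"
  using assms by (intro order_trans[OF integral_norm_bound integral_mono]) auto

subsection \<open>Coefficients of the left regular representation\<close>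

lemma voice_left_regular:
  assumes "square_integrable f" "square_integrable g"
  shows "voice_transform left_regular (abs_l2 g) (abs_l2 f) s = (\<integral>t. f t * cnj (g (- s + t)) \<partial>haar)"
  using assms by (simp add: voice_transform_def left_regular_abs_l2 cinner_abs_l2 square_integrable_translate)

text \<open>Reads the convolutions in \<open>right_bounded\<close> and \<open>E_prime\<close> as
  coefficients of the regular representation.\<close>

lemma convolution_eq_voice:
  assumes "square_integrable f" "square_integrable (flat g)"
  shows "convolution f g = voice_transform left_regular (abs_l2 (flat g)) (abs_l2 f)"
  using assms by (simp add: fun_eq_iff voice_left_regular convolution_def flat_def minus_add)

lemma left_coefficient_integrable:
  fixes \<phi> g :: "'g::locally_compact_group \<Rightarrow> complex"
  assumes \<phi>: "csupp \<phi>" and g: "csupp g"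
  shows "integrable haar (\<lambda>t. \<phi> t * cinner (left_regular t x) (abs_l2 g))"
proof -
  have "continuous_on UNIV (\<lambda>t. cnj (cinner (abs_l2 g) (left_regular t x)))"
    by (intro continuous_intros csupp_coefficient_continuous g)
  then have "continuous_on UNIV (\<lambda>t. cinner (left_regular t x) (abs_l2 g))"
    by (simp flip: cinner_commute)
  then show ?thesis by (intro csupp_integrable csupp_mult(1) \<phi>)
qed

lemma csupp_flat: "csupp f \<Longrightarrow> csupp (flat f)"
  unfolding flat_def[abs_def]
  by (rule csupp_compose[OF csupp_uminus]) (auto intro!: continuous_intros)

text \<open>The Fubini identity \<open>\<integral> \<phi>(t) (\<lambda>(t) h | g) dt = (\<phi> * h | g)\<close>. Continuous \<open>h\<close> are covered by
  \<open>kernel_Fubini\<close>; both sides are continuous in \<open>h\<close> for the \<open>L\<^sup>2\<close> norm because only the values of \<open>h\<close>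
  on a compact set matter, where the modular function is bounded.\<close>

lemma kernel_pairing:
  fixes \<phi> g h :: "'g::locally_compact_group \<Rightarrow> complex"
  assumes \<phi>: "csupp \<phi>" and g: "csupp g" and h: "square_integrable h" "square_integrable (flat h)"
  shows "(\<integral>t. \<phi> t * cinner (left_regular t (abs_l2 h)) (abs_l2 g) \<partial>haar)
    = (\<integral>s. voice_transform left_regular (abs_l2 (flat h)) (abs_l2 \<phi>) s * cnj (g s) \<partial>haar)"
proof -
  obtain K where K: "compact K" "\<And>x. x \<notin> K \<Longrightarrow> \<phi> x = 0" using csuppE[OF \<phi>] by blast
  obtain L where L: "compact L" "\<And>x. x \<notin> L \<Longrightarrow> g x = 0" using csuppE[OF g] by blast
  have sq: "square_integrable \<phi>" "square_integrable g" using \<phi> g by (simp_all add: csupp_square_integrable)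
  define E where "E = (\<lambda>(t, s). - t + s) ` (K \<times> L)"
  have E: "compact E" unfolding E_def case_prod_beta
    by (intro compact_continuous_image compact_Times K L continuous_intros)
  have inE: "- t + s \<in> E" if "t \<in> K" "s \<in> L" for t s using that by (auto simp: E_def)
  have Eb [measurable]: "E \<in> sets borel" by (rule compact_borel[OF E])
  have "compact ((\<lambda>s. inverse (modular s)) ` E)"
    by (intro compact_continuous_image E continuous_on_subset[OF continuous_inverse_modular]) simp
  then obtain B where B: "0 < B" "\<And>u. u \<in> E \<Longrightarrow> inverse (modular u) \<le> B"
    using compact_imp_bounded bounded_pos[of "(\<lambda>s. inverse (modular s)) ` E"]
    by (metis abs_ge_self image_eqI order_trans real_norm_def)
  have bound: "cmod (voice_transform left_regular (abs_l2 (flat d)) (abs_l2 \<phi>) s)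
      \<le> norm (abs_l2 \<phi>) * (sqrt B * norm (abs_l2 d))"
    if d: "square_integrable d" "square_integrable (flat d)" and s: "s \<in> L" for d s
  proof -
    have dm [measurable]: "d \<in> borel_measurable borel" by (rule square_integrable_measurable[OF d(1)])
    \<comment> \<open>Truncating \<open>d\<close> to \<open>E\<close> leaves the coefficient
      unchanged at points of \<open>L\<close>, and on \<open>E\<close> the involution multiplies
      norms by at most \<open>sqrt B\<close>.\<close>
    define k where "k = flat (\<lambda>u. indicator E u * d u)"
    have km: "k \<in> borel_measurable borel" unfolding k_def by (rule flat_measurable) measurable
    have "(\<integral>\<^sup>+u. ennreal ((cmod (k u))\<^sup>2) \<partial>haar)
        = (\<integral>\<^sup>+u. ennreal (inverse (modular u) * (cmod (indicator E u * d u))\<^sup>2) \<partial>haar)"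
      unfolding k_def by (rule nn_integral_flat) measurable
    also have "\<dots> \<le> (\<integral>\<^sup>+u. ennreal B * ennreal ((cmod (d u))\<^sup>2) \<partial>haar)"
    proof (rule nn_integral_mono)
      fix u
      show "ennreal (inverse (modular u) * (cmod (indicator E u * d u))\<^sup>2) \<le> ennreal B * ennreal ((cmod (d u))\<^sup>2)"
        using B by (cases "u \<in> E") (auto simp: ennreal_mult[symmetric] intro!: ennreal_leI mult_right_mono)
    qed
    also have "\<dots> = ennreal B * ennreal ((norm (abs_l2 d))\<^sup>2)"
      by (subst nn_integral_cmult) (auto simp: nn_integral_square[OF d(1)])
    also have "\<dots> = ennreal ((sqrt B * norm (abs_l2 d))\<^sup>2)"
      using B(1) by (simp add: ennreal_mult[symmetric] power_mult_distrib)
    finally have nk: "(\<integral>\<^sup>+u. ennreal ((cmod (k u))\<^sup>2) \<partial>haar) \<le> ennreal ((sqrt B * norm (abs_l2 d))\<^sup>2)" .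
    then have k: "square_integrable k"
      unfolding square_integrable_iff_nn using km by (auto intro: order_le_less_trans)
    have "(norm (abs_l2 k))\<^sup>2 \<le> (sqrt B * norm (abs_l2 d))\<^sup>2"
      using nk by (simp add: nn_integral_square[OF k] ennreal_le_iff)
    then have nk': "norm (abs_l2 k) \<le> sqrt B * norm (abs_l2 d)"
      by (rule power2_le_imp_le) (use B(1) in simp)
    have "voice_transform left_regular (abs_l2 (flat d)) (abs_l2 \<phi>) s = voice_transform left_regular (abs_l2 k) (abs_l2 \<phi>) s"
      unfolding voice_left_regular[OF sq(1) d(2)] voice_left_regular[OF sq(1) k]
    proof (rule Bochner_Integration.integral_cong[OF refl])
      fix t
      show "\<phi> t * cnj (flat d (- s + t)) = \<phi> t * cnj (k (- s + t))"
        using K(2)[of t] inE[of t s] s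
        by (cases "t \<in> K") (auto simp: k_def flat_def minus_add)
    qed
    also have "cmod \<dots> \<le> norm (abs_l2 \<phi>) * norm (left_regular s (abs_l2 k))"
      unfolding voice_transform_def by (rule cinner_Cauchy_Schwarz)
    also have "\<dots> \<le> norm (abs_l2 \<phi>) * (sqrt B * norm (abs_l2 d))"
      using nk' by (simp add: mult_left_mono)
    finally show ?thesis .
  qed
  define lhs where "lhs x = (\<integral>t. \<phi> t * cinner (left_regular t x) (abs_l2 g) \<partial>haar)" for x
  define rhs where "rhs x = (\<integral>s. voice_transform left_regular x (abs_l2 \<phi>) s * cnj (g s) \<partial>haar)" for x
  note int_l = left_coefficient_integrable[OF \<phi> g]
  have cg: "csupp (\<lambda>s. cnj (g s))" by (rule csupp_compose[OF g]) (auto intro!: continuous_intros)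
  have int_r: "integrable haar (\<lambda>s. voice_transform left_regular x (abs_l2 \<phi>) s * cnj (g s))" for x
    unfolding voice_transform_def
    by (intro csupp_integrable csupp_mult(2) cg csupp_coefficient_continuous \<phi>)
  have lhs_diff: "lhs x - lhs y = lhs (x - y)" for x y
    unfolding lhs_def
    by (subst Bochner_Integration.integral_diff[symmetric, OF int_l int_l])
       (simp add: left_regular_diff cinner_diff_left right_diff_distrib)
  have rhs_diff: "rhs x - rhs y = rhs (x - y)" for x y
    unfolding rhs_def voice_transform_def
    by (subst Bochner_Integration.integral_diff[symmetric, OF int_r[unfolded voice_transform_def] int_r[unfolded voice_transform_def]])
       (simp add: left_regular_diff cinner_diff_right left_diff_distrib)
  define I\<phi> where "I\<phi> = (\<integral>t. cmod (\<phi> t) \<partial>haar)"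
  define Ig where "Ig = (\<integral>t. cmod (g t) \<partial>haar)"
  have int_n: "integrable haar (\<lambda>t. cmod (\<phi> t))" "integrable haar (\<lambda>t. cmod (g t))"
    using csupp_integrable[OF \<phi>] csupp_integrable[OF g] by simp_all
  have lhs_le: "cmod (lhs x) \<le> I\<phi> * norm x * norm (abs_l2 g)" for x
  proof -
    have "cmod (lhs x) \<le> (\<integral>t. cmod (\<phi> t) * (norm x * norm (abs_l2 g)) \<partial>haar)"
      unfolding lhs_def
    proof (rule norm_integral_le[OF int_l])
      fix t
      show "cmod (\<phi> t * cinner (left_regular t x) (abs_l2 g)) \<le> cmod (\<phi> t) * (norm x * norm (abs_l2 g))"
        using cinner_Cauchy_Schwarz[of "left_regular t x" "abs_l2 g"]
        by (simp add: norm_mult mult_left_mono)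
    qed (use int_n in simp)
    also have "\<dots> = I\<phi> * norm x * norm (abs_l2 g)" by (simp add: I\<phi>_def mult.assoc)
    finally show ?thesis .
  qed
  \<comment> \<open>The bound involves the norm of \<open>d\<close> and not that of
    \<open>flat d\<close>, so it is enough to approximate \<open>h\<close> itself in
    \<open>L\<^sup>2\<close>.\<close>
  have rhs_le: "cmod (rhs (abs_l2 (flat d))) \<le> norm (abs_l2 \<phi>) * (sqrt B * norm (abs_l2 d)) * Ig"
    if d: "square_integrable d" "square_integrable (flat d)" for d
  proof -
    have "cmod (rhs (abs_l2 (flat d))) \<le> (\<integral>s. norm (abs_l2 \<phi>) * (sqrt B * norm (abs_l2 d)) * cmod (g s) \<partial>haar)"
      unfolding rhs_def
    proof (rule norm_integral_le[OF int_r])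
      fix s
      show "cmod (voice_transform left_regular (abs_l2 (flat d)) (abs_l2 \<phi>) s * cnj (g s))
          \<le> norm (abs_l2 \<phi>) * (sqrt B * norm (abs_l2 d)) * cmod (g s)"
        using bound[OF d, of s] L(2)[of s]
        by (cases "s \<in> L") (simp_all add: norm_mult mult_right_mono)
    qed (use int_n in simp)
    then show ?thesis by (simp add: Ig_def)
  qed
  have csupp_case: "lhs (abs_l2 p) = rhs (abs_l2 (flat p))" if p: "csupp p" for p
  proof -
    note fp = csupp_flat[OF p]
    have sp: "square_integrable p" "square_integrable (flat p)"
      using p fp by (simp_all add: csupp_square_integrable)
    have "lhs (abs_l2 p) = (\<integral>t. (\<integral>s. \<phi> t * p (- t + s) * cnj (g s) \<partial>haar) \<partial>haar)"
      unfolding lhs_def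
      by (simp add: left_regular_abs_l2 sp sq cinner_abs_l2 square_integrable_translate mult.assoc)
    also have "\<dots> = (\<integral>s. (\<integral>t. \<phi> t * p (- t + s) * cnj (g s) \<partial>haar) \<partial>haar)"
      by (rule kernel_Fubini[OF \<phi> cg p]) (intro continuous_intros)
    also have "\<dots> = rhs (abs_l2 (flat p))"
      unfolding rhs_def voice_left_regular[OF sq(1) sp(2)] by (simp add: flat_def minus_add)
    finally show ?thesis .
  qed
  obtain p where p: "\<And>n. csupp (p n)" "(\<lambda>n. abs_l2 (p n)) \<longlonglongrightarrow> abs_l2 h"
    by (rule csupp_dense[of "abs_l2 h"], rule that) auto
  define M where "M = I\<phi> * norm (abs_l2 g) + norm (abs_l2 \<phi>) * sqrt B * Ig"
  have le: "cmod (lhs (abs_l2 h) - rhs (abs_l2 (flat h))) \<le> M * norm (abs_l2 h - abs_l2 (p n))" for n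
  proof -
    have sp: "square_integrable (p n)" "square_integrable (flat (p n))"
      using csupp_flat[OF p(1)] p(1) by (simp_all add: csupp_square_integrable)
    define d where "d s = h s - p n s" for s
    have fd: "flat d = (\<lambda>s. flat h s - flat (p n) s)" by (simp add: d_def flat_def fun_eq_iff)
    have d: "square_integrable d" "square_integrable (flat d)"
      unfolding fd by (simp_all add: d_def[abs_def] square_integrable_diff h sp)
    have ad: "abs_l2 h - abs_l2 (p n) = abs_l2 d" "abs_l2 (flat h) - abs_l2 (flat (p n)) = abs_l2 (flat d)"
      unfolding fd by (simp_all add: d_def[abs_def] diff_abs_l2 h sp)
    have "lhs (abs_l2 h) - rhs (abs_l2 (flat h)) = lhs (abs_l2 d) - rhs (abs_l2 (flat d))"
      using csupp_case[OF p(1)] by (simp add: ad[symmetric] lhs_diff[symmetric] rhs_diff[symmetric])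
    also have "cmod \<dots> \<le> cmod (lhs (abs_l2 d)) + cmod (rhs (abs_l2 (flat d)))" by (rule norm_triangle_ineq4)
    also have "\<dots> \<le> M * norm (abs_l2 d)"
      using lhs_le[of "abs_l2 d"] rhs_le[OF d] by (simp add: M_def algebra_simps)
    finally show ?thesis by (simp add: ad)
  qed
  have "(\<lambda>n. M * norm (abs_l2 h - abs_l2 (p n))) \<longlonglongrightarrow> M * norm (abs_l2 h - abs_l2 h)"
    by (intro tendsto_intros p)
  then have "cmod (lhs (abs_l2 h) - rhs (abs_l2 (flat h))) \<le> M * norm (abs_l2 h - abs_l2 h)"
    by (rule LIMSEQ_le_const) (use le in blast)
  then show ?thesis by (simp add: lhs_def rhs_def)
qed

section \<open>Square-integrable irreducible subrepresentations\<close>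

text \<open>Invariance of \<open>K\<close> under \<open>U\<close> and its adjoint \<open>V\<close>
  makes the orthogonal complement invariant too.\<close>

lemma orth_proj_commute:
  assumes K: "closed_csubspace K" and U: "\<And>x. x \<in> K \<Longrightarrow> U x \<in> K" "\<And>x. x \<in> K \<Longrightarrow> V x \<in> K"
    and add: "\<And>x y. U (x - y) = U x - U y" and adj: "\<And>x y. cinner (U x) y = cinner x (V y)"
  shows "orth_proj K (U x) = U (orth_proj K x)"
proof (rule orth_proj_unique[OF K])
  show "U (orth_proj K x) \<in> K" by (intro U orth_proj_in[OF K])
  fix y assume "y \<in> K"
  then have "cinner (x - orth_proj K x) (V y) = 0" by (intro cinner_orth_proj[OF K] U)
  then show "inner (U x - U (orth_proj K x)) y = 0"
    by (simp add: inner_eq_Re_cinner add[symmetric] adj)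
qed

lemma voice_add: "voice_transform \<pi> \<eta> (x + y) s = voice_transform \<pi> \<eta> x s + voice_transform \<pi> \<eta> y s"
  by (simp add: voice_transform_def cinner_add_left)

lemma voice_scaleC: "voice_transform \<pi> \<eta> (a *\<^sub>C x) s = a * voice_transform \<pi> \<eta> x s"
  by (simp add: voice_transform_def cinner_scaleC_left)

lemma voice_left_regular_translate:
  "voice_transform left_regular \<eta> (left_regular t x) s = voice_transform left_regular \<eta> x (- t + s)"
  by (simp add: voice_transform_def cinner_left_regular_left left_regular_comp)

lemma voice_scaleR_right:
  "voice_transform left_regular (r *\<^sub>R \<eta>) x s = of_real r * voice_transform left_regular \<eta> x s"
  by (simp add: voice_transform_def scaleR_scaleC left_regular_scaleC cinner_scaleC_right)

lemma voice_limit: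
  assumes "x \<longlonglongrightarrow> y"
  shows "(\<lambda>n. voice_transform \<pi> \<eta> (x n) s) \<longlonglongrightarrow> voice_transform \<pi> \<eta> y s"
  unfolding voice_transform_def by (intro tendsto_intros assms)

text \<open>The vector \<open>h\<close> is a parameter tied to \<open>f\<close> by an equation, so
  that a vector fixed by the involution can be inserted for both.\<close>

context
  fixes H :: "'g::locally_compact_group l2 set" and f h :: "'g l2"
  assumes inv: "invariant_subspace left_regular H" and irr: "irreducible_on left_regular H"
    and f: "f \<in> H" "f \<noteq> 0" "f \<in> flat_domain"
    and h_def: "h = abs_l2 (flat (rep_l2 f))"
begin

lemma subrep_closed: "closed_csubspace H" and subrep_invariant: "x \<in> H \<Longrightarrow> left_regular s x \<in> H"
  using inv by (auto simp: invariant_subspace_def)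

lemma flat_f: "square_integrable (flat (rep_l2 f))"
  using f(3) by (simp add: flat_domain_iff)

lemma voice_f_proj: "voice_transform left_regular f (orth_proj H x) = voice_transform left_regular f x"
  by (simp add: voice_transform_def fun_eq_iff cinner_orth_proj_left[OF subrep_closed] subrep_invariant f(1))

text \<open>The coefficient is \<phi> * h, the average of the translates of \<open>h\<close> with
  weight \<phi>, so its pairing with g is at most the \<open>L\<^sup>1\<close> norm of \<phi> times
  the norms of \<open>h\<close> and g. Thus the coefficient operator of \<open>f\<close> is densely
  defined on \<open>H\<close>.\<close>

lemma voice_f_csupp: 
  assumes \<phi>: "csupp \<phi>"
  shows "square_integrable (voice_transform left_regular f (abs_l2 \<phi>))"
proof (rule square_integrable_by_duality)
  show "continuous_on UNIV (voice_transform left_regular f (abs_l2 \<phi>))"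
    unfolding voice_transform_def by (rule csupp_coefficient_continuous[OF \<phi>])
  fix g :: "'g \<Rightarrow> complex" assume g: "csupp g"
  have "(\<integral>s. voice_transform left_regular f (abs_l2 \<phi>) s * cnj (g s) \<partial>haar)
      = (\<integral>t. \<phi> t * cinner (left_regular t h) (abs_l2 g) \<partial>haar)"
    using kernel_pairing[OF \<phi> g flat_f] by (simp add: square_integrable_rep h_def)
  also have "cmod \<dots> \<le> (\<integral>t. cmod (\<phi> t) * (norm h * norm (abs_l2 g)) \<partial>haar)"
  proof (rule norm_integral_le[OF left_coefficient_integrable[OF \<phi> g]])
    fix t
    show "cmod (\<phi> t * cinner (left_regular t h) (abs_l2 g)) \<le> cmod (\<phi> t) * (norm h * norm (abs_l2 g))"
      using cinner_Cauchy_Schwarz[of "left_regular t h" "abs_l2 g"]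
      by (simp add: norm_mult mult_left_mono)
  qed (use csupp_integrable[OF \<phi>] in simp)
  also have "\<dots> = ((\<integral>t. cmod (\<phi> t) \<partial>haar) * norm h) * norm (abs_l2 g)" by (simp add: mult.assoc)
  finally show "cmod (\<integral>s. voice_transform left_regular f (abs_l2 \<phi>) s * cnj (g s) \<partial>haar)
      \<le> ((\<integral>t. cmod (\<phi> t) \<partial>haar) * norm h) * norm (abs_l2 g)" .
qed

text \<open>The possibly unbounded operator \<open>x \<mapsto> (x | \<lambda>(\<cdot>) f)\<close> on \<open>H\<close> is handled through its closed,
  invariant graph: compressing the projection onto the graph to \<open>H\<close> gives a bounded operator, which is
  scalar by Schur's lemma.\<close>

definition voice_graph :: "('g l2 \<times> 'g l2) set" where
  "voice_graph = {p. fst p \<in> H \<and> square_integrable (voice_transform left_regular f (fst p)) \<and>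
     snd p = abs_l2 (voice_transform left_regular f (fst p))}"

text \<open>Closedness holds because convergence of vectors forces pointwise convergence of their
  coefficients; any \<open>L\<^sup>2\<close> limit must then be the coefficient of the
  limit.\<close>

lemma closed_csubspace_voice_graph: "closed_csubspace voice_graph"
  unfolding closed_csubspace_def
proof (intro conjI ballI allI)
  have z: "voice_transform left_regular f 0 = (\<lambda>_. 0)" by (simp add: voice_transform_def fun_eq_iff)
  show "0 \<in> voice_graph"
    by (simp add: voice_graph_def z closed_csubspaceD(2)[OF subrep_closed] square_integrable_zero zero_l2_def[symmetric])
  show "p + q \<in> voice_graph" if "p \<in> voice_graph" "q \<in> voice_graph" for p q
  proof -
    have "voice_transform left_regular f (fst (p + q))
        = (\<lambda>s. voice_transform left_regular f (fst p) s + voice_transform left_regular f (fst q) s)"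
      by (simp add: fun_eq_iff voice_add)
    then show ?thesis using that
      by (simp add: voice_graph_def closed_csubspaceD[OF subrep_closed] square_integrable_add add_abs_l2)
  qed
  show "a *\<^sub>C p \<in> voice_graph" if "p \<in> voice_graph" for a p
  proof -
    have "voice_transform left_regular f (fst (a *\<^sub>C p)) = (\<lambda>s. a * voice_transform left_regular f (fst p) s)"
      by (simp add: fun_eq_iff voice_scaleC scaleC_prod_def)
    then show ?thesis using that
      by (simp add: voice_graph_def scaleC_prod_def closed_csubspaceD[OF subrep_closed] square_integrable_scale scaleC_abs_l2)
  qed
  show "closed voice_graph" unfolding closed_sequential_limits
  proof (intro allI impI, elim conjE)
    fix p :: "nat \<Rightarrow> 'g l2 \<times> 'g l2" and q assume p: "\<forall>n. p n \<in> voice_graph" "p \<longlonglongrightarrow> q"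
    have l1: "(\<lambda>n. fst (p n)) \<longlonglongrightarrow> fst q" and l2: "(\<lambda>n. snd (p n)) \<longlonglongrightarrow> snd q"
      using p(2) by (auto intro: tendsto_fst tendsto_snd)
    have sq: "square_integrable (voice_transform left_regular f (fst (p n)))" for n
      using p(1) by (simp add: voice_graph_def)
    have "(\<lambda>n. abs_l2 (voice_transform left_regular f (fst (p n)))) \<longlonglongrightarrow> snd q"
      using p(1) l2 by (simp add: voice_graph_def)
    note lim = square_integrable_limit[OF sq voice_limit[OF l1] this]
    moreover have "fst q \<in> H"
      using closed_sequentially[OF closed_csubspaceD(1)[OF subrep_closed] _ l1] p(1) by (simp add: voice_graph_def)
    ultimately show "q \<in> voice_graph" by (simp add: voice_graph_def)
  qed
qed

lemma voice_graph_invariant: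
  assumes "p \<in> voice_graph"
  shows "(left_regular t (fst p), left_regular t (snd p)) \<in> voice_graph"
proof -
  have v: "voice_transform left_regular f (left_regular t (fst p)) = (\<lambda>s. voice_transform left_regular f (fst p) (- t + s))"
    by (simp add: fun_eq_iff voice_left_regular_translate)
  show ?thesis using assms
    by (simp add: voice_graph_def v subrep_invariant square_integrable_translate left_regular_abs_l2)
qed

lemma voice_graph_csupp:
  "csupp \<phi> \<Longrightarrow> (orth_proj H (abs_l2 \<phi>), abs_l2 (voice_transform left_regular f (abs_l2 \<phi>))) \<in> voice_graph"
  by (simp add: voice_graph_def voice_f_proj voice_f_csupp orth_proj_in[OF subrep_closed])

text \<open>For the operator \<open>T\<close> with graph \<open>voice_graph\<close>, the compressed
  projection \<open>A\<close> is \<open>(1 + T\<^sup>* T)\<^sup>-\<^sup>1\<close> on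
  \<open>H\<close>. Once it is a nonzero scalar, every vector of \<open>H\<close> occurs as a first
  component in the graph, so \<open>T\<close> is everywhere defined.\<close>

lemma voice_f_isometry:
  "\<exists>k>0. (\<forall>x. square_integrable (voice_transform left_regular f x)) \<and>
     (\<forall>x\<in>H. \<forall>y\<in>H. cinner (abs_l2 (voice_transform left_regular f x)) (abs_l2 (voice_transform left_regular f y))
        = of_real k * cinner x y)"
proof -
  let ?V = "voice_transform left_regular f"
  let ?\<Gamma> = voice_graph
  note \<Gamma> = closed_csubspace_voice_graph
  define A where "A y = fst (orth_proj ?\<Gamma> (orth_proj H y, 0))" for y
  have bH: "bounded_linear (orth_proj H)" and b\<Gamma>: "bounded_linear (orth_proj ?\<Gamma>)"
    by (rule bounded_op_on_UNIV[OF bounded_op_orth_proj[OF subrep_closed]],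
        rule bounded_op_on_UNIV[OF bounded_op_orth_proj[OF \<Gamma>]])
  have A_op: "bounded_op_on UNIV A"
  proof (rule bounded_op_on_UNIVI)
    show "bounded_linear A" unfolding A_def
      by (intro bounded_linear_compose[OF bounded_linear_fst] bounded_linear_compose[OF b\<Gamma>]
          bounded_linear_Pair bH bounded_linear_zero)
    show "A (a *\<^sub>C x) = a *\<^sub>C A x" for a x
    proof -
      have eq: "(orth_proj H (a *\<^sub>C x), 0) = a *\<^sub>C (orth_proj H x, 0 :: 'g l2)"
        by (simp add: scaleC_prod_def orth_proj_scaleC[OF subrep_closed])
      show ?thesis unfolding A_def eq orth_proj_scaleC[OF \<Gamma>] by (simp add: scaleC_prod_def)
    qed
  qed
  have A_H: "A x \<in> H" for x
    using orth_proj_in[OF \<Gamma>, of "(orth_proj H x, 0)"] by (simp add: A_def voice_graph_def)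
  have A_cinner: "cinner (A x) y = cinner (orth_proj ?\<Gamma> (orth_proj H x, 0)) (orth_proj H y, 0)" for x y
  proof -
    have "cinner (A x) y = cinner (A x) (orth_proj H y)"
      by (rule cinner_orth_proj_right[OF subrep_closed A_H, symmetric])
    then show ?thesis by (simp add: cinner_prod_def A_def)
  qed
  have A_sym: "cinner (A x) y = cinner x (A y)" for x y
  proof -
    have "cinner (A x) y = cinner (orth_proj H x, 0) (orth_proj ?\<Gamma> (orth_proj H y, 0))"
      unfolding A_cinner by (rule orth_proj_sym[OF \<Gamma>])
    also have "\<dots> = cnj (cinner (A y) x)" unfolding A_cinner by (rule cinner_commute)
    also have "\<dots> = cinner x (A y)" by (rule cinner_commute[symmetric])
    finally show ?thesis .
  qed
  have A_comm: "A (left_regular s x) = left_regular s (A x)" if x: "x \<in> H" for s x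
  proof -
    \<comment> \<open>The diagonal action on pairs preserves the graph, so the projection onto the
      graph commutes with it.\<close>
    define U where "U t p = (left_regular t (fst p), left_regular t (snd p))" for t and p :: "'g l2 \<times> 'g l2"
    have "orth_proj ?\<Gamma> (U s (x, 0)) = U s (orth_proj ?\<Gamma> (x, 0))"
      by (rule orth_proj_commute[OF \<Gamma>, of _ "U (- s)"])
         (auto simp: U_def voice_graph_invariant left_regular_diff cinner_prod_def cinner_left_regular_left)
    moreover have "left_regular s 0 = 0" using left_regular_scaleC[of s 0 0] by simp
    ultimately show ?thesis using x subrep_invariant[OF x] by (simp add: A_def U_def orth_proj_id[OF subrep_closed])
  qed
  have "inner (A x) y = inner x (A y)" for x y by (simp add: inner_eq_Re_cinner A_sym)
  then have "\<exists>c. \<forall>x\<in>H. A x = c *\<^sub>R x"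
    using A_H A_comm by (intro Schur_selfadjoint[OF subrep_closed irr left_regular_unitary[OF inv] A_op])
  then obtain c where c: "\<forall>x\<in>H. A x = c *\<^sub>R x" ..
  have Q: "orth_proj ?\<Gamma> (x, 0) = (c *\<^sub>R x, abs_l2 (?V (c *\<^sub>R x)))" "square_integrable (?V (c *\<^sub>R x))"
    if x: "x \<in> H" for x
  proof -
    have "orth_proj ?\<Gamma> (x, 0) \<in> ?\<Gamma>" by (rule orth_proj_in[OF \<Gamma>])
    moreover have "fst (orth_proj ?\<Gamma> (x, 0)) = c *\<^sub>R x"
      using bspec[OF c x] x by (simp add: A_def orth_proj_id[OF subrep_closed])
    ultimately show "orth_proj ?\<Gamma> (x, 0) = (c *\<^sub>R x, abs_l2 (?V (c *\<^sub>R x)))" "square_integrable (?V (c *\<^sub>R x))"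
      by (auto simp: voice_graph_def prod_eq_iff)
  qed
  \<comment> \<open>If \<open>c\<close> were zero, \<open>(f, 0)\<close> would be orthogonal to the
    graph, and hence \<open>f\<close> to all compactly supported functions.\<close>
  have c0: "c \<noteq> 0"
  proof
    assume "c = 0"
    moreover have "?V 0 = (\<lambda>_. 0)" by (simp add: voice_transform_def fun_eq_iff)
    ultimately have Q0: "orth_proj ?\<Gamma> (f, 0) = 0" using Q(1)[OF f(1)]
      by (simp add: zero_l2_def[symmetric] zero_prod_def)
    have "cinner f (abs_l2 \<phi>) = 0" if \<phi>: "csupp \<phi>" for \<phi>
    proof -
      have "cinner ((f, 0) - orth_proj ?\<Gamma> (f, 0)) (orth_proj H (abs_l2 \<phi>), abs_l2 (?V (abs_l2 \<phi>))) = 0"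
        by (rule cinner_orth_proj[OF \<Gamma> voice_graph_csupp[OF \<phi>]])
      then show ?thesis by (simp add: Q0 cinner_prod_def cinner_orth_proj_right[OF subrep_closed f(1)])
    qed
    then have "f = 0" by (rule orthogonal_csupp_zero)
    then show False using f(2) by simp
  qed
  have sq_H: "square_integrable (?V x)" if x: "x \<in> H" for x
  proof -
    have eq: "?V x = (\<lambda>s. of_real (1 / c) * ?V (c *\<^sub>R x) s)"
      using c0 by (simp add: fun_eq_iff scaleR_scaleC voice_scaleC)
    show ?thesis unfolding eq by (rule square_integrable_scale[OF Q(2)[OF x]])
  qed
  have sq: "square_integrable (?V x)" for x
    using sq_H[OF orth_proj_in[OF subrep_closed], of x] by (simp add: voice_f_proj)
  \<comment> \<open>Solves \<open>c = 1 / (1 + k)\<close>; pairing the projection of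
    \<open>(x, 0)\<close> with a point of the graph is this relation in weak form.\<close>
  define k where "k = (1 - c) / c"
  have iso: "cinner (abs_l2 (?V x)) (abs_l2 (?V y)) = of_real k * cinner x y" if xy: "x \<in> H" "y \<in> H" for x y
  proof -
    have y: "(y, abs_l2 (?V y)) \<in> ?\<Gamma>" using xy(2) sq by (simp add: voice_graph_def)
    have "abs_l2 (?V (c *\<^sub>R x)) = of_real c *\<^sub>C abs_l2 (?V x)"
      by (simp add: scaleC_abs_l2 sq scaleR_scaleC voice_scaleC[abs_def])
    then have "cinner x y = of_real c * cinner x y + of_real c * cinner (abs_l2 (?V x)) (abs_l2 (?V y))"
      using cinner_orth_proj_left[OF \<Gamma> y, of "(x, 0)"]
      by (simp add: Q(1)[OF xy(1)] cinner_prod_def cinner_scaleR_left cinner_scaleC_left)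
    then show ?thesis using c0 by (simp add: k_def field_simps)
  qed
  have "0 \<le> k"
  proof -
    have "complex_of_real ((norm (abs_l2 (?V f)))\<^sup>2) = of_real (k * (norm f)\<^sup>2)"
      using iso[OF f(1) f(1)] by (simp add: cinner_self)
    then have "(norm (abs_l2 (?V f)))\<^sup>2 = k * (norm f)\<^sup>2" by (simp only: of_real_eq_iff)
    then have "0 \<le> k * (norm f)\<^sup>2" by (metis zero_le_power2)
    then show ?thesis using f(2) by (simp add: zero_le_mult_iff)
  qed
  \<comment> \<open>Otherwise all coefficients against \<open>f\<close> would vanish, and the
    coefficient of \<phi> at the identity is the inner product of \<phi> with
    \<open>f\<close>.\<close>
  moreover have "k \<noteq> 0"
  proof
    assume k: "k = 0"
    have "cinner f (abs_l2 \<phi>) = 0" if \<phi>: "csupp \<phi>" for \<phi>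
    proof -
      have "cinner (abs_l2 (?V (orth_proj H (abs_l2 \<phi>)))) (abs_l2 (?V (orth_proj H (abs_l2 \<phi>)))) = 0"
        using iso[OF orth_proj_in[OF subrep_closed] orth_proj_in[OF subrep_closed]] by (simp add: k)
      then have "abs_l2 (?V (abs_l2 \<phi>)) = abs_l2 (\<lambda>_. 0)"
        by (simp add: voice_f_proj zero_l2_def[symmetric])
      then have "AE s in haar. ?V (abs_l2 \<phi>) s = 0"
        by (rule abs_l2_eqD[OF sq square_integrable_zero])
      then have "?V (abs_l2 \<phi>) 0 = 0"
        by (intro continuous_AE_zero) (simp_all add: voice_transform_def csupp_coefficient_continuous[OF \<phi>])
      then have "cinner (abs_l2 \<phi>) f = 0" by (simp add: voice_transform_def)
      then show ?thesis by (metis cinner_commute complex_cnj_zero)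
    qed
    then have "f = 0" by (rule orthogonal_csupp_zero)
    then show False using f(2) by simp
  qed
  ultimately show ?thesis using sq iso by (intro exI[of _ k]) auto
qed

text \<open>With \<open>T x = (x | \<lambda>(\<cdot>) f)\<close> one has \<open>T\<^sup>* T = k\<close> on \<open>H\<close> and \<open>T\<^sup>* y = (y | \<lambda>(\<cdot>) h)\<close>, hence
  \<open>k \<psi> = T\<^sup>* T \<psi> = (T \<psi> | \<lambda>(\<cdot>) h) = (\<psi> | \<lambda>(\<cdot>) T\<^sup>* h)\<close> on \<open>H\<close>.\<close>

lemma reproducing_vector_exists:
  "\<exists>k>0. \<exists>e\<in>H. (\<forall>x\<in>H. square_integrable (voice_transform left_regular e x) \<and>
      abs_l2 (voice_transform left_regular e x) = x) \<and>
    square_integrable (voice_transform left_regular h h) \<and>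
    k *\<^sub>R e = abs_l2 (voice_transform left_regular h h)"
proof -
  let ?V = "voice_transform left_regular"
  obtain k where k: "0 < k" and sq: "\<And>x. square_integrable (?V f x)"
    and iso: "\<And>x y. x \<in> H \<Longrightarrow> y \<in> H \<Longrightarrow> cinner (abs_l2 (?V f x)) (abs_l2 (?V f y)) = of_real k * cinner x y"
    using voice_f_isometry by blast
  define T where "T x = abs_l2 (?V f x)" for x
  have T_proj: "T (orth_proj H x) = T x" for x by (simp add: T_def voice_f_proj)
  have T_add: "T (x + y) = T x + T y" for x y
    by (simp add: T_def add_abs_l2 sq voice_add[abs_def])
  have T_scale: "T (a *\<^sub>C x) = a *\<^sub>C T x" for a x
    by (simp add: T_def scaleC_abs_l2 sq voice_scaleC[abs_def])
  have T_trans: "T (left_regular t x) = left_regular t (T x)" for t x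
    by (simp add: T_def left_regular_abs_l2 sq voice_left_regular_translate[abs_def])
  have T_norm: "norm (T x) \<le> sqrt k * norm x" for x
  proof -
    have "complex_of_real ((norm (T (orth_proj H x)))\<^sup>2) = of_real (k * (norm (orth_proj H x))\<^sup>2)"
      using iso[OF orth_proj_in[OF subrep_closed] orth_proj_in[OF subrep_closed], of x x] by (simp add: cinner_self T_def)
    then have "(norm (T x))\<^sup>2 = k * (norm (orth_proj H x))\<^sup>2"
      unfolding T_proj by (simp only: of_real_eq_iff)
    also have "\<dots> \<le> k * (norm x)\<^sup>2"
      using k norm_orth_proj_le[OF subrep_closed, of x] by (intro mult_left_mono power_mono) auto
    also have "\<dots> = (sqrt k * norm x)\<^sup>2" using k by (simp add: power_mult_distrib)
    finally show ?thesis by (rule power2_le_imp_le) (use k in simp)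
  qed
  have "bounded_op_on UNIV T"
    using T_add T_scale T_norm by (auto simp: bounded_op_on_def clinear_on_def)
  then obtain A where A_op: "bounded_op_on UNIV A" and A: "\<And>x y. cinner (T x) y = cinner x (A y)"
    using adjoint_exists by blast
  \<comment> \<open>\<open>T\<close> kills the complement of \<open>H\<close>, so its adjoint maps
    into \<open>H\<close>.\<close>
  have A_H: "A y \<in> H" for y
  proof -
    have "A y = orth_proj H (A y)"
      by (rule cinner_ext_right) (metis A T_proj orth_proj_sym[OF subrep_closed])
    then show ?thesis by (metis orth_proj_in[OF subrep_closed])
  qed
  have AT: "A (T x) = k *\<^sub>R x" if x: "x \<in> H" for x
  proof (rule cinner_ext_right)
    fix z
    have "cinner z (A (T x)) = cinner (T (orth_proj H z)) (T x)" by (simp add: A[symmetric] T_proj)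
    also have "\<dots> = of_real k * cinner (orth_proj H z) x"
      unfolding T_def by (rule iso[OF orth_proj_in[OF subrep_closed] x])
    finally show "cinner z (A (T x)) = cinner z (k *\<^sub>R x)"
      by (simp add: cinner_scaleR_right cinner_orth_proj_left[OF subrep_closed x])
  qed
  have A_csupp: "square_integrable (?V h (abs_l2 \<phi>)) \<and> A (abs_l2 \<phi>) = abs_l2 (?V h (abs_l2 \<phi>))"
    if \<phi>: "csupp \<phi>" for \<phi>
  proof -
    \<comment> \<open>The adjoint is known only weakly, so it is compared with the coefficient
      against \<open>h\<close> through pairings with compactly supported functions, where the Fubini
      identity is available.\<close>
    have pair: "cinner (A (abs_l2 \<phi>)) (abs_l2 g) = (\<integral>s. ?V h (abs_l2 \<phi>) s * cnj (g s) \<partial>haar)"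
      if g: "csupp g" for g
    proof -
      have sg: "square_integrable \<phi>" "square_integrable g" using \<phi> g by (simp_all add: csupp_square_integrable)
      have "cinner (A (abs_l2 \<phi>)) (abs_l2 g) = cinner (abs_l2 \<phi>) (T (abs_l2 g))"
        by (metis A cinner_commute)
      also have "\<dots> = (\<integral>t. \<phi> t * cnj (?V f (abs_l2 g) t) \<partial>haar)"
        unfolding T_def by (rule cinner_abs_l2[OF sg(1) sq])
      also have "\<dots> = (\<integral>t. \<phi> t * cinner (left_regular t f) (abs_l2 g) \<partial>haar)"
        by (simp add: voice_transform_def flip: cinner_commute)
      also have "\<dots> = (\<integral>s. ?V h (abs_l2 \<phi>) s * cnj (g s) \<partial>haar)"
        using kernel_pairing[OF \<phi> g square_integrable_rep flat_f] by (simp add: h_def)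
      finally show ?thesis .
    qed
    have sqh: "square_integrable (?V h (abs_l2 \<phi>))"
    proof (rule square_integrable_by_duality)
      show "continuous_on UNIV (?V h (abs_l2 \<phi>))"
        unfolding voice_transform_def by (rule csupp_coefficient_continuous[OF \<phi>])
      show "cmod (\<integral>s. ?V h (abs_l2 \<phi>) s * cnj (g s) \<partial>haar) \<le> norm (A (abs_l2 \<phi>)) * norm (abs_l2 g)"
        if "csupp g" for g
        unfolding pair[OF that, symmetric] by (rule cinner_Cauchy_Schwarz)
    qed
    have "A (abs_l2 \<phi>) - abs_l2 (?V h (abs_l2 \<phi>)) = 0"
    proof (rule orthogonal_csupp_zero)
      fix g :: "'g \<Rightarrow> complex" assume g: "csupp g"
      show "cinner (A (abs_l2 \<phi>) - abs_l2 (?V h (abs_l2 \<phi>))) (abs_l2 g) = 0"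
        by (simp add: cinner_diff_left pair[OF g] cinner_abs_l2 sqh csupp_square_integrable[OF g])
    qed
    then show ?thesis using sqh by simp
  qed
  \<comment> \<open>Both sides pass to \<open>L\<^sup>2\<close> limits: the adjoint is bounded, and
    coefficients converge pointwise.\<close>
  have A_voice: "square_integrable (?V h y)" "abs_l2 (?V h y) = A y" for y
  proof -
    obtain \<phi> where \<phi>: "\<And>n. csupp (\<phi> n)" "(\<lambda>n. abs_l2 (\<phi> n)) \<longlonglongrightarrow> y"
      by (rule csupp_dense[of y], rule that) auto
    have "(\<lambda>n. A (abs_l2 (\<phi> n))) \<longlonglongrightarrow> A y"
      by (rule bounded_linear.tendsto[OF bounded_op_on_UNIV(1)[OF A_op] \<phi>(2)])
    then have "(\<lambda>n. abs_l2 (?V h (abs_l2 (\<phi> n)))) \<longlonglongrightarrow> A y"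
      using A_csupp[OF \<phi>(1)] by simp
    from square_integrable_limit[OF _ voice_limit[OF \<phi>(2)] this]
    show "square_integrable (?V h y)" "abs_l2 (?V h y) = A y"
      using A_csupp[OF \<phi>(1)] by simp_all
  qed
  define e where "e = (1 / k) *\<^sub>R A h"
  have e: "e \<in> H" unfolding e_def by (intro closed_csubspaceD[OF subrep_closed] A_H)
  have rep: "square_integrable (?V e x) \<and> abs_l2 (?V e x) = x" if x: "x \<in> H" for x
  proof -
    \<comment> \<open>\<open>T\<close> commutes with translations, so the translation can be shifted
      to \<open>x\<close>, the adjoint taken, and the translation shifted back.\<close>
    have "?V h (T x) s = ?V (A h) x s" for s
    proof -
      have "?V h (T x) s = cinner (T (left_regular (- s) x)) h"
        by (simp add: voice_transform_def cinner_left_regular_right T_trans)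
      also have "\<dots> = ?V (A h) x s"
        by (simp add: A voice_transform_def cinner_left_regular_right)
      finally show ?thesis .
    qed
    then have eq: "?V e x = (\<lambda>s. of_real (1 / k) * ?V h (T x) s)"
      by (simp add: e_def fun_eq_iff voice_scaleR_right)
    have "abs_l2 (?V e x) = of_real (1 / k) *\<^sub>C abs_l2 (?V h (T x))"
      unfolding eq by (rule scaleC_abs_l2[OF A_voice(1), symmetric])
    also have "\<dots> = x" using k by (simp add: A_voice(2) AT[OF x] scaleR_scaleC scaleC_scaleC)
    finally show ?thesis unfolding eq by (simp only: square_integrable_scale[OF A_voice(1)] simp_thms)
  qed
  have "k *\<^sub>R e = abs_l2 (?V h h)" using k by (simp add: e_def A_voice)
  then show ?thesis using k e rep A_voice(1) by (intro exI[of _ k] conjI bexI[of _ e]) auto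
qed

end

subsection \<open>Reproducing vectors and projections\<close>

text \<open>In terms of convolution this says \<open>x * e = x\<close> on \<open>H\<close>, once
  \<open>e\<close> is known to be fixed by the involution. It is the common source of admissibility
  and of membership in \<open>E_prime\<close>.\<close>

definition reproducing :: "'g::locally_compact_group l2 set \<Rightarrow> 'g l2 \<Rightarrow> bool" where
  "reproducing H e \<longleftrightarrow> e \<in> H \<and>
     (\<forall>x\<in>H. square_integrable (voice_transform left_regular e x) \<and>
       abs_l2 (voice_transform left_regular e x) = x)"

lemma reproducing_AE:
  assumes "reproducing H e" "x \<in> H"
  shows "AE s in haar. rep_l2 x s = voice_transform left_regular e x s"
  using assms by (intro abs_l2_eqD) (auto simp: reproducing_def square_integrable_rep)

lemma voice_uminus:
  "voice_transform left_regular x y (- s) = cnj (voice_transform left_regular y x s)"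
  by (simp add: voice_transform_def cinner_left_regular_right[of y] cinner_commute[of x])

lemma flat_voice: "flat (voice_transform left_regular x y) = voice_transform left_regular y x"
  by (simp add: flat_def fun_eq_iff voice_uminus)

lemma reproducing_flat:
  assumes e: "reproducing H e"
  shows "AE s in haar. rep_l2 e s = flat (rep_l2 e) s"
proof -
  have 1: "AE s in haar. rep_l2 e s = voice_transform left_regular e e s"
    using reproducing_AE[OF e] e by (simp add: reproducing_def)
  have "AE s in haar. flat (rep_l2 e) s = voice_transform left_regular e e s"
    using AE_flat_cong[OF 1] by (simp add: flat_voice)
  with 1 show ?thesis by eventually_elim simp
qed

lemma flat_symmetric_l2:
  assumes "AE s in haar. rep_l2 e s = flat (rep_l2 e) s"
  shows "square_integrable (flat (rep_l2 e))" "abs_l2 (flat (rep_l2 e)) = e"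
proof -
  have m: "flat (rep_l2 e) \<in> borel_measurable borel"
    by (intro flat_measurable square_integrable_measurable square_integrable_rep)
  have AE: "AE s in haar. flat (rep_l2 e) s = rep_l2 e s"
    using assms by (rule eventually_mono) simp
  show sq: "square_integrable (flat (rep_l2 e))"
    by (rule square_integrable_AE_cong[OF square_integrable_rep m AE])
  have "abs_l2 (flat (rep_l2 e)) = abs_l2 (rep_l2 e)"
    by (rule abs_l2_cong[OF sq square_integrable_rep AE])
  then show "abs_l2 (flat (rep_l2 e)) = e" by simp
qed

text \<open>Reproducing \<open>e\<close> by means of \<open>e'\<close>, and \<open>e'\<close> by
  means of \<open>e\<close>, gives two coefficients interchanged by the involution, which fixes
  \<open>e'\<close>.\<close>

lemma reproducing_unique:
  assumes e: "reproducing H e" and e': "reproducing H e'"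
  shows "e = e'"
proof -
  have mem: "e \<in> H" "e' \<in> H" using e e' by (simp_all add: reproducing_def)
  have 1: "AE s in haar. rep_l2 e s = voice_transform left_regular e' e s"
    by (rule reproducing_AE[OF e' mem(1)])
  have "AE s in haar. flat (rep_l2 e') s = voice_transform left_regular e' e s"
    using AE_flat_cong[OF reproducing_AE[OF e mem(2)]] by (simp add: flat_voice)
  with 1 reproducing_flat[OF e'] have "AE s in haar. rep_l2 e s = rep_l2 e' s"
    by eventually_elim simp
  then have "abs_l2 (rep_l2 e) = abs_l2 (rep_l2 e')"
    by (intro abs_l2_cong square_integrable_rep)
  then show ?thesis by simp
qed

text \<open>Coefficients against \<open>e\<close> only see the projection onto \<open>H\<close>, so
  right convolution with \<open>e\<close> is that projection; its norm bound 1 gives right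
  boundedness.\<close>

lemma reproducing_E_prime:
  assumes H: "invariant_subspace left_regular H" and e: "reproducing H e" and e0: "e \<noteq> 0"
  shows "e \<in> E_prime"
proof -
  have cH: "closed_csubspace H" and H_inv: "\<And>s x. x \<in> H \<Longrightarrow> left_regular s x \<in> H"
    using H by (auto simp: invariant_subspace_def)
  have eH: "e \<in> H" using e by (simp add: reproducing_def)
  note sym = reproducing_flat[OF e]
  note fl = flat_symmetric_l2[OF sym]
  have conv: "convolution f (rep_l2 e) = voice_transform left_regular e (abs_l2 f)" if "square_integrable f" for f
    using convolution_eq_voice[OF that fl(1)] by (simp add: fl(2))
  have "AE s in haar. rep_l2 e s = convolution (rep_l2 e) (rep_l2 e) s"
    using reproducing_AE[OF e eH] by (simp add: conv square_integrable_rep)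
  moreover have "e \<in> right_bounded"
    unfolding right_bounded_def
  proof (intro CollectI exI[of _ 1] ballI impI)
    fix f :: "'a \<Rightarrow> complex" assume f: "f \<in> Cc" and le: "norm (abs_l2 f) \<le> 1"
    have "convolution f (rep_l2 e) = voice_transform left_regular e (orth_proj H (abs_l2 f))"
      using f by (simp add: conv Cc_iff_csupp csupp_square_integrable voice_transform_def
          cinner_orth_proj_left[OF cH] H_inv eH)
    then have "square_integrable (convolution f (rep_l2 e))"
      "abs_l2 (convolution f (rep_l2 e)) = orth_proj H (abs_l2 f)"
      using e orth_proj_in[OF cH, of "abs_l2 f"] by (simp_all add: reproducing_def)
    then show "square_integrable (convolution f (rep_l2 e)) \<and> norm (abs_l2 (convolution f (rep_l2 e))) \<le> 1"
      using order_trans[OF norm_orth_proj_le[OF cH] le] by simp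
  qed
  ultimately show ?thesis
    using sym e0 fl(1) by (simp add: E_prime_def U_prime_def flat_domain_iff)
qed

lemma E_prime_reproducing:
  assumes inv: "invariant_subspace left_regular H" and irr: "irreducible_on left_regular H"
    and e: "e \<in> H" "e \<in> E_prime"
  shows "reproducing H e"
proof -
  let ?V = "voice_transform left_regular"
  have e0: "e \<noteq> 0" and sym: "AE s in haar. rep_l2 e s = flat (rep_l2 e) s"
    and idem: "AE s in haar. rep_l2 e s = convolution (rep_l2 e) (rep_l2 e) s"
    and fd: "e \<in> flat_domain"
    using e(2) by (auto simp: E_prime_def U_prime_def)
  note fl = flat_symmetric_l2[OF sym]
  obtain k e2 where k: "0 < k" and e2: "reproducing H e2" and sq: "square_integrable (?V e e)"
    and ke2: "k *\<^sub>R e2 = abs_l2 (?V e e)"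
    using reproducing_vector_exists[OF inv irr e(1) e0 fd fl(2)[symmetric]] by (auto simp: reproducing_def)
  have "convolution (rep_l2 e) (rep_l2 e) = ?V e e"
    using convolution_eq_voice[OF square_integrable_rep fl(1)] by (simp add: fl(2))
  then have "abs_l2 (rep_l2 e) = abs_l2 (?V e e)"
    using idem by (intro abs_l2_cong square_integrable_rep sq) simp
  then have k_e2: "k *\<^sub>R e2 = e" by (simp add: ke2)
  \<comment> \<open>Both arguments of the coefficient scale with \<open>k\<close>, so its class is
    \<open>k * k\<close> times \<open>e2\<close>, while by construction it is also \<open>k\<close>
    times \<open>e2\<close>.\<close>
  have "?V e e s = of_real (k * k) * ?V e2 e2 s" for s
    by (simp add: k_e2[symmetric] voice_scaleR_right)
       (simp add: scaleR_scaleC voice_scaleC)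
  then have "?V e e = (\<lambda>s. of_real (k * k) * ?V e2 e2 s)" by blast
  moreover have "square_integrable (?V e2 e2)" "abs_l2 (?V e2 e2) = e2"
    using e2 by (auto simp: reproducing_def)
  ultimately have "e = of_real (k * k) *\<^sub>C e2"
    by (metis ke2 k_e2 scaleC_abs_l2)
  then have "k *\<^sub>R e2 = (k * k) *\<^sub>R e2" by (simp only: k_e2 scaleR_scaleC[symmetric])
  moreover have "e2 \<noteq> 0" using k_e2 e0 by auto
  ultimately have "k = 1" using k by simp
  then show ?thesis using k_e2 e2 by simp
qed

subsection \<open>Admissible vectors\<close>

text \<open>An isometry satisfies \<open>L\<^sup>* L = I\<close>. The adjoint on the subspace is
  obtained by extending \<open>L\<close> by zero on the complement of \<open>H\<close> and
  projecting the resulting adjoint back to \<open>H\<close>.\<close>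

lemma admissibleI:
  fixes H :: "'h::complex_hilbert set"
  assumes H: "closed_csubspace H" and \<eta>: "\<eta> \<in> H"
    and sq: "\<And>x. x \<in> H \<Longrightarrow> square_integrable (voice_transform \<pi> \<eta> x)"
    and iso: "\<And>x y. x \<in> H \<Longrightarrow> y \<in> H \<Longrightarrow> cinner (voice_operator \<pi> \<eta> x) (voice_operator \<pi> \<eta> y) = cinner x y"
  shows "admissible \<pi> H \<eta>"
proof -
  let ?L = "voice_operator \<pi> \<eta>"
  have add: "?L (x + y) = ?L x + ?L y" if "x \<in> H" "y \<in> H" for x y
    using sq that by (simp add: voice_operator_def add_abs_l2 voice_add[abs_def])
  have scale: "?L (a *\<^sub>C x) = a *\<^sub>C ?L x" if "x \<in> H" for a x
    using sq that by (simp add: voice_operator_def scaleC_abs_l2 voice_scaleC[abs_def])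
  have norm: "norm (?L x) = norm x" if "x \<in> H" for x
  proof -
    have "(norm (?L x))\<^sup>2 = (norm x)\<^sup>2" using iso[OF that that] unfolding cinner_self by (simp only: of_real_eq_iff)
    then show ?thesis by (simp add: power2_eq_iff_nonneg)
  qed
  have bL: "bounded_op_on H ?L"
    by (auto simp: bounded_op_on_def clinear_on_def add scale norm intro!: exI[of _ 1])
  have "bounded_op_on UNIV (\<lambda>x. ?L (orth_proj H x))"
    by (auto simp: bounded_op_on_def clinear_on_def orth_proj_add[OF H] orth_proj_scaleC[OF H] add scale
        norm orth_proj_in[OF H] norm_orth_proj_le[OF H] intro!: exI[of _ 1])
  then obtain A where A: "\<And>x y. cinner (?L (orth_proj H x)) y = cinner x (A y)"
    using adjoint_exists by blast
  have adj: "is_adjoint_on H ?L (\<lambda>y. orth_proj H (A y))"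
    unfolding is_adjoint_on_def
    by (metis A H cinner_orth_proj_right orth_proj_id orth_proj_in)
  have "orth_proj H (A (?L x)) = x" if x: "x \<in> H" for x
  proof (rule cinner_ext_right)
    fix z
    have "cinner z (orth_proj H (A (?L x))) = cinner (orth_proj H z) (A (?L x))"
      by (rule orth_proj_sym[OF H, symmetric])
    also have "\<dots> = cinner (orth_proj H z) x"
      using iso[OF orth_proj_in[OF H] x, of z] by (simp add: A[symmetric] orth_proj_id[OF H] orth_proj_in[OF H])
    also have "\<dots> = cinner z x" by (rule cinner_orth_proj_left[OF H x])
    finally show "cinner z (orth_proj H (A (?L x))) = cinner z x" .
  qed
  with adj show ?thesis using \<eta> sq bL by (auto simp: admissible_def)
qed

lemma admissible_isometry:
  assumes "admissible \<pi> H \<eta>" "x \<in> H" "y \<in> H"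
  shows "cinner (voice_operator \<pi> \<eta> x) (voice_operator \<pi> \<eta> y) = cinner x y"
  using assms by (auto simp: admissible_def is_adjoint_on_def)

lemma reproducing_admissible:
  assumes "invariant_subspace left_regular H" "reproducing H e"
  shows "admissible left_regular H e"
  using assms by (intro admissibleI) (auto simp: invariant_subspace_def reproducing_def voice_operator_def)

text \<open>Lets \<open>H \<inter> flat_domain \<noteq> {0}\<close> be read as the existence of a
  nonzero vector: an empty intersection would satisfy it too.\<close>

lemma zero_flat_domain: "(0 :: 'g::locally_compact_group l2) \<in> flat_domain"
proof -
  have "AE s in haar. rep_l2 (0 :: 'g l2) s = 0"
    unfolding zero_l2_def by (rule AE_rep_abs_l2[OF square_integrable_zero])
  from AE_flat_cong[OF this] have AE: "AE s in haar. flat (rep_l2 (0 :: 'g l2)) s = 0"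
    by (simp add: flat_def)
  have m: "flat (rep_l2 (0 :: 'g l2)) \<in> borel_measurable borel"
    by (intro flat_measurable square_integrable_measurable square_integrable_rep)
  show ?thesis
    unfolding flat_domain_iff by (rule square_integrable_AE_cong[OF square_integrable_zero m AE])
qed

lemma subrepresentation_reproducing:
  assumes sub: "subrepresentation left_regular H" and irr: "irreducible_on left_regular H"
    and fd: "H \<inter> flat_domain \<noteq> {0}"
  obtains e where "reproducing H e" "H \<inter> E_prime = {e}"
proof -
  have inv: "invariant_subspace left_regular H" and H0: "H \<noteq> {0}"
    using sub by (auto simp: subrepresentation_def)
  have "0 \<in> H" using inv by (auto simp: invariant_subspace_def closed_csubspace_def)
  then obtain f where f: "f \<in> H" "f \<in> flat_domain" "f \<noteq> 0"
    using fd zero_flat_domain by blast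
  obtain e where e: "reproducing H e"
    using reproducing_vector_exists[OF inv irr f(1,3,2) refl] by (auto simp: reproducing_def)
  have e0: "e \<noteq> 0"
  proof
    assume "e = 0"
    moreover have "left_regular s 0 = 0" for s :: 'a using left_regular_scaleC[of s 0 0] by simp
    ultimately have "voice_transform left_regular e f = (\<lambda>_. 0)" by (simp add: voice_transform_def fun_eq_iff)
    then have "f = 0" using e f(1) by (auto simp: reproducing_def zero_l2_def)
    then show False using f(3) by simp
  qed
  have "x = e" if "x \<in> H" "x \<in> E_prime" for x
    by (rule reproducing_unique[OF E_prime_reproducing[OF inv irr that] e])
  moreover have "e \<in> H" "e \<in> E_prime"
    using e reproducing_E_prime[OF inv e e0] by (simp_all add: reproducing_def)
  ultimately have "H \<inter> E_prime = {e}" by blast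
  then show thesis by (rule that[OF e])
qed

section \<open>Transport along unitary equivalences\<close>

lemma admissible_transport:
  assumes \<pi>: "unitary_representation \<pi> H" and U: "unitary_between H K U"
    and comm: "\<And>s x. x \<in> H \<Longrightarrow> U (\<pi> s x) = left_regular s (U x)"
    and e: "reproducing K e"
  shows "\<exists>\<eta>. admissible \<pi> H \<eta>"
proof -
  have H: "closed_csubspace H" and pi: "\<And>s x. x \<in> H \<Longrightarrow> \<pi> s x \<in> H"
    using \<pi> by (auto simp: unitary_representation_def unitary_between_def bij_betw_def)
  have U_iso: "cinner (U x) (U y) = cinner x y" if "x \<in> H" "y \<in> H" for x y
    using U that by (auto simp: unitary_between_def)
  have UK: "U ` H = K" using U by (auto simp: unitary_between_def bij_betw_def)
  then obtain \<eta> where \<eta>: "\<eta> \<in> H" "U \<eta> = e" using e by (auto simp: reproducing_def)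
  \<comment> \<open>With \<eta> the preimage of \<open>e\<close>, coefficients against \<eta> are
    those against \<open>e\<close> after \<open>U\<close>, so the voice operator of \<eta> agrees
    with \<open>U\<close> on \<open>H\<close>.\<close>
  have v: "voice_transform \<pi> \<eta> x = voice_transform left_regular e (U x)" if x: "x \<in> H" for x
    using U_iso[OF x pi[OF \<eta>(1)]] by (simp add: voice_transform_def fun_eq_iff comm[OF \<eta>(1)] \<eta>(2))
  have "U x \<in> K" if "x \<in> H" for x using UK that by blast
  then have "square_integrable (voice_transform \<pi> \<eta> x)" "voice_operator \<pi> \<eta> x = U x" if "x \<in> H" for x
    using e that by (simp_all add: v voice_operator_def reproducing_def)
  then have "admissible \<pi> H \<eta>" by (intro admissibleI[OF H \<eta>(1)]) (simp_all add: U_iso)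
  then show ?thesis by blast
qed

lemma irreducible_transport:
  assumes H: "closed_csubspace H" and U: "unitary_between H K U"
    and comm: "\<And>s x. x \<in> H \<Longrightarrow> U (\<pi> s x) = \<rho> s (U x)" and pi: "\<And>s x. x \<in> H \<Longrightarrow> \<pi> s x \<in> H"
    and irr: "irreducible_on \<pi> H"
  shows "irreducible_on \<rho> K"
  unfolding irreducible_on_def
proof (intro allI impI)
  fix L assume L: "L \<subseteq> K" "invariant_subspace \<rho> L"
  have UK: "U ` H = K" and inj: "inj_on U H" using U by (auto simp: unitary_between_def bij_betw_def)
  have lin: "U (x + y) = U x + U y" "U (a *\<^sub>C x) = a *\<^sub>C U x" if "x \<in> H" "y \<in> H" for x y a
    using U that by (auto simp: unitary_between_def clinear_on_def)
  have U0: "U 0 = 0" using lin(2)[of 0 0 0] closed_csubspaceD(2)[OF H] by simp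
  have U_diff: "U (x - y) = U x - U y" if "x \<in> H" "y \<in> H" for x y
    using lin(1)[of "x - y" y] that closed_csubspaceD(6)[OF H] by simp
  have cL: "closed_csubspace L" using L(2) by (simp add: invariant_subspace_def)
  define M where "M = {x \<in> H. U x \<in> L}"
  have "closed M" unfolding closed_sequential_limits
  proof (intro allI impI, elim conjE)
    fix x y assume x: "\<forall>n. x n \<in> M" "x \<longlonglongrightarrow> y"
    have y: "y \<in> H" using closed_sequentially[OF closed_csubspaceD(1)[OF H] _ x(2)] x(1) by (simp add: M_def)
    have "norm (U (x n) - U y) = norm (x n - y)" for n
      using unitary_between_norm[OF U, of "x n - y"] x(1) y closed_csubspaceD(6)[OF H]
      by (simp add: M_def U_diff)
    then have lim: "(\<lambda>n. U (x n)) \<longlonglongrightarrow> U y"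
      using x(2) by (simp add: tendsto_iff dist_norm)
    have "U y \<in> L"
      by (rule closed_sequentially[OF closed_csubspaceD(1)[OF cL] _ lim]) (use x(1) in \<open>simp add: M_def\<close>)
    then show "y \<in> M" using y by (simp add: M_def)
  qed
  then have "closed_csubspace M"
    using closed_csubspaceD(2-4)[OF H] closed_csubspaceD(2-4)[OF cL] lin
    by (auto simp: closed_csubspace_def M_def U0)
  moreover have "\<pi> s x \<in> M" if "x \<in> M" for s x
    using that L(2) pi by (simp add: M_def comm invariant_subspace_def)
  ultimately have "M = {0} \<or> M = H"
    using irr by (auto simp: irreducible_on_def invariant_subspace_def M_def)
  moreover have "L = U ` M" using L(1) UK by (auto simp: M_def)
  ultimately show "L = {0} \<or> L = K" using U0 UK by auto
qed

lemma admissible_imp_subrepresentation: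
  fixes \<pi> :: "'g::locally_compact_group \<Rightarrow> 'h::complex_hilbert \<Rightarrow> 'h"
  assumes \<pi>: "unitary_representation \<pi> H" and irr: "irreducible_on \<pi> H" and \<eta>: "admissible \<pi> H \<eta>"
  shows "\<exists>K :: 'g l2 set. subrepresentation left_regular K \<and> irreducible_on left_regular K \<and>
    unitarily_equivalent \<pi> H left_regular K \<and> K \<inter> flat_domain \<noteq> {0}"
proof -
  let ?L = "voice_operator \<pi> \<eta>"
  have H: "closed_csubspace H" and H0: "H \<noteq> {0}" and unit: "\<And>s. unitary_between H H (\<pi> s)"
    and hom: "\<And>s t x. x \<in> H \<Longrightarrow> \<pi> (s + t) x = \<pi> s (\<pi> t x)"
    using \<pi> by (auto simp: unitary_representation_def)
  have pi: "\<pi> s x \<in> H" if "x \<in> H" for s x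
    using unit that by (auto simp: unitary_between_def bij_betw_def)
  have pi_iso: "cinner (\<pi> s x) (\<pi> s y) = cinner x y" if "x \<in> H" "y \<in> H" for s x y
    using unit that by (auto simp: unitary_between_def)
  have \<eta>H: "\<eta> \<in> H" and sq: "\<And>x. x \<in> H \<Longrightarrow> square_integrable (voice_transform \<pi> \<eta> x)"
    and lin: "clinear_on H ?L"
    using \<eta> by (auto simp: admissible_def bounded_op_on_def)
  note iso = admissible_isometry[OF \<eta>]
  have v_trans: "voice_transform \<pi> \<eta> (\<pi> t x) s = voice_transform \<pi> \<eta> x (- t + s)" if x: "x \<in> H" for t x s
    using pi_iso[OF x pi[OF \<eta>H], of t "- t + s"] hom[OF \<eta>H, of t "- t + s"]
    by (simp add: voice_transform_def)
  have comm: "?L (\<pi> t x) = left_regular t (?L x)" if x: "x \<in> H" for t x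
  proof -
    have v: "voice_transform \<pi> \<eta> (\<pi> t x) = (\<lambda>s. voice_transform \<pi> \<eta> x (- t + s))"
      by (rule ext) (rule v_trans[OF x])
    show ?thesis unfolding voice_operator_def v
      by (rule left_regular_abs_l2[OF sq[OF x], symmetric])
  qed
  define K where "K = ?L ` H"
  have inj: "inj_on ?L H"
  proof (rule inj_onI)
    fix x y assume xy: "x \<in> H" "y \<in> H" "?L x = ?L y"
    have "cinner (x - y) z = 0" if z: "z \<in> H" for z
      using iso[OF xy(1) z] iso[OF xy(2) z] xy(3) by (simp add: cinner_diff_left)
    from this[of "x - y"] show "x = y" using xy closed_csubspaceD(6)[OF H] by simp
  qed
  have U: "unitary_between H K ?L"
    using lin inj iso by (auto simp: unitary_between_def bij_betw_def K_def)
  have add: "?L (x + y) = ?L x + ?L y" if "x \<in> H" "y \<in> H" for x y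
    using lin that by (auto simp: clinear_on_def)
  have scale: "?L (a *\<^sub>C x) = a *\<^sub>C ?L x" if "x \<in> H" for a x
    using lin that by (auto simp: clinear_on_def)
  have L0: "?L 0 = 0" using scale[of 0 0] closed_csubspaceD(2)[OF H] by simp
  have bl: "bounded_linear (\<lambda>x. ?L (orth_proj H x))"
    by (rule bounded_op_on_UNIV(1))
       (auto simp: bounded_op_on_def clinear_on_def orth_proj_add[OF H] orth_proj_scaleC[OF H] add scale
        orth_proj_in[OF H] unitary_between_norm[OF U] norm_orth_proj_le[OF H] intro!: exI[of _ 1])
  \<comment> \<open>An isometric image of a complete space is complete, hence closed; the projection
    makes the map linear on the whole space.\<close>
  have "complete ((\<lambda>x. ?L (orth_proj H x)) ` H)"
    by (rule complete_isometric_image[OF zero_less_one closed_csubspaceD(7)[OF H] bl])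
       (auto simp: orth_proj_id[OF H] unitary_between_norm[OF U] complete_eq_closed closed_csubspaceD(1)[OF H])
  moreover have "(\<lambda>x. ?L (orth_proj H x)) ` H = K"
    unfolding K_def by (intro image_cong refl) (simp add: orth_proj_id[OF H])
  ultimately have "closed K" by (simp add: complete_eq_closed)
  moreover have "x + y \<in> K" if "x \<in> K" "y \<in> K" for x y
    using that closed_csubspaceD(3)[OF H] by (auto simp: K_def add[symmetric])
  moreover have "a *\<^sub>C x \<in> K" if "x \<in> K" for a x
    using that closed_csubspaceD(4)[OF H] by (auto simp: K_def scale[symmetric])
  moreover have "0 \<in> K" using L0 closed_csubspaceD(2)[OF H] by (force simp: K_def)
  ultimately have cK: "closed_csubspace K" by (simp add: closed_csubspace_def)
  have inv: "invariant_subspace left_regular K"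
    using cK pi by (auto simp: invariant_subspace_def K_def comm[symmetric])
  obtain x where x: "x \<in> H" "x \<noteq> 0" using H0 closed_csubspaceD(2)[OF H] by blast
  have Lx: "?L y \<noteq> 0" if "y \<in> H" "y \<noteq> 0" for y
    using unitary_between_norm[OF U that(1)] that(2) by auto
  have "K \<noteq> {0}" using Lx[OF x] x(1) by (auto simp: K_def)
  then have sub: "subrepresentation left_regular K" using inv by (simp add: subrepresentation_def)
  have irrK: "irreducible_on left_regular K"
    by (rule irreducible_transport[OF H U comm pi irr])
  have "\<eta> \<noteq> 0"
  proof
    assume "\<eta> = 0"
    have "\<pi> s 0 = 0" for s
      using unitary_between_norm[OF unit closed_csubspaceD(2)[OF H], of s] by simp
    then have "voice_transform \<pi> \<eta> x = (\<lambda>_. 0)" by (simp add: voice_transform_def fun_eq_iff \<open>\<eta> = 0\<close>)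
    then have "?L x = 0" by (simp add: voice_operator_def zero_l2_def)
    then show False using Lx[OF x] by simp
  qed
  then have "?L \<eta> \<noteq> 0" by (rule Lx[OF \<eta>H])
  moreover have "?L \<eta> \<in> flat_domain"
  proof -
    let ?v = "voice_transform \<pi> \<eta> \<eta>"
    have "flat ?v s = ?v s" for s
    proof -
      have "cinner \<eta> (\<pi> (- s) \<eta>) = cinner (\<pi> s \<eta>) (\<pi> s (\<pi> (- s) \<eta>))"
        by (rule pi_iso[OF \<eta>H pi[OF \<eta>H], symmetric])
      also have "\<pi> s (\<pi> (- s) \<eta>) = \<pi> 0 \<eta>" using hom[OF \<eta>H, of s "- s"] by simp
      \<comment> \<open>That the identity acts trivially is not assumed; it follows from idempotence
        and injectivity of \<open>\<pi> 0\<close>.\<close>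
      also have "\<pi> 0 \<eta> = \<eta>"
      proof -
        have "\<pi> 0 (\<pi> 0 \<eta>) = \<pi> 0 \<eta>" using hom[OF \<eta>H, of 0 0] by simp
        then show ?thesis using unit[of 0] pi[OF \<eta>H] \<eta>H
          by (auto simp: unitary_between_def bij_betw_def inj_on_def)
      qed
      finally show ?thesis
        unfolding flat_def voice_transform_def by (metis cinner_commute)
    qed
    then have fv: "flat ?v = ?v" by blast
    have "AE s in haar. ?v s = rep_l2 (?L \<eta>) s"
      using AE_rep_abs_l2[OF sq[OF \<eta>H]] by (auto simp: voice_operator_def elim: eventually_mono)
    from square_integrable_flat_cong[OF sq[OF \<eta>H] square_integrable_rep this]
    show ?thesis unfolding flat_domain_iff by (simp add: fv sq[OF \<eta>H])
  qed
  moreover have "?L \<eta> \<in> K" using \<eta>H by (simp add: K_def)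
  ultimately have "K \<inter> flat_domain \<noteq> {0}" by blast
  moreover have "unitarily_equivalent \<pi> H left_regular K"
    using U comm by (auto simp: unitarily_equivalent_def)
  ultimately show ?thesis using sub irrK by blast
qed

theorem theorem10:
  fixes \<pi> :: "'g::locally_compact_group \<Rightarrow> 'h::complex_hilbert \<Rightarrow> 'h" and H :: "'h set"
  assumes "unitary_representation \<pi> H" and "irreducible_on \<pi> H"
  shows "((\<exists>\<eta>. admissible \<pi> H \<eta>) \<longleftrightarrow>
           (\<exists>H\<^sub>0 :: 'g l2 set. subrepresentation left_regular H\<^sub>0 \<and> irreducible_on left_regular H\<^sub>0 \<and>
              unitarily_equivalent \<pi> H left_regular H\<^sub>0 \<and> H\<^sub>0 \<inter> flat_domain \<noteq> {0})) \<and>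
         (\<forall>H\<^sub>0 :: 'g l2 set. subrepresentation left_regular H\<^sub>0 \<and> irreducible_on left_regular H\<^sub>0 \<and>
              unitarily_equivalent \<pi> H left_regular H\<^sub>0 \<and> H\<^sub>0 \<inter> flat_domain \<noteq> {0} \<longrightarrow>
           (\<exists>e. H\<^sub>0 \<inter> E_prime = {e} \<and> admissible left_regular H\<^sub>0 e))"
proof (intro conjI iffI allI impI)
  assume "\<exists>\<eta>. admissible \<pi> H \<eta>"
  then show "\<exists>H\<^sub>0 :: 'g l2 set. subrepresentation left_regular H\<^sub>0 \<and> irreducible_on left_regular H\<^sub>0 \<and>
      unitarily_equivalent \<pi> H left_regular H\<^sub>0 \<and> H\<^sub>0 \<inter> flat_domain \<noteq> {0}"
    using admissible_imp_subrepresentation[OF assms] by blast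
next
  assume "\<exists>H\<^sub>0 :: 'g l2 set. subrepresentation left_regular H\<^sub>0 \<and> irreducible_on left_regular H\<^sub>0 \<and>
      unitarily_equivalent \<pi> H left_regular H\<^sub>0 \<and> H\<^sub>0 \<inter> flat_domain \<noteq> {0}"
  then obtain K :: "'g l2 set" and U where K: "subrepresentation left_regular K" "irreducible_on left_regular K"
    "K \<inter> flat_domain \<noteq> {0}" and U: "unitary_between H K U" "\<And>s x. x \<in> H \<Longrightarrow> U (\<pi> s x) = left_regular s (U x)"
    unfolding unitarily_equivalent_def by blast
  obtain e where "reproducing K e"
    by (rule subrepresentation_reproducing[OF K])
  then show "\<exists>\<eta>. admissible \<pi> H \<eta>"
    using admissible_transport[OF assms(1) U] by blast
next
  fix K :: "'g l2 set"
  assume K: "subrepresentation left_regular K \<and> irreducible_on left_regular K \<and>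
      unitarily_equivalent \<pi> H left_regular K \<and> K \<inter> flat_domain \<noteq> {0}"
  then obtain e where e: "reproducing K e" "K \<inter> E_prime = {e}"
    using subrepresentation_reproducing by metis
  moreover have "invariant_subspace left_regular K" using K by (simp add: subrepresentation_def)
  ultimately show "\<exists>e. K \<inter> E_prime = {e} \<and> admissible left_regular K e"
    using reproducing_admissible by blast
qed

end
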